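(* Assume (A1) and (A2), let $\alpha \ge \frac12\max\{0,\operatorname{ess\,sup}_{\Omega}(V+\omega)\}+\frac12$, and let $u_g$ be a ground state satisfying the non-degeneracy condition (ND). Then there exists $\delta_0>0$ such that for every initial datum $u^0\in U_{\delta_0}(u_g)\cap\mathcal S_{p+1}$ and every $\tau>0$, the GFALM iterates satisfy $$\|u^n-u_g\|_{H^1}\le C\,e^{-a n\tau/(1+\tau)}\qquad\forall n\in\mathbb N,$$ where $C,a>0$ are constants independent of $n$ and $\tau$.
   Context: Real-valued functions are used throughout. $\Omega\subset\mathbb R^d$ is a bounded box with homogeneous Dirichlet or periodic boundary conditions; $X=H^1(\Omega)$ with these boundary conditions incorporated; $\langle\cdot,\cdot\rangle$ is the $L^2(\Omega)$ inner product. Assumption (A1): $1<p<\frac{d+2}{d-2}$ if $d\ge3$ and $1<p<\infty$ if $d=1,2$; $V\in L^\infty(\Omega)$, $V\ge0$. $\lambda_0:=\inf\{\frac12\|\nabla u\|_{L^2}^2+\int_\Omega V|u|^2:\ u\in X,\|u\|_{L^2}=1\}$; Assumption (A2): $\omega>-\lambda_0$. $Q(u):=\frac12\|\nabla u\|_{L^2}^2+\int_\Omega V|u|^2\,d\mathbf x+\omega\|u\|_{L^2}^2$, $\mathcal A:=-\frac12\Delta+V+\omega$, $\mathcal S_{p+1}:=\{u\in X:\|u\|_{L^{p+1}}=1\}$, $\widetilde\lambda(u):=Q(u)/\|u\|_{L^{p+1}}^{p+1}$. A ground state is $u_g\in\arg\min\{Q(u):u\in\mathcal S_{p+1}\}$,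 with $\mathcal Au_g=\lambda_g|u_g|^{p-1}u_g$, $\lambda_g=Q(u_g)$. Tangent space $\mathcal T_{u_g}:=\{\xi\in X:\langle|u_g|^{p-1}u_g,\xi\rangle=0\}$. (ND): there is $c>0$ with $\langle\mathcal A\xi,\xi\rangle-p\lambda_g\langle|u_g|^{p-1}\xi,\xi\rangle\ge c\|\xi\|_{H^1}^2$ for all $\xi\in\mathcal T_{u_g}$. $U_\delta(u_g):=\{u\in X:\|u-u_g\|_{H^1}\le\delta\}$. GFALM scheme with time step $\tau>0$ and parameter $\alpha\ge0$: given $u^n$, let $\widetilde u^{n+1}\in X$ solve (with the same boundary conditions) $\frac1\tau(\widetilde u^{n+1}-u^n)=-\widetilde\mu^{n+1}$, where $\widetilde\mu^{n+1}=(-\frac12\Delta+\alpha)\widetilde u^{n+1}+(V+\omega-\widetilde\lambda(u^n)|u^n|^{p-1}-\alpha)u^n$, and then set $u^{n+1}=\widetilde u^{n+1}/\|\widetilde u^{n+1}\|_{L^{p+1}}$. *)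

theory Defs
  imports "HOL-Analysis.Analysis" "HOL-Probability.Essential_Supremum"
begin

definition Omega :: "real^'d \<Rightarrow> real^'d \<Rightarrow> (real^'d) set" where
  "Omega a b = box a b"

definition Lint :: "real^'d \<Rightarrow> real^'d \<Rightarrow> (real^'d \<Rightarrow> real) \<Rightarrow> real" where
  "Lint a b f = integral\<^sup>L (lebesgue_on (Omega a b)) f"

fun pd :: "'d list \<Rightarrow> (real^'d \<Rightarrow> real) \<Rightarrow> real^'d \<Rightarrow> real" where
  "pd [] f = f"
| "pd (i # is) f = (\<lambda>x. deriv (\<lambda>t. pd is f (x + t *\<^sub>R axis i 1)) 0)"

definition smooth :: "(real^'d \<Rightarrow> real) \<Rightarrow> bool" where
  "smooth f \<longleftrightarrow> (\<forall>is. continuous_on UNIV (pd is f) \<and>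
      (\<forall>i x. (\<lambda>t. pd is f (x + t *\<^sub>R axis i 1)) differentiable (at 0)))"

definition test_fun :: "real^'d \<Rightarrow> real^'d \<Rightarrow> (real^'d \<Rightarrow> real) \<Rightarrow> bool" where
  "test_fun a b \<phi> \<longleftrightarrow> smooth \<phi> \<and>
     (\<exists>K. compact K \<and> K \<subseteq> Omega a b \<and> (\<forall>x. x \<notin> K \<longrightarrow> \<phi> x = 0))"

definition L2 :: "real^'d \<Rightarrow> real^'d \<Rightarrow> (real^'d \<Rightarrow> real) \<Rightarrow> bool" where
  "L2 a b u \<longleftrightarrow> u \<in> borel_measurable (lebesgue_on (Omega a b)) \<and>
     integrable (lebesgue_on (Omega a b)) (\<lambda>x. (u x)\<^sup>2)"

definition is_weak_grad :: "real^'d \<Rightarrow> real^'d \<Rightarrow> (real^'d \<Rightarrow> real) \<Rightarrow> (real^'d \<Rightarrow> real^'d) \<Rightarrow> bool" where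
  "is_weak_grad a b u g \<longleftrightarrow> (\<forall>i. L2 a b (\<lambda>x. g x $ i) \<and>
     (\<forall>\<phi>. test_fun a b \<phi> \<longrightarrow>
        Lint a b (\<lambda>x. u x * pd [i] \<phi> x) = - Lint a b (\<lambda>x. g x $ i * \<phi> x)))"

definition H1 :: "real^'d \<Rightarrow> real^'d \<Rightarrow> (real^'d \<Rightarrow> real) \<Rightarrow> bool" where
  "H1 a b u \<longleftrightarrow> L2 a b u \<and> (\<exists>g. is_weak_grad a b u g)"

definition wgrad :: "real^'d \<Rightarrow> real^'d \<Rightarrow> (real^'d \<Rightarrow> real) \<Rightarrow> real^'d \<Rightarrow> real^'d" where
  "wgrad a b u = (SOME g. is_weak_grad a b u g)"

definition L2_inner :: "real^'d \<Rightarrow> real^'d \<Rightarrow> (real^'d \<Rightarrow> real) \<Rightarrow> (real^'d \<Rightarrow> real) \<Rightarrow> real" where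
  "L2_inner a b u v = Lint a b (\<lambda>x. u x * v x)"

definition L2_norm :: "real^'d \<Rightarrow> real^'d \<Rightarrow> (real^'d \<Rightarrow> real) \<Rightarrow> real" where
  "L2_norm a b u = sqrt (Lint a b (\<lambda>x. (u x)\<^sup>2))"

definition grad_sq :: "real^'d \<Rightarrow> real^'d \<Rightarrow> (real^'d \<Rightarrow> real) \<Rightarrow> real" where
  "grad_sq a b u = Lint a b (\<lambda>x. (norm (wgrad a b u x))\<^sup>2)"

definition H1_norm :: "real^'d \<Rightarrow> real^'d \<Rightarrow> (real^'d \<Rightarrow> real) \<Rightarrow> real" where
  "H1_norm a b u = sqrt (Lint a b (\<lambda>x. (u x)\<^sup>2) + grad_sq a b u)"

definition Lp_norm :: "real^'d \<Rightarrow> real^'d \<Rightarrow> real \<Rightarrow> (real^'d \<Rightarrow> real) \<Rightarrow> real" where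
  "Lp_norm a b q u = (Lint a b (\<lambda>x. \<bar>u x\<bar> powr q)) powr (1 / q)"

definition H1_0 :: "real^'d \<Rightarrow> real^'d \<Rightarrow> (real^'d \<Rightarrow> real) \<Rightarrow> bool" where
  "H1_0 a b u \<longleftrightarrow> H1 a b u \<and>
     (\<forall>\<epsilon>>0. \<exists>\<phi>. test_fun a b \<phi> \<and> H1_norm a b (\<lambda>x. u x - \<phi> x) < \<epsilon>)"

definition box_periodic :: "real^'d \<Rightarrow> real^'d \<Rightarrow> (real^'d \<Rightarrow> real) \<Rightarrow> bool" where
  "box_periodic a b \<phi> \<longleftrightarrow> (\<forall>x i. \<phi> (x + (b $ i - a $ i) *\<^sub>R axis i 1) = \<phi> x)"

definition H1_per :: "real^'d \<Rightarrow> real^'d \<Rightarrow> (real^'d \<Rightarrow> real) \<Rightarrow> bool" where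
  "H1_per a b u \<longleftrightarrow> H1 a b u \<and>
     (\<forall>\<epsilon>>0. \<exists>\<phi>. smooth \<phi> \<and> box_periodic a b \<phi> \<and> H1_norm a b (\<lambda>x. u x - \<phi> x) < \<epsilon>)"

datatype bc = Dirichlet | Periodic

definition Xsp :: "bc \<Rightarrow> real^'d \<Rightarrow> real^'d \<Rightarrow> (real^'d \<Rightarrow> real) \<Rightarrow> bool" where
  "Xsp c a b u = (case c of Dirichlet \<Rightarrow> H1_0 a b u | Periodic \<Rightarrow> H1_per a b u)"

definition Qf :: "real^'d \<Rightarrow> real^'d \<Rightarrow> (real^'d \<Rightarrow> real) \<Rightarrow> real \<Rightarrow> (real^'d \<Rightarrow> real) \<Rightarrow> real" where
  "Qf a b V \<omega> u = grad_sq a b u / 2 + Lint a b (\<lambda>x. V x * (u x)\<^sup>2) + \<omega> * (L2_norm a b u)\<^sup>2"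

definition lambda0 :: "bc \<Rightarrow> real^'d \<Rightarrow> real^'d \<Rightarrow> (real^'d \<Rightarrow> real) \<Rightarrow> real" where
  "lambda0 c a b V = Inf {grad_sq a b u / 2 + Lint a b (\<lambda>x. V x * (u x)\<^sup>2) | u.
       Xsp c a b u \<and> L2_norm a b u = 1}"

definition lambda_tilde :: "real^'d \<Rightarrow> real^'d \<Rightarrow> (real^'d \<Rightarrow> real) \<Rightarrow> real \<Rightarrow> real \<Rightarrow> (real^'d \<Rightarrow> real) \<Rightarrow> real" where
  "lambda_tilde a b V \<omega> p u = Qf a b V \<omega> u / (Lp_norm a b (p + 1) u) powr (p + 1)"

definition ground_state :: "bc \<Rightarrow> real^'d \<Rightarrow> real^'d \<Rightarrow> (real^'d \<Rightarrow> real) \<Rightarrow> real \<Rightarrow> real \<Rightarrow> (real^'d \<Rightarrow> real) \<Rightarrow> bool" where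
  "ground_state c a b V \<omega> p ug \<longleftrightarrow> Xsp c a b ug \<and> Lp_norm a b (p + 1) ug = 1 \<and>
     (\<forall>u. Xsp c a b u \<and> Lp_norm a b (p + 1) u = 1 \<longrightarrow> Qf a b V \<omega> ug \<le> Qf a b V \<omega> u)"

text \<open>Non-degeneracy (ND); note <A xi, xi> = Q(xi) for xi in X (weak form).\<close>
definition nondegenerate :: "bc \<Rightarrow> real^'d \<Rightarrow> real^'d \<Rightarrow> (real^'d \<Rightarrow> real) \<Rightarrow> real \<Rightarrow> real \<Rightarrow> (real^'d \<Rightarrow> real) \<Rightarrow> bool" where
  "nondegenerate c a b V \<omega> p ug \<longleftrightarrow> (\<exists>k>0. \<forall>\<xi>. Xsp c a b \<xi> \<and>
       L2_inner a b (\<lambda>x. \<bar>ug x\<bar> powr (p - 1) * ug x) \<xi> = 0 \<longrightarrow>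
       Qf a b V \<omega> \<xi> - p * Qf a b V \<omega> ug * Lint a b (\<lambda>x. \<bar>ug x\<bar> powr (p - 1) * (\<xi> x)\<^sup>2)
         \<ge> k * (H1_norm a b \<xi>)\<^sup>2)"

text \<open>One GFALM step in weak form: ut solves
  (1/tau)(ut - u) = -( (-Delta/2 + alpha) ut + (V + omega - lambda_tilde(u)|u|^{p-1} - alpha) u )
  tested against every v in X (with -Delta/2 weakly: (1/2)<grad ut, grad v>),
  and the new iterate is ut normalised in L^{p+1}.\<close>
definition gfalm_step :: "bc \<Rightarrow> real^'d \<Rightarrow> real^'d \<Rightarrow> (real^'d \<Rightarrow> real) \<Rightarrow> real \<Rightarrow> real \<Rightarrow> real \<Rightarrow> real
     \<Rightarrow> (real^'d \<Rightarrow> real) \<Rightarrow> (real^'d \<Rightarrow> real) \<Rightarrow> (real^'d \<Rightarrow> real) \<Rightarrow> bool" where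
  "gfalm_step c a b V \<omega> p \<tau> \<alpha> u ut u' \<longleftrightarrow> Xsp c a b ut \<and>
     (\<forall>v. Xsp c a b v \<longrightarrow>
        L2_inner a b (\<lambda>x. ut x - u x) v / \<tau> =
        - (Lint a b (\<lambda>x. inner (wgrad a b ut x) (wgrad a b v x)) / 2
           + \<alpha> * L2_inner a b ut v
           + Lint a b (\<lambda>x. (V x + \<omega> - lambda_tilde a b V \<omega> p u * \<bar>u x\<bar> powr (p - 1) - \<alpha>)
                            * u x * v x))) \<and>
     u' = (\<lambda>x. ut x / Lp_norm a b (p + 1) ut)"

end

(*
  A step of the scheme is a preconditioned gradient step for Q on the sphere S_(p+1): with
  w = ut - u one has B(w, v) = - G(u)(v), where B(w, v) = <w, v> / tau + <grad w, grad v> / 2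
  + alpha <w, v> and G(u)(v) = q(u, v) - Q(u) <|u|^(p-1) u, v>.  Hoelder's inequality gives
  ||u + w||^2 >= 1 + 2 <|u|^(p-1) u, w>, whence Q(u') <= Q(u) - (2 B - q)(w, w) / ||u + w||^2 after
  normalisation, and the lower bound on alpha makes 2 B - q comparable to B, for every tau.
  Near u_g, second-order expansions and (ND) show that the energy gap Q(u) - Q(u_g) is comparable
  to the squared H1-error E^2 and that G(u)(u - u_g) >= c E^2; by Cauchy-Schwarz for B this forces
  B(w, w) >= c' E^2 tau / (1 + tau).  Hence the gap contracts by a factor 1 - a tau / (1 + tau),
  which also keeps the iterates close to u_g.

  The only analytic input is the subcritical Sobolev inequality, proved for smooth functions on the
  box without boundary conditions and extended to X by density: u(x) is compared with its mean
  along the paths s -> x + s^k (y - x), and the averages over y of |grad u| along these paths are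
  interpolated between L2 and L-infinity.
*)

theory Submission
  imports Defs
begin

section \<open>Pointwise estimates for power nonlinearities\<close>

text \<open>For p <= 2 the map s -> |s|^(p-1) s is C^1 but not C^2, so no third-order Taylor
  remainder is available. The expansions carry the error \<epsilon> |g|^(p-1) e^2 + C |e|^(p+1)
  instead: its first part is a small multiple of the quadratic term, its second part is o(E^2)
  because p > 1. The step size is felt through two bounds: B lies between half the squared H1-norm
  and (1 + \<alpha>) (1 + \<tau>) / \<tau> times the squared H1-norm. The lower bound limits the
  increment w for every \<tau>; the upper bound is the origin of the rate \<tau> / (1 + \<tau>). The
  estimates near u_g do not involve \<tau>. On the concrete side, \<open>wgrad\<close> is an
  arbitrary choice among weak gradients, so even linearity of the gradient form must be derived, and
  holds through almost-everywhere uniqueness only. This is why bump functions and the fundamental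
  lemma of the calculus of variations appear, and why smooth functions need their weak gradient
  identified with the classical one before the Sobolev inequality applies.\<close>

lemma has_real_derivative_abs_powr_mult:
  fixes p s :: real
  assumes "p > 1"
  shows "((\<lambda>s. \<bar>s\<bar> powr (p - 1) * s) has_real_derivative p * \<bar>s\<bar> powr (p - 1)) (at s)"
proof -
  consider "s > 0" | "s < 0" | "s = 0" by linarith
  then show ?thesis
  proof cases
    case 1
    have "((\<lambda>s. s powr p) has_real_derivative p * \<bar>s\<bar> powr (p - 1)) (at s)"
      using 1 by (auto intro!: derivative_eq_intros)
    moreover have "\<forall>\<^sub>F t in nhds s. t powr p = \<bar>t\<bar> powr (p - 1) * t"
      using eventually_nhds_in_open[of "{0<..}" s] 1
      by (auto elim!: eventually_mono simp: powr_diff)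
    ultimately show ?thesis
      by (subst DERIV_cong_ev[OF refl _ refl, symmetric]) auto
  next
    case 2
    have "((\<lambda>s. - ((- s) powr p)) has_real_derivative p * \<bar>s\<bar> powr (p - 1)) (at s)"
      using 2 by (auto intro!: derivative_eq_intros)
    moreover have "\<forall>\<^sub>F t in nhds s. - ((- t) powr p) = \<bar>t\<bar> powr (p - 1) * t"
      using eventually_nhds_in_open[of "{..<0}" s] 2
      by (auto elim!: eventually_mono simp: powr_diff)
    ultimately show ?thesis
      by (subst DERIV_cong_ev[OF refl _ refl, symmetric]) auto
  next
    case 3
    \<comment> \<open>At 0 the difference quotient is |h|^(p-1), which tends to 0 exactly because p
      > 1.\<close>
    have "((\<lambda>h::real. \<bar>h\<bar> powr (p - 1)) \<longlongrightarrow> \<bar>0\<bar> powr (p - 1)) (at 0)"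
      using assms by (intro tendsto_powr' tendsto_intros) auto
    then have "((\<lambda>h::real. \<bar>h\<bar> powr (p - 1)) \<longlongrightarrow> 0) (at 0)" by simp
    then have "((\<lambda>h::real. (\<bar>0 + h\<bar> powr (p - 1) * (0 + h) - \<bar>0\<bar> powr (p - 1) * 0) / h) \<longlongrightarrow> 0) (at 0)"
      by (rule Lim_transform_eventually) (auto simp: eventually_at_filter)
    then show ?thesis using 3 unfolding DERIV_def by simp
  qed
qed

lemma has_real_derivative_abs_powr:
  fixes p s :: real
  assumes "p > 1"
  shows "((\<lambda>s. \<bar>s\<bar> powr (p + 1)) has_real_derivative (p + 1) * (\<bar>s\<bar> powr (p - 1) * s)) (at s)"
proof -
  have eq: "\<bar>s\<bar> powr (p + 1) = (\<bar>s\<bar> powr (p - 1) * s) * s" for s :: real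
    by (cases "s = 0") (auto simp: powr_add powr_diff abs_if)
  have "((\<lambda>s. (\<bar>s\<bar> powr (p - 1) * s) * s) has_real_derivative (p + 1) * (\<bar>s\<bar> powr (p - 1) * s)) (at s)"
    by (rule derivative_eq_intros has_real_derivative_abs_powr_mult assms refl)+
       (simp add: algebra_simps)
  then show ?thesis by (simp add: eq)
qed

lemma real_mvt_unit:
  fixes f f' :: "real \<Rightarrow> real"
  assumes "\<And>t. (f has_real_derivative f' t) (at t)"
  obtains \<theta> where "0 < \<theta>" "\<theta> < 1" "f 1 - f 0 = f' \<theta>"
  using MVT2[of 0 1 f f'] assms by auto

text \<open>By homogeneity only the ratio of \<open>e\<close> to \<open>g\<close> matters: for a
  small ratio, continuity of |1+s|^r at 0 yields the \<epsilon> term; otherwise |g| is at most a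
  multiple of |e| and both powers are absorbed by the second term. The exponent may be below 1,
  where the power is not differentiable at 0.\<close>

lemma abs_powr_add_diff_le:
  fixes r \<epsilon> :: real
  assumes "r > 0" "\<epsilon> > 0"
  obtains C where "C \<ge> 0"
    "\<And>g e :: real. \<bar>\<bar>g + e\<bar> powr r - \<bar>g\<bar> powr r\<bar> \<le> \<epsilon> * \<bar>g\<bar> powr r + C * \<bar>e\<bar> powr r"
proof -
  have "isCont (\<lambda>s::real. \<bar>1 + s\<bar> powr r) 0"
    by (intro continuous_intros) auto
  then obtain d where d: "d > 0" and D: "\<And>s. \<bar>s\<bar> < d \<Longrightarrow> \<bar>\<bar>1 + s\<bar> powr r - 1\<bar> < \<epsilon>"
    using assms(2) unfolding continuous_at_eps_delta by (auto simp: dist_real_def)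
  \<comment> \<open>The two summands bound |g+e|^r and |g|^r in the case |g| <= |e| / d.\<close>
  define C where "C = (1 / d + 1) powr r + (1 / d) powr r"
  have "\<bar>\<bar>g + e\<bar> powr r - \<bar>g\<bar> powr r\<bar> \<le> \<epsilon> * \<bar>g\<bar> powr r + C * \<bar>e\<bar> powr r" for g e :: real
  proof (cases "\<bar>e\<bar> < d * \<bar>g\<bar>")
    case True
    then have g: "g \<noteq> 0" by auto
    have "\<bar>e / g\<bar> < d" using True g by (simp add: field_simps)
    from D[OF this] have "\<bar>g\<bar> powr r * \<bar>\<bar>1 + e / g\<bar> powr r - 1\<bar> \<le> \<bar>g\<bar> powr r * \<epsilon>"
      by (intro mult_left_mono) auto
    moreover have "\<bar>g + e\<bar> powr r = \<bar>g\<bar> powr r * \<bar>1 + e / g\<bar> powr r"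
    proof -
      have "g + e = g * (1 + e / g)" using g by (simp add: field_simps)
      then have "\<bar>g + e\<bar> = \<bar>g\<bar> * \<bar>1 + e / g\<bar>" by (simp only: abs_mult)
      then show ?thesis by (simp only: powr_mult)
    qed
    moreover have "\<bar>\<bar>g\<bar> powr r * \<bar>1 + e / g\<bar> powr r - \<bar>g\<bar> powr r\<bar> = \<bar>g\<bar> powr r * \<bar>\<bar>1 + e / g\<bar> powr r - 1\<bar>"
    proof -
      have "\<bar>g\<bar> powr r * \<bar>1 + e / g\<bar> powr r - \<bar>g\<bar> powr r = \<bar>g\<bar> powr r * (\<bar>1 + e / g\<bar> powr r - 1)"
        by (simp only: right_diff_distrib mult_1_right)
      then show ?thesis by (simp only: abs_mult abs_of_nonneg[OF powr_ge_zero])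
    qed
    ultimately have "\<bar>\<bar>g + e\<bar> powr r - \<bar>g\<bar> powr r\<bar> \<le> \<epsilon> * \<bar>g\<bar> powr r"
      by (simp only: mult.commute)
    then show ?thesis unfolding C_def
      by (smt (verit) mult_nonneg_nonneg powr_ge_zero)
  next
    case False
    then have ge: "\<bar>g\<bar> \<le> 1 / d * \<bar>e\<bar>" using d by (simp add: field_simps)
    then have "\<bar>g + e\<bar> \<le> (1 / d + 1) * \<bar>e\<bar>" by (simp add: algebra_simps)
    then have "\<bar>g + e\<bar> powr r \<le> ((1 / d + 1) * \<bar>e\<bar>) powr r"
      using assms by (intro powr_mono2) auto
    moreover have "\<bar>g\<bar> powr r \<le> (1 / d * \<bar>e\<bar>) powr r"
      using assms ge by (intro powr_mono2) auto
    ultimately have "\<bar>g + e\<bar> powr r + \<bar>g\<bar> powr r \<le> C * \<bar>e\<bar> powr r"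
      unfolding C_def distrib_right[of "_ powr r"] by (simp only: powr_mult)
    moreover have "0 \<le> \<epsilon> * \<bar>g\<bar> powr r" using assms by simp
    ultimately show ?thesis by (smt (verit) powr_ge_zero)
  qed
  moreover have "C \<ge> 0" unfolding C_def by simp
  ultimately show ?thesis using that by blast
qed

text \<open>The mean value theorem writes the remainder as p e (|g + \<theta> e|^(p-1) - |g|^(p-1)),
  a difference of powers of exponent p - 1 only. No second derivative is used, so 1 < p < 2 is
  covered.\<close>

lemma power_nonlinearity_expansion:
  fixes p \<epsilon> :: real
  assumes p: "p > 1" and "\<epsilon> > 0"
  obtains C where "C \<ge> 0"
    "\<And>g e :: real. \<bar>\<bar>g + e\<bar> powr (p - 1) * (g + e) - \<bar>g\<bar> powr (p - 1) * g - p * \<bar>g\<bar> powr (p - 1) * e\<bar>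
        \<le> \<epsilon> * (\<bar>g\<bar> powr (p - 1) * \<bar>e\<bar>) + C * \<bar>e\<bar> powr p"
proof -
  obtain C where C: "C \<ge> 0"
    and H: "\<And>g e :: real. \<bar>\<bar>g + e\<bar> powr (p - 1) - \<bar>g\<bar> powr (p - 1)\<bar> \<le> \<epsilon> / p * \<bar>g\<bar> powr (p - 1) + C * \<bar>e\<bar> powr (p - 1)"
    using abs_powr_add_diff_le[of "p - 1" "\<epsilon> / p"] assms by auto
  have "\<bar>\<bar>g + e\<bar> powr (p - 1) * (g + e) - \<bar>g\<bar> powr (p - 1) * g - p * \<bar>g\<bar> powr (p - 1) * e\<bar>
        \<le> \<epsilon> * (\<bar>g\<bar> powr (p - 1) * \<bar>e\<bar>) + (p * C) * \<bar>e\<bar> powr p" for g e :: real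
  proof -
    have "((\<lambda>t. \<bar>g + t * e\<bar> powr (p - 1) * (g + t * e)) has_real_derivative
            p * \<bar>g + t * e\<bar> powr (p - 1) * e) (at t)" for t
      by (rule DERIV_chain2[OF has_real_derivative_abs_powr_mult[OF p]])
         (auto intro!: derivative_eq_intros)
    then obtain \<theta> where \<theta>: "0 < \<theta>" "\<theta> < 1"
      and eq: "\<bar>g + e\<bar> powr (p - 1) * (g + e) - \<bar>g\<bar> powr (p - 1) * g = p * \<bar>g + \<theta> * e\<bar> powr (p - 1) * e"
      by (rule real_mvt_unit) auto
    have "\<bar>\<theta> * e\<bar> powr (p - 1) \<le> \<bar>e\<bar> powr (p - 1)"
      using \<theta> p by (intro powr_mono2) (auto simp: abs_mult mult_left_le_one_le)
    then have "\<bar>\<bar>g + \<theta> * e\<bar> powr (p - 1) - \<bar>g\<bar> powr (p - 1)\<bar> \<le> \<epsilon> / p * \<bar>g\<bar> powr (p - 1) + C * \<bar>e\<bar> powr (p - 1)"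
      using H[of g "\<theta> * e"] C by (smt (verit) mult_left_mono)
    then have "p * \<bar>e\<bar> * \<bar>\<bar>g + \<theta> * e\<bar> powr (p - 1) - \<bar>g\<bar> powr (p - 1)\<bar>
        \<le> p * \<bar>e\<bar> * (\<epsilon> / p * \<bar>g\<bar> powr (p - 1) + C * \<bar>e\<bar> powr (p - 1))"
      using p by (intro mult_left_mono) auto
    also have "\<dots> = \<epsilon> * (\<bar>g\<bar> powr (p - 1) * \<bar>e\<bar>) + (p * C) * \<bar>e\<bar> powr p"
    proof -
      have "\<bar>e\<bar> powr p = \<bar>e\<bar> * \<bar>e\<bar> powr (p - 1)"
        by (cases "e = 0") (auto simp: powr_diff)
      then show ?thesis using p by (simp add: algebra_simps)
    qed
    also have "p * \<bar>e\<bar> * \<bar>\<bar>g + \<theta> * e\<bar> powr (p - 1) - \<bar>g\<bar> powr (p - 1)\<bar>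
      = \<bar>\<bar>g + e\<bar> powr (p - 1) * (g + e) - \<bar>g\<bar> powr (p - 1) * g - p * \<bar>g\<bar> powr (p - 1) * e\<bar>"
    proof -
      have "p * \<bar>e\<bar> = \<bar>p * e\<bar>" using p by (simp add: abs_mult)
      then show ?thesis
        unfolding eq by (simp only: abs_mult[symmetric]) (simp add: algebra_simps)
    qed
    finally show ?thesis .
  qed
  then show ?thesis using that[of "p * C"] C p by auto
qed

lemma power_potential_expansion:
  fixes p \<epsilon> :: real
  assumes p: "p > 1" and "\<epsilon> > 0"
  obtains C where "C \<ge> 0"
    "\<And>g e :: real. \<bar>\<bar>g + e\<bar> powr (p + 1) - \<bar>g\<bar> powr (p + 1) - (p + 1) * (\<bar>g\<bar> powr (p - 1) * g * e)
          - (p + 1) * p / 2 * (\<bar>g\<bar> powr (p - 1) * e\<^sup>2)\<bar>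
        \<le> \<epsilon> * (\<bar>g\<bar> powr (p - 1) * e\<^sup>2) + C * \<bar>e\<bar> powr (p + 1)"
proof -
  obtain C where C: "C \<ge> 0"
    and H: "\<And>g e :: real. \<bar>\<bar>g + e\<bar> powr (p - 1) * (g + e) - \<bar>g\<bar> powr (p - 1) * g - p * \<bar>g\<bar> powr (p - 1) * e\<bar>
        \<le> \<epsilon> / (p + 1) * (\<bar>g\<bar> powr (p - 1) * \<bar>e\<bar>) + C * \<bar>e\<bar> powr p"
    using power_nonlinearity_expansion[of p "\<epsilon> / (p + 1)"] assms by auto
  have "\<bar>\<bar>g + e\<bar> powr (p + 1) - \<bar>g\<bar> powr (p + 1) - (p + 1) * (\<bar>g\<bar> powr (p - 1) * g * e)
          - (p + 1) * p / 2 * (\<bar>g\<bar> powr (p - 1) * e\<^sup>2)\<bar>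
        \<le> \<epsilon> * (\<bar>g\<bar> powr (p - 1) * e\<^sup>2) + ((p + 1) * C) * \<bar>e\<bar> powr (p + 1)" for g e :: real
  proof -
    let ?R = "\<lambda>t. \<bar>g + t * e\<bar> powr (p - 1) * (g + t * e) - \<bar>g\<bar> powr (p - 1) * g - p * \<bar>g\<bar> powr (p - 1) * (t * e)"
    \<comment> \<open>Subtracting the quadratic polynomial in t makes the derivative a multiple of
      the remainder of the nonlinearity at \<open>t * e\<close>, so a single use of the mean value
      theorem reduces the second-order expansion to the first-order one.\<close>
    have "((\<lambda>t. \<bar>g + t * e\<bar> powr (p + 1) - t * ((p + 1) * (\<bar>g\<bar> powr (p - 1) * g * e))
            - t\<^sup>2 * ((p + 1) * p / 2 * (\<bar>g\<bar> powr (p - 1) * e\<^sup>2))) has_real_derivative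
            (p + 1) * (?R t * e)) (at t)" for t
    proof -
      have "((\<lambda>t. \<bar>g + t * e\<bar> powr (p + 1)) has_real_derivative
          (p + 1) * (\<bar>g + t * e\<bar> powr (p - 1) * (g + t * e)) * e) (at t)"
        by (rule DERIV_chain2[OF has_real_derivative_abs_powr[OF p]])
           (auto intro!: derivative_eq_intros)
      moreover have "((\<lambda>t. t * a) has_real_derivative a) (at t)" for a
        by (auto intro!: derivative_eq_intros)
      moreover have "((\<lambda>t. t\<^sup>2 * a) has_real_derivative 2 * t * a) (at t)" for a
        by (auto intro!: derivative_eq_intros)
      ultimately show ?thesis
        by (rule DERIV_cong[OF DERIV_diff[OF DERIV_diff]]) (auto simp: algebra_simps power2_eq_square)
    qed
    then obtain \<theta> where \<theta>: "0 < \<theta>" "\<theta> < 1"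
      and eq: "\<bar>g + e\<bar> powr (p + 1) - \<bar>g\<bar> powr (p + 1) - (p + 1) * (\<bar>g\<bar> powr (p - 1) * g * e)
          - (p + 1) * p / 2 * (\<bar>g\<bar> powr (p - 1) * e\<^sup>2) = (p + 1) * (?R \<theta> * e)"
      by (rule real_mvt_unit) simp
    have "\<bar>\<theta> * e\<bar> powr p \<le> \<bar>e\<bar> powr p"
      using \<theta> p by (intro powr_mono2) (auto simp: abs_mult mult_left_le_one_le)
    moreover have "\<bar>\<theta> * e\<bar> \<le> \<bar>e\<bar>"
      using \<theta> by (auto simp: abs_mult mult_left_le_one_le)
    ultimately have "\<epsilon> / (p + 1) * (\<bar>g\<bar> powr (p - 1) * \<bar>\<theta> * e\<bar>) + C * \<bar>\<theta> * e\<bar> powr p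
      \<le> \<epsilon> / (p + 1) * (\<bar>g\<bar> powr (p - 1) * \<bar>e\<bar>) + C * \<bar>e\<bar> powr p"
      using C assms by (intro add_mono mult_left_mono) auto
    then have "\<bar>?R \<theta>\<bar> \<le> \<epsilon> / (p + 1) * (\<bar>g\<bar> powr (p - 1) * \<bar>e\<bar>) + C * \<bar>e\<bar> powr p"
      using H[of g "\<theta> * e"] by linarith
    then have "(p + 1) * \<bar>e\<bar> * \<bar>?R \<theta>\<bar>
        \<le> (p + 1) * \<bar>e\<bar> * (\<epsilon> / (p + 1) * (\<bar>g\<bar> powr (p - 1) * \<bar>e\<bar>) + C * \<bar>e\<bar> powr p)"
      using p by (intro mult_left_mono) auto
    also have "\<dots> = \<epsilon> * (\<bar>g\<bar> powr (p - 1) * (\<bar>e\<bar> * \<bar>e\<bar>)) + ((p + 1) * C) * (\<bar>e\<bar> * \<bar>e\<bar> powr p)"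
    proof -
      have "(p + 1) * X * (\<epsilon> / (p + 1) * (G * X) + C * P) = \<epsilon> * (G * (X * X)) + (p + 1) * C * (X * P)" for X G P
        using p by (simp add: field_simps)
      then show ?thesis .
    qed
    also have "\<bar>e\<bar> * \<bar>e\<bar> = e\<^sup>2" by (simp add: power2_eq_square)
    also have "\<bar>e\<bar> * \<bar>e\<bar> powr p = \<bar>e\<bar> powr (p + 1)" by (simp add: powr_add)
    also have "(p + 1) * \<bar>e\<bar> * \<bar>?R \<theta>\<bar> = \<bar>(p + 1) * (?R \<theta> * e)\<bar>"
      using p by (simp add: abs_mult)
    finally show ?thesis unfolding eq .
  qed
  then show ?thesis using that[of "(p + 1) * C"] C p by auto
qed

text \<open>Weighted arithmetic-geometric mean inequality with weights (p-1)/(p+1), 1/(p+1),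
  1/(p+1), built from the two-term inequality: first y and z with equal weights, then x against
  their mean.\<close>

lemma weighted_Young3:
  fixes x y z p :: real
  assumes p: "p > 1" and "x \<ge> 0" "y \<ge> 0" "z \<ge> 0"
  shows "x powr (p - 1) * y * z \<le> ((p - 1) * x powr (p + 1) + y powr (p + 1) + z powr (p + 1)) / (p + 1)"
proof (cases "x = 0 \<or> y = 0 \<or> z = 0")
  case True
  then show ?thesis using assms by auto
next
  case False
  then have pos: "x > 0" "y > 0" "z > 0" using assms by auto
  let ?X = "x powr (p + 1)" let ?Y = "y powr (p + 1)" let ?Z = "z powr (p + 1)"
  have "y * z = ((?Y) powr (1/2) * (?Z) powr (1/2)) powr (2 / (p + 1))"
  proof -
    have "(p + 1) * (1 / 2 * (2 / (p + 1))) = 1" using p by (simp add: divide_simps)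
    then show ?thesis using pos by (simp only: powr_powr powr_mult mult.assoc) simp
  qed
  also have "\<dots> \<le> (1/2 * ?Y + 1/2 * ?Z) powr (2 / (p + 1))"
    using p pos by (intro powr_mono2 Youngs_inequality_0) auto
  finally have le: "x powr (p - 1) * (y * z) \<le> x powr (p - 1) * (1/2 * ?Y + 1/2 * ?Z) powr (2 / (p + 1))"
    by (intro mult_left_mono) auto
  have X: "x powr (p - 1) = ?X powr ((p - 1) / (p + 1))"
    using p by (simp add: powr_powr)
  note le[unfolded X]
  also have "?X powr ((p - 1) / (p + 1)) * (1/2 * ?Y + 1/2 * ?Z) powr (2 / (p + 1))
     \<le> (p - 1) / (p + 1) * ?X + 2 / (p + 1) * (1/2 * ?Y + 1/2 * ?Z)"
    using p pos by (intro Youngs_inequality_0) (auto simp: add_divide_distrib[symmetric] add_pos_pos)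
  also have "\<dots> = ((p - 1) * ?X + ?Y + ?Z) / (p + 1)"
    using p by (simp add: divide_simps) (simp add: algebra_simps)
  finally show ?thesis by (simp only: X mult.assoc)
qed

text \<open>Serves Cauchy-Schwarz and, with \<open>A = 0\<close>, the Euler-Lagrange equation. The
  degenerate case \<open>C = 0\<close> matters because the forms are only semidefinite.\<close>

lemma discriminant_le:
  fixes A B C :: real
  assumes "\<And>t. 0 \<le> A + 2 * t * B + t\<^sup>2 * C" "C \<ge> 0"
  shows "B\<^sup>2 \<le> A * C"
proof (cases "C = 0")
  case True
  have "B = 0"
  proof (rule ccontr)
    assume "B \<noteq> 0"
    \<comment> \<open>At this t the affine function takes the value -1.\<close>
    then show False using assms(1)[of "- (A + 1) / (2 * B)"] True by (simp add: field_simps)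
  qed
  then show ?thesis using True by simp
next
  case False
  then have "C > 0" using assms by simp
  then show ?thesis using assms(1)[of "- B / C"] 
    by (simp add: power2_eq_square field_simps)
qed

section \<open>Energy spaces\<close>

definition Lnorm :: "'a measure \<Rightarrow> real \<Rightarrow> ('a \<Rightarrow> real) \<Rightarrow> real" where
  "Lnorm M r u = (\<integral>x. \<bar>u x\<bar> powr r \<partial>M) powr (1 / r)"

lemma Lnorm_nonneg [simp]: "0 \<le> Lnorm M r u"
  by (simp add: Lnorm_def)

lemma Lnorm_powr:
  assumes "r > 0"
  shows "Lnorm M r u powr r = (\<integral>x. \<bar>u x\<bar> powr r \<partial>M)"
  using assms by (simp add: Lnorm_def powr_powr integral_nonneg_AE)

lemma Lnorm_scale:
  assumes "r > 0"
  shows "Lnorm M r (\<lambda>x. c * u x) = \<bar>c\<bar> * Lnorm M r u"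
  using assms by (simp add: Lnorm_def abs_mult powr_mult powr_powr integral_nonneg_AE)

text \<open>Hoelder with exponents (p+1)/(p-1), p+1, p+1. The pointwise Young inequality is applied
  to the functions divided by their norms and then integrated; the weights add up to 1.\<close>

lemma Holder_three:
  fixes g e v :: "'a \<Rightarrow> real"
  assumes p: "p > 1"
    and [measurable]: "g \<in> borel_measurable M" "e \<in> borel_measurable M" "v \<in> borel_measurable M"
    and int: "integrable M (\<lambda>x. \<bar>g x\<bar> powr (p + 1))" "integrable M (\<lambda>x. \<bar>e x\<bar> powr (p + 1))"
      "integrable M (\<lambda>x. \<bar>v x\<bar> powr (p + 1))"
  shows "integrable M (\<lambda>x. \<bar>g x\<bar> powr (p - 1) * e x * v x)"
    and "(\<integral>x. \<bar>\<bar>g x\<bar> powr (p - 1) * e x * v x\<bar> \<partial>M)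
           \<le> Lnorm M (p + 1) g powr (p - 1) * Lnorm M (p + 1) e * Lnorm M (p + 1) v"
proof -
  let ?h = "\<lambda>x. \<bar>g x\<bar> powr (p - 1) * e x * v x"
  have abs_h: "\<bar>?h x\<bar> = \<bar>g x\<bar> powr (p - 1) * \<bar>e x\<bar> * \<bar>v x\<bar>" for x
    by (simp add: abs_mult)
  show I: "integrable M ?h"
  proof (rule Bochner_Integration.integrable_bound)
    show "integrable M (\<lambda>x. ((p - 1) * \<bar>g x\<bar> powr (p + 1) + \<bar>e x\<bar> powr (p + 1) + \<bar>v x\<bar> powr (p + 1)) / (p + 1))"
      using int by auto
    show "AE x in M. norm (?h x) \<le> norm (((p - 1) * \<bar>g x\<bar> powr (p + 1) + \<bar>e x\<bar> powr (p + 1) + \<bar>v x\<bar> powr (p + 1)) / (p + 1))"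
      using weighted_Young3[OF p abs_ge_zero abs_ge_zero abs_ge_zero] p
      by (intro AE_I2) (simp only: real_norm_def abs_h, smt (verit))
  qed measurable
  let ?A = "Lnorm M (p + 1) g" let ?B = "Lnorm M (p + 1) e" let ?C = "Lnorm M (p + 1) v"
  \<comment> \<open>Norms may vanish, so the division is by norms increased by \<eta> > 0, and
    \<eta> tends to 0 afterwards.\<close>
  have bound: "(\<integral>x. \<bar>?h x\<bar> \<partial>M) \<le> (?A + \<eta>) powr (p - 1) * (?B + \<eta>) * (?C + \<eta>)" if \<eta>: "\<eta> > 0" for \<eta>
  proof -
    define a b c where abc: "a = ?A + \<eta>" "b = ?B + \<eta>" "c = ?C + \<eta>"
    have pos: "a > 0" "b > 0" "c > 0" unfolding abc by (auto intro: add_nonneg_pos \<eta>)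
    have le: "(\<integral>x. \<bar>u x\<bar> powr (p + 1) \<partial>M) / y powr (p + 1) \<le> 1"
      if "y \<ge> Lnorm M (p + 1) u" "y > 0" for u :: "'a \<Rightarrow> real" and y
      using powr_mono2[OF _ _ that(1), of "p + 1"] p that(2) by (simp add: Lnorm_powr)
    have pt: "\<bar>?h x\<bar> \<le> a powr (p - 1) * b * c * (((p - 1) * (\<bar>g x\<bar> powr (p + 1) / a powr (p + 1))
        + \<bar>e x\<bar> powr (p + 1) / b powr (p + 1) + \<bar>v x\<bar> powr (p + 1) / c powr (p + 1)) / (p + 1))" for x
    proof -
      have "\<bar>?h x\<bar> = a powr (p - 1) * b * c * ((\<bar>g x\<bar> / a) powr (p - 1) * (\<bar>e x\<bar> / b) * (\<bar>v x\<bar> / c))"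
        using pos by (simp add: abs_h powr_divide)
      also have "\<dots> \<le> a powr (p - 1) * b * c * (((p - 1) * (\<bar>g x\<bar> / a) powr (p + 1)
        + (\<bar>e x\<bar> / b) powr (p + 1) + (\<bar>v x\<bar> / c) powr (p + 1)) / (p + 1))"
        using pos p by (intro mult_left_mono weighted_Young3) auto
      finally show ?thesis using pos by (simp add: powr_divide)
    qed
    have "(\<integral>x. \<bar>?h x\<bar> \<partial>M) \<le> (\<integral>x. a powr (p - 1) * b * c * (((p - 1) * (\<bar>g x\<bar> powr (p + 1) / a powr (p + 1))
        + \<bar>e x\<bar> powr (p + 1) / b powr (p + 1) + \<bar>v x\<bar> powr (p + 1) / c powr (p + 1)) / (p + 1)) \<partial>M)"
      using I int by (intro integral_mono pt) auto
    also have "\<dots> = a powr (p - 1) * b * c * (((p - 1) * ((\<integral>x. \<bar>g x\<bar> powr (p + 1) \<partial>M) / a powr (p + 1))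
        + (\<integral>x. \<bar>e x\<bar> powr (p + 1) \<partial>M) / b powr (p + 1) + (\<integral>x. \<bar>v x\<bar> powr (p + 1) \<partial>M) / c powr (p + 1)) / (p + 1))"
      using int by simp
    also have "\<dots> \<le> a powr (p - 1) * b * c * (((p - 1) * 1 + 1 + 1) / (p + 1))"
      using pos p \<eta> by (intro mult_left_mono divide_right_mono add_mono le) (auto simp: abc)
    also have "\<dots> = a powr (p - 1) * b * c" using p by simp
    finally show ?thesis unfolding abc .
  qed
  have "((\<lambda>\<eta>. (?A + \<eta>) powr (p - 1) * (?B + \<eta>) * (?C + \<eta>)) \<longlongrightarrow> (?A + 0) powr (p - 1) * (?B + 0) * (?C + 0)) (at_right 0)"
    using p by (intro tendsto_intros tendsto_powr') (auto simp: eventually_at_filter intro: add_nonneg_nonneg always_eventually)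
  then show "(\<integral>x. \<bar>?h x\<bar> \<partial>M) \<le> ?A powr (p - 1) * ?B * ?C"
    by (intro tendsto_lowerbound[where F = "at_right (0::real)"])
       (auto simp: eventually_at_filter bound intro!: always_eventually)
qed

text \<open>Functions are not identified almost everywhere and \<open>X\<close> is a set rather than
  a type, so bilinearity is relativised to \<open>X\<close>. Linearity in the first slot plus
  symmetry gives the second slot. The gradient form is linear only on such a set, since its
  gradients are chosen representatives.\<close>

definition sym_form :: "('a \<Rightarrow> real) set \<Rightarrow> (('a \<Rightarrow> real) \<Rightarrow> ('a \<Rightarrow> real) \<Rightarrow> real) \<Rightarrow> bool" where
  "sym_form X B \<longleftrightarrow> (\<forall>u\<in>X. \<forall>v\<in>X. \<forall>w\<in>X. \<forall>c. B (\<lambda>x. u x + c * v x) w = B u w + c * B v w) \<and>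
     (\<forall>u\<in>X. \<forall>v\<in>X. B u v = B v u)"

lemma sym_form_lincomb:
  "sym_form X B \<Longrightarrow> u \<in> X \<Longrightarrow> v \<in> X \<Longrightarrow> w \<in> X \<Longrightarrow> B (\<lambda>x. u x + c * v x) w = B u w + c * B v w"
  by (auto simp: sym_form_def)

lemma sym_form_commute: "sym_form X B \<Longrightarrow> u \<in> X \<Longrightarrow> v \<in> X \<Longrightarrow> B u v = B v u"
  by (auto simp: sym_form_def)

lemma sym_form_add: "sym_form X B \<Longrightarrow> sym_form X C \<Longrightarrow> sym_form X (\<lambda>u v. B u v + C u v)"
  by (simp add: sym_form_def algebra_simps)

lemma sym_form_diff: "sym_form X B \<Longrightarrow> sym_form X C \<Longrightarrow> sym_form X (\<lambda>u v. B u v - C u v)"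
  by (simp add: sym_form_def algebra_simps)

lemma sym_form_cmult: "sym_form X B \<Longrightarrow> sym_form X (\<lambda>u v. c * B u v)"
  by (simp add: sym_form_def algebra_simps)

lemma sym_form_divide: "sym_form X B \<Longrightarrow> sym_form X (\<lambda>u v. B u v / c)"
  by (simp add: sym_form_def add_divide_distrib)

lemmas sym_form_intros = sym_form_add sym_form_diff sym_form_cmult sym_form_divide

locale function_space =
  fixes X :: "('a \<Rightarrow> real) set"
  assumes lincomb_mem: "u \<in> X \<Longrightarrow> v \<in> X \<Longrightarrow> (\<lambda>x. u x + c * v x) \<in> X"
begin

lemma scale_mem:
  assumes "u \<in> X" shows "(\<lambda>x. c * u x) \<in> X"
  using lincomb_mem[OF assms assms, of "c - 1"] by (simp add: algebra_simps)

lemma diff_mem: "u \<in> X \<Longrightarrow> v \<in> X \<Longrightarrow> (\<lambda>x. u x - v x) \<in> X"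
  using lincomb_mem[of u v "-1"] by simp

context
  fixes B
  assumes B: "sym_form X B"
begin

lemma form_diff: "u \<in> X \<Longrightarrow> v \<in> X \<Longrightarrow> w \<in> X \<Longrightarrow> B (\<lambda>x. u x - v x) w = B u w - B v w"
  using sym_form_lincomb[OF B, of u v w "-1"] by simp

lemma form_diff_right: "u \<in> X \<Longrightarrow> v \<in> X \<Longrightarrow> w \<in> X \<Longrightarrow> B w (\<lambda>x. u x - v x) = B w u - B w v"
  using form_diff[of u v w] sym_form_commute[OF B] by (metis diff_mem)

lemma form_scale:
  assumes "u \<in> X" "w \<in> X" shows "B (\<lambda>x. c * u x) w = c * B u w"
  using sym_form_lincomb[OF B assms(1,1,2), of "c - 1"] by (simp add: algebra_simps)

lemma form_scale_both:
  assumes "u \<in> X" shows "B (\<lambda>x. c * u x) (\<lambda>x. c * u x) = c\<^sup>2 * B u u"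
  using form_scale[OF assms scale_mem[OF assms]] form_scale[OF assms assms]
    sym_form_commute[OF B assms scale_mem[OF assms]]
  by (simp add: power2_eq_square)

lemma form_expand:
  assumes "u \<in> X" "v \<in> X"
  shows "B (\<lambda>x. u x + c * v x) (\<lambda>x. u x + c * v x) = B u u + 2 * c * B u v + c\<^sup>2 * B v v"
proof -
  let ?w = "\<lambda>x. u x + c * v x"
  have w: "?w \<in> X" by (rule lincomb_mem assms)+
  have "B ?w ?w = B u ?w + c * B v ?w" by (rule sym_form_lincomb[OF B assms w])
  also have "B u ?w = B u u + c * B v u"
    using sym_form_lincomb[OF B assms assms(1)] sym_form_commute[OF B assms(1) w] by simp
  also have "B v ?w = B u v + c * B v v"
    using sym_form_lincomb[OF B assms assms(2)] sym_form_commute[OF B assms(2) w] by simp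
  also have "B v u = B u v" by (rule sym_form_commute[OF B assms(2,1)])
  finally show ?thesis by (simp add: algebra_simps power2_eq_square)
qed

lemma form_Cauchy_Schwarz:
  assumes nonneg: "\<And>u. u \<in> X \<Longrightarrow> 0 \<le> B u u" and "u \<in> X" "v \<in> X"
  shows "(B u v)\<^sup>2 \<le> B u u * B v v"
  using form_expand[OF assms(2,3)] nonneg[OF lincomb_mem[OF assms(2,3)]]
  by (intro discriminant_le nonneg assms(3)) simp

lemma form_triangle:
  assumes nonneg: "\<And>u. u \<in> X \<Longrightarrow> 0 \<le> B u u" and uv: "u \<in> X" "v \<in> X"
  shows "sqrt (B (\<lambda>x. u x + c * v x) (\<lambda>x. u x + c * v x)) \<le> sqrt (B u u) + \<bar>c\<bar> * sqrt (B v v)"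
proof (rule real_le_lsqrt)
  have "(B u v)\<^sup>2 \<le> B u u * B v v"
    by (rule form_Cauchy_Schwarz[OF nonneg uv])
  then have "\<bar>B u v\<bar> \<le> sqrt (B u u) * sqrt (B v v)"
    using real_sqrt_le_mono by (fastforce simp: real_sqrt_mult)
  then have "\<bar>c\<bar> * \<bar>B u v\<bar> \<le> \<bar>c\<bar> * (sqrt (B u u) * sqrt (B v v))"
    by (intro mult_left_mono) auto
  then have "c * B u v \<le> \<bar>c\<bar> * (sqrt (B u u) * sqrt (B v v))"
    using abs_ge_self[of "c * B u v"] by (simp add: abs_mult)
  then show "B (\<lambda>x. u x + c * v x) (\<lambda>x. u x + c * v x) \<le> (sqrt (B u u) + \<bar>c\<bar> * sqrt (B v v))\<^sup>2"
    using nonneg uv by (simp add: form_expand[OF uv] power2_sum power_mult_distrib mult_ac)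
  show "0 \<le> sqrt (B u u) + \<bar>c\<bar> * sqrt (B v v)" using nonneg uv by simp
qed

end

end

text \<open>Turns the |e|^(p+1) errors into an arbitrarily small multiple of the squared
  H1-error.\<close>

lemma small_powr_bound:
  fixes C \<epsilon> p :: real
  assumes "p > 1" "\<epsilon> > 0" "C \<ge> 0"
  obtains \<delta> where "\<delta> > 0" "\<And>E. 0 \<le> E \<Longrightarrow> E \<le> \<delta> \<Longrightarrow> C * E powr (p + 1) \<le> \<epsilon> * E\<^sup>2"
proof
  \<comment> \<open>Chosen so that E^(p-1) <= \<epsilon> / (C + 1); the 1 covers
    \<open>C = 0\<close>.\<close>
  define \<delta> where "\<delta> = (\<epsilon> / (C + 1)) powr (1 / (p - 1))"
  show "\<delta> > 0" using assms by (simp add: \<delta>_def)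
  show "C * E powr (p + 1) \<le> \<epsilon> * E\<^sup>2" if E: "0 \<le> E" "E \<le> \<delta>" for E
  proof (cases "E = 0")
    case False
    have "E powr (p - 1) \<le> \<delta> powr (p - 1)" using E assms by (intro powr_mono2) auto
    also have "\<dots> = \<epsilon> / (C + 1)" using assms by (simp add: \<delta>_def powr_powr)
    finally have "C * E powr (p - 1) \<le> C * (\<epsilon> / (C + 1))" using assms by (intro mult_left_mono)
    also have "\<dots> \<le> \<epsilon>" using assms by (simp add: field_simps)
    finally have "C * E powr (p - 1) * E\<^sup>2 \<le> \<epsilon> * E\<^sup>2" by (intro mult_right_mono) auto
    moreover have "E powr (p + 1) = E powr (p - 1) * E\<^sup>2"
    proof -
      have "E powr (p + 1) = E powr ((p - 1) + 2)" by (simp add: add.commute)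
      also have "\<dots> = E powr (p - 1) * E powr 2" by (rule powr_add)
      finally show ?thesis using E False by (simp add: powr_numeral)
    qed
    ultimately show ?thesis by (simp add: mult.assoc)
  qed auto
qed

text \<open>Collects what the descent argument uses about the domain. Box and boundary conditions
  enter only through \<open>X\<close>, \<open>M\<close> and the semidefinite form \<open>gr\<close>;
  the Sobolev inequality enters as an assumption with constant \<open>S\<close>, to be discharged
  for the concrete spaces at the end.\<close>

locale energy_space = function_space X
  for X :: "('a \<Rightarrow> real) set" +
  fixes M :: "'a measure" and gr :: "('a \<Rightarrow> real) \<Rightarrow> ('a \<Rightarrow> real) \<Rightarrow> real"
    and V :: "'a \<Rightarrow> real" and \<omega> p S KV :: real
  assumes X_meas: "u \<in> X \<Longrightarrow> u \<in> borel_measurable M"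
    and X_sq: "u \<in> X \<Longrightarrow> integrable M (\<lambda>x. (u x)\<^sup>2)"
    and X_pow: "u \<in> X \<Longrightarrow> integrable M (\<lambda>x. \<bar>u x\<bar> powr (p + 1))"
    and gr_form: "sym_form X gr"
    and gr_nonneg: "u \<in> X \<Longrightarrow> 0 \<le> gr u u"
    and V_meas: "V \<in> borel_measurable M"
    and V_bounds: "AE x in M. 0 \<le> V x \<and> V x \<le> KV"
    and p_gt: "p > 1"
    and S_pos: "S > 0" and KV_nonneg: "KV \<ge> 0"
    and Sobolev: "u \<in> X \<Longrightarrow> Lnorm M (p + 1) u \<le> S * sqrt ((\<integral>x. u x * u x \<partial>M) + gr u u)"
begin

definition ip :: "('a \<Rightarrow> real) \<Rightarrow> ('a \<Rightarrow> real) \<Rightarrow> real" where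
  "ip u v = (\<integral>x. u x * v x \<partial>M)"

definition Vf :: "('a \<Rightarrow> real) \<Rightarrow> ('a \<Rightarrow> real) \<Rightarrow> real" where
  "Vf u v = (\<integral>x. V x * u x * v x \<partial>M)"

text \<open>With the weight kept as a separate argument this is bilinear in \<open>u\<close> and
  \<open>v\<close>. \<open>W u u v\<close> is the nonlinear term tested with \<open>v\<close>, and
  \<open>W g \<xi> \<xi>\<close> is the weighted integral in (ND).\<close>

definition W :: "('a \<Rightarrow> real) \<Rightarrow> ('a \<Rightarrow> real) \<Rightarrow> ('a \<Rightarrow> real) \<Rightarrow> real" where
  "W g u v = (\<integral>x. \<bar>g x\<bar> powr (p - 1) * u x * v x \<partial>M)"

definition q :: "('a \<Rightarrow> real) \<Rightarrow> ('a \<Rightarrow> real) \<Rightarrow> real" where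
  "q u v = gr u v / 2 + Vf u v + \<omega> * ip u v"

definition H :: "('a \<Rightarrow> real) \<Rightarrow> ('a \<Rightarrow> real) \<Rightarrow> real" where
  "H u v = ip u v + gr u v"

definition hn :: "('a \<Rightarrow> real) \<Rightarrow> real" where
  "hn u = sqrt (H u u)"

abbreviation nrm :: "('a \<Rightarrow> real) \<Rightarrow> real" where
  "nrm \<equiv> Lnorm M (p + 1)"

text \<open>Treats \<open>ip\<close>, \<open>Vf\<close> and \<open>W g\<close> at once, with the
  weights 1, \<open>V\<close> and |g|^(p-1).\<close>

lemma weighted_form:
  assumes "\<And>u v. u \<in> X \<Longrightarrow> v \<in> X \<Longrightarrow> integrable M (\<lambda>x. m x * u x * v x)"
  shows "sym_form X (\<lambda>u v. \<integral>x. m x * u x * v x \<partial>M)"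
  unfolding sym_form_def
proof (intro conjI ballI allI)
  fix u v w c assume X: "u \<in> X" "v \<in> X" "w \<in> X"
  have "(\<integral>x. m x * (u x + c * v x) * w x \<partial>M) = (\<integral>x. m x * u x * w x + c * (m x * v x * w x) \<partial>M)"
    by (simp add: algebra_simps)
  also have "\<dots> = (\<integral>x. m x * u x * w x \<partial>M) + c * (\<integral>x. m x * v x * w x \<partial>M)"
    using assms X by simp
  finally show "(\<integral>x. m x * (u x + c * v x) * w x \<partial>M) = (\<integral>x. m x * u x * w x \<partial>M) + c * (\<integral>x. m x * v x * w x \<partial>M)" .
qed (simp add: mult_ac)

lemma ip_integrable:
  assumes "u \<in> X" "v \<in> X"
  shows "integrable M (\<lambda>x. u x * v x)"
proof (rule Bochner_Integration.integrable_bound)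
  show "integrable M (\<lambda>x. (u x)\<^sup>2 + (v x)\<^sup>2)" using X_sq assms by auto
  show "(\<lambda>x. u x * v x) \<in> borel_measurable M" using X_meas assms by measurable
  have "\<bar>s * t\<bar> \<le> s\<^sup>2 + t\<^sup>2" for s t :: real
    using sum_squares_bound[of "\<bar>s\<bar>" "\<bar>t\<bar>"] mult_nonneg_nonneg[of "\<bar>s\<bar>" "\<bar>t\<bar>"]
    unfolding abs_mult power2_abs by linarith
  then show "AE x in M. norm (u x * v x) \<le> norm ((u x)\<^sup>2 + (v x)\<^sup>2)"
    by (intro AE_I2) (simp add: abs_of_nonneg)
qed

lemma V_integrable:
  assumes "u \<in> X" "v \<in> X"
  shows "integrable M (\<lambda>x. V x * u x * v x)"
proof (rule Bochner_Integration.integrable_bound)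
  show "integrable M (\<lambda>x. KV * (u x * v x))" using ip_integrable assms by auto
  show "(\<lambda>x. V x * u x * v x) \<in> borel_measurable M" using X_meas assms V_meas by measurable
  show "AE x in M. norm (V x * u x * v x) \<le> norm (KV * (u x * v x))"
    using V_bounds by eventually_elim (auto simp: abs_mult mult.assoc intro!: mult_right_mono)
qed

lemma W_integrable:
  assumes "g \<in> X" "u \<in> X" "v \<in> X"
  shows "integrable M (\<lambda>x. \<bar>g x\<bar> powr (p - 1) * u x * v x)"
  by (intro Holder_three(1) p_gt X_meas X_pow assms)

lemma W_abs_bound:
  assumes "g \<in> X" "u \<in> X" "v \<in> X"
  shows "(\<integral>x. \<bar>\<bar>g x\<bar> powr (p - 1) * u x * v x\<bar> \<partial>M) \<le> nrm g powr (p - 1) * nrm u * nrm v"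
  by (intro Holder_three(2) p_gt X_meas X_pow assms)

lemma W_bound:
  assumes "g \<in> X" "u \<in> X" "v \<in> X"
  shows "\<bar>W g u v\<bar> \<le> nrm g powr (p - 1) * nrm u * nrm v"
  unfolding W_def using integral_abs_bound W_abs_bound[OF assms] by (rule order_trans)

lemma ip_form: "sym_form X ip"
  using weighted_form[of "\<lambda>_. 1"] ip_integrable unfolding ip_def[abs_def] by simp

lemma Vf_form: "sym_form X Vf"
  using weighted_form[of V] V_integrable unfolding Vf_def[abs_def] by simp

lemma W_form: "g \<in> X \<Longrightarrow> sym_form X (W g)"
  using weighted_form[of "\<lambda>x. \<bar>g x\<bar> powr (p - 1)"] W_integrable unfolding W_def[abs_def] by simp

lemma q_form: "sym_form X q"
  unfolding q_def[abs_def] by (intro sym_form_intros gr_form ip_form Vf_form)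

lemma H_form: "sym_form X H"
  unfolding H_def[abs_def] by (intro sym_form_intros gr_form ip_form)

lemma ip_nonneg: "0 \<le> ip u u"
  unfolding ip_def by (intro integral_nonneg_AE AE_I2) simp

lemma Vf_nonneg: "0 \<le> Vf u u"
  unfolding Vf_def using V_bounds
  by (intro integral_nonneg_AE) (auto elim!: eventually_mono simp: mult.assoc)

lemma H_nonneg: "u \<in> X \<Longrightarrow> 0 \<le> H u u"
  unfolding H_def using gr_nonneg ip_nonneg by auto

lemma hn_nonneg [simp]: "u \<in> X \<Longrightarrow> 0 \<le> hn u"
  by (simp add: hn_def H_nonneg)

lemma hn_sq: "u \<in> X \<Longrightarrow> (hn u)\<^sup>2 = H u u"
  by (simp add: hn_def H_nonneg)

lemma nrm_le: "u \<in> X \<Longrightarrow> nrm u \<le> S * hn u"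
  using Sobolev by (simp add: hn_def H_def ip_def)

lemma form_hn_bound:
  assumes B: "sym_form X B" and nn: "\<And>u. u \<in> X \<Longrightarrow> 0 \<le> B u u"
    and le: "\<And>u. u \<in> X \<Longrightarrow> B u u \<le> K * H u u" and K: "K \<ge> 0" and uv: "u \<in> X" "v \<in> X"
  shows "\<bar>B u v\<bar> \<le> K * hn u * hn v"
proof -
  have "(B u v)\<^sup>2 \<le> B u u * B v v" by (rule form_Cauchy_Schwarz[OF B nn uv])
  also have "\<dots> \<le> (K * H u u) * (K * H v v)"
    using uv le nn K H_nonneg by (intro mult_mono) auto
  also have "\<dots> = (K * hn u * hn v)\<^sup>2"
    using uv by (simp add: power_mult_distrib hn_sq) (simp add: power2_eq_square)
  finally show ?thesis using K uv by (simp add: abs_le_square_iff[symmetric])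
qed

lemma hn_scale: "u \<in> X \<Longrightarrow> hn (\<lambda>x. c * u x) = \<bar>c\<bar> * hn u"
  by (simp add: hn_def form_scale_both[OF H_form] real_sqrt_mult)

lemma hn_lincomb:
  assumes "u \<in> X" "v \<in> X"
  shows "hn (\<lambda>x. u x + c * v x) \<le> hn u + \<bar>c\<bar> * hn v"
  unfolding hn_def by (rule form_triangle[OF H_form H_nonneg assms])

definition Kq :: real where "Kq = 1 / 2 + KV + \<bar>\<omega>\<bar>"

lemma Kq_pos: "Kq > 0"
  unfolding Kq_def using KV_nonneg by simp

lemma q_bound:
  assumes "u \<in> X" "v \<in> X"
  shows "\<bar>q u v\<bar> \<le> Kq * hn u * hn v"
proof -
  have 1: "\<bar>gr u v\<bar> \<le> 1 * hn u * hn v"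
    by (rule form_hn_bound[OF gr_form]) (use assms gr_nonneg ip_nonneg in \<open>auto simp: H_def\<close>)
  have 2: "\<bar>ip u v\<bar> \<le> 1 * hn u * hn v"
    by (rule form_hn_bound[OF ip_form]) (use assms gr_nonneg ip_nonneg in \<open>auto simp: H_def\<close>)
  have VV: "Vf w w \<le> KV * H w w" if w: "w \<in> X" for w
  proof -
    have "Vf w w \<le> (\<integral>x. KV * (w x * w x) \<partial>M)"
      unfolding Vf_def
    proof (intro integral_mono_AE V_integrable w integrable_mult_right ip_integrable)
      show "AE x in M. V x * w x * w x \<le> KV * (w x * w x)"
        using V_bounds by eventually_elim (auto simp: mult.assoc intro!: mult_right_mono)
    qed
    also have "\<dots> = KV * ip w w" by (simp add: ip_def)
    also have "\<dots> \<le> KV * H w w" using KV_nonneg gr_nonneg[OF w] by (intro mult_left_mono) (auto simp: H_def)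
    finally show ?thesis .
  qed
  have 3: "\<bar>Vf u v\<bar> \<le> KV * hn u * hn v"
    by (rule form_hn_bound[OF Vf_form Vf_nonneg VV KV_nonneg]) (use assms in auto)
  have "\<bar>q u v\<bar> \<le> \<bar>gr u v\<bar> / 2 + \<bar>Vf u v\<bar> + \<bar>\<omega>\<bar> * \<bar>ip u v\<bar>"
    unfolding q_def abs_mult[symmetric] by linarith
  also have "\<dots> \<le> (hn u * hn v) / 2 + KV * hn u * hn v + \<bar>\<omega>\<bar> * (hn u * hn v)"
    using 1 2 3 by (intro add_mono mult_left_mono) auto
  finally show ?thesis by (simp add: Kq_def algebra_simps)
qed

lemma W_self: "W u u u = nrm u powr (p + 1)"
proof -
  have "\<bar>t\<bar> powr (p - 1) * t * t = \<bar>t\<bar> powr (p + 1)" for t :: real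
    by (cases "t = 0") (auto simp: powr_add powr_diff abs_if)
  then show ?thesis using p_gt by (simp add: W_def Lnorm_powr)
qed

end

section \<open>Non-degenerate ground states\<close>

text \<open>The multiplier is \<open>q g g\<close>, and \<open>q_nonneg\<close> is the form in which
  (A2) is used: it makes multiplication by \<open>q g g\<close> or \<open>q u u\<close>
  monotone.\<close>

locale nondegenerate_ground_state = energy_space +
  fixes g :: "'a \<Rightarrow> real" and k :: real
  assumes g_mem: "g \<in> X" and g_norm: "nrm g = 1"
    and g_min: "u \<in> X \<Longrightarrow> nrm u = 1 \<Longrightarrow> q g g \<le> q u u"
    and q_nonneg: "u \<in> X \<Longrightarrow> 0 \<le> q u u"
    and k_pos: "k > 0"
    and nondeg: "\<xi> \<in> X \<Longrightarrow> W g g \<xi> = 0 \<Longrightarrow> k * H \<xi> \<xi> \<le> q \<xi> \<xi> - p * q g g * W g \<xi> \<xi>"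
begin

definition err :: "('a \<Rightarrow> real) \<Rightarrow> 'a \<Rightarrow> real" where
  "err u = (\<lambda>x. u x - g x)"

lemma err_mem: "u \<in> X \<Longrightarrow> err u \<in> X"
  unfolding err_def by (rule diff_mem[OF _ g_mem])

lemma nrm_unit_self: "u \<in> X \<Longrightarrow> nrm u = 1 \<Longrightarrow> W u u u = 1"
  by (simp add: W_self)

lemma unit_W_le: 
  assumes "u \<in> X" "v \<in> X" "nrm u = 1" shows "\<bar>W u u v\<bar> \<le> nrm v"
  using W_bound[OF assms(1,1,2)] assms(3) by simp

text \<open>For a unit vector, \<open>W u u\<close> is the norming functional: it equals 1 at
  \<open>u\<close> and is bounded by the norm. Evaluating it at u + t v bounds that norm from below
  by a supporting affine function. The bound serves both for minimality at \<open>g\<close> and for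
  the normalisation in the scheme.\<close>

lemma unit_nrm_sq_ge:
  assumes u: "u \<in> X" and v: "v \<in> X" and n: "nrm u = 1"
  shows "1 + 2 * t * W u u v \<le> (nrm (\<lambda>x. u x + t * v x))\<^sup>2"
proof -
  let ?w = "\<lambda>x. u x + t * v x"
  have w: "?w \<in> X" by (rule lincomb_mem[OF u v])
  have "W u u ?w = W u u u + t * W u u v"
    using sym_form_lincomb[OF W_form[OF u] u v u, of t] sym_form_commute[OF W_form[OF u] u w]
      sym_form_commute[OF W_form[OF u] u v] by simp
  then have le: "1 + t * W u u v \<le> nrm ?w"
    using unit_W_le[OF u w n] nrm_unit_self[OF u n] by simp
  have sq: "1 + 2 * t * W u u v \<le> (1 + t * W u u v)\<^sup>2"
    by (simp add: power2_sum)
  show ?thesis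
  proof (cases "0 \<le> 1 + t * W u u v")
    case True
    then show ?thesis using le sq power_mono[OF le, of 2] by linarith
  next
    \<comment> \<open>Squaring is not monotone here, but then the left-hand side is negative
      anyway.\<close>
    case False
    then have "1 + 2 * t * W u u v \<le> 0" by simp
    then show ?thesis using zero_le_power2 order_trans by blast
  qed
qed

text \<open>Homogeneity of degree 2 carries minimality from the unit sphere to all of
  \<open>X\<close>, so perturbations of \<open>g\<close> need not be normalised.\<close>

lemma q_ge_nrm_sq:
  assumes u: "u \<in> X"
  shows "q g g * (nrm u)\<^sup>2 \<le> q u u"
proof (cases "nrm u = 0")
  case True
  then show ?thesis using q_nonneg[OF u] by simp
next
  case False
  then have pos: "nrm u > 0" using Lnorm_nonneg[of M "p + 1" u] by linarith
  let ?v = "\<lambda>x. (1 / nrm u) * u x"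
  have "nrm ?v = 1" using pos p_gt by (subst Lnorm_scale) auto
  then have "q g g \<le> q ?v ?v" by (intro g_min scale_mem u)
  also have "\<dots> = (1 / nrm u)\<^sup>2 * q u u" by (rule form_scale_both[OF q_form u])
  finally show ?thesis using pos by (simp add: field_simps)
qed

text \<open>Hoelder's inequality gives the one-sided bound \<open>nrm (g + t v)\<^sup>2 \<ge> 1 + 2 t W g g v\<close>, so
  minimality turns into a nonnegative quadratic polynomial in \<open>t\<close> without constant term, and no
  derivative of the norm is needed.\<close>
lemma Euler_Lagrange:
  assumes v: "v \<in> X"
  shows "q g v = q g g * W g g v"
proof -
  have "0 \<le> 0 + 2 * t * (q g v - q g g * W g g v) + t\<^sup>2 * q v v" for t
  proof -
    have "q g g * (1 + 2 * t * W g g v) \<le> q g g * (nrm (\<lambda>x. g x + t * v x))\<^sup>2"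
      by (intro mult_left_mono unit_nrm_sq_ge g_mem v g_norm q_nonneg)
    also have "\<dots> \<le> q (\<lambda>x. g x + t * v x) (\<lambda>x. g x + t * v x)"
      by (intro q_ge_nrm_sq lincomb_mem g_mem v)
    also have "\<dots> = q g g + 2 * t * q g v + t\<^sup>2 * q v v"
      by (rule form_expand[OF q_form g_mem v])
    finally show ?thesis by (simp add: algebra_simps)
  qed
  then have "(q g v - q g g * W g g v)\<^sup>2 \<le> 0 * q v v"
    by (intro discriminant_le q_nonneg v) auto
  then show ?thesis by simp
qed

lemma W_g_err_bound: 
  assumes "e \<in> X" shows "0 \<le> W g e e" "W g e e \<le> S\<^sup>2 * (hn e)\<^sup>2"
proof -
  show "0 \<le> W g e e"
    unfolding W_def by (intro integral_nonneg_AE AE_I2) (simp add: mult.assoc)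
  have "W g e e \<le> nrm e * nrm e"
    using W_bound[OF g_mem assms assms] by (simp add: g_norm)
  also have "\<dots> \<le> (S * hn e) * (S * hn e)"
    using nrm_le[OF assms] S_pos assms by (intro mult_mono) auto
  finally show "W g e e \<le> S\<^sup>2 * (hn e)\<^sup>2" by (simp add: power2_eq_square mult_ac)
qed

text \<open>Common ending of both integrated expansions. The weight \<epsilon> / 2 / S^2 is chosen
  because \<open>W g e e\<close> is at most S^2 times the squared H1-norm, so each of the two terms
  costs \<epsilon> / 2.\<close>

lemma remainder_absorb:
  assumes "\<epsilon> > 0" "C \<ge> 0"
  obtains \<delta> where "\<delta> > 0"
    "\<And>e. e \<in> X \<Longrightarrow> hn e \<le> \<delta> \<Longrightarrow> \<epsilon> / 2 / S\<^sup>2 * W g e e + C * nrm e powr (p + 1) \<le> \<epsilon> * (hn e)\<^sup>2"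
proof -
  obtain \<delta> where \<delta>: "\<delta> > 0"
    and small: "\<And>E. 0 \<le> E \<Longrightarrow> E \<le> \<delta> \<Longrightarrow> (C * S powr (p + 1)) * E powr (p + 1) \<le> \<epsilon> / 2 * E\<^sup>2"
    using small_powr_bound[OF p_gt, of "\<epsilon> / 2" "C * S powr (p + 1)"] assms by auto
  have "\<epsilon> / 2 / S\<^sup>2 * W g e e + C * nrm e powr (p + 1) \<le> \<epsilon> * (hn e)\<^sup>2"
    if e: "e \<in> X" "hn e \<le> \<delta>" for e
  proof -
    have "nrm e powr (p + 1) \<le> (S * hn e) powr (p + 1)"
      using nrm_le[OF e(1)] p_gt by (intro powr_mono2) auto
    then have "C * nrm e powr (p + 1) \<le> (C * S powr (p + 1)) * hn e powr (p + 1)"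
      using assms by (simp add: powr_mult mult_left_mono mult.assoc)
    moreover have "\<epsilon> / 2 / S\<^sup>2 * W g e e \<le> \<epsilon> / 2 / S\<^sup>2 * (S\<^sup>2 * (hn e)\<^sup>2)"
      using W_g_err_bound(2)[OF e(1)] assms by (intro mult_left_mono) auto
    moreover have "\<epsilon> / 2 / S\<^sup>2 * (S\<^sup>2 * (hn e)\<^sup>2) = \<epsilon> / 2 * (hn e)\<^sup>2" using S_pos by simp
    ultimately show ?thesis using small[of "hn e"] e by simp
  qed
  then show ?thesis using \<delta> that by blast
qed

text \<open>The pointwise expansion is tested with the error itself: the factor |e| turns its two
  error terms into the densities of \<open>W g e e\<close> and of the (p+1)-th power of the norm,
  both controlled by the H1-error.\<close>

lemma nonlinearity_remainder:
  assumes "\<epsilon> > 0"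
  obtains \<delta> where "\<delta> > 0"
    "\<And>u. u \<in> X \<Longrightarrow> hn (err u) \<le> \<delta> \<Longrightarrow>
       \<bar>W u u (err u) - W g g (err u) - p * W g (err u) (err u)\<bar> \<le> \<epsilon> * (hn (err u))\<^sup>2"
proof -
  have \<epsilon>': "\<epsilon> / 2 / S\<^sup>2 > 0" using assms S_pos by simp
  obtain C where C: "C \<ge> 0"
    and pt: "\<And>g e :: real. \<bar>\<bar>g + e\<bar> powr (p - 1) * (g + e) - \<bar>g\<bar> powr (p - 1) * g - p * \<bar>g\<bar> powr (p - 1) * e\<bar>
        \<le> \<epsilon> / 2 / S\<^sup>2 * (\<bar>g\<bar> powr (p - 1) * \<bar>e\<bar>) + C * \<bar>e\<bar> powr p"
    using power_nonlinearity_expansion[OF p_gt \<epsilon>'] by blast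
  obtain \<delta> where \<delta>: "\<delta> > 0"
    and abs: "\<And>e. e \<in> X \<Longrightarrow> hn e \<le> \<delta> \<Longrightarrow> \<epsilon> / 2 / S\<^sup>2 * W g e e + C * nrm e powr (p + 1) \<le> \<epsilon> * (hn e)\<^sup>2"
    using remainder_absorb[OF assms C] by blast
  have "\<bar>W u u (err u) - W g g (err u) - p * W g (err u) (err u)\<bar> \<le> \<epsilon> * (hn (err u))\<^sup>2"
    if u: "u \<in> X" "hn (err u) \<le> \<delta>" for u
  proof -
    define e where "e = err u"
    have e: "e \<in> X" unfolding e_def by (rule err_mem[OF u(1)])
    have ue: "g x + e x = u x" for x by (simp add: e_def err_def)
    let ?r = "\<lambda>x. \<bar>u x\<bar> powr (p - 1) * u x * e x - \<bar>g x\<bar> powr (p - 1) * g x * e x - p * (\<bar>g x\<bar> powr (p - 1) * e x * e x)"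
    have I: "integrable M ?r"
      by (intro Bochner_Integration.integrable_diff integrable_mult_right W_integrable u e g_mem)
    have "\<bar>?r x\<bar> \<le> \<epsilon> / 2 / S\<^sup>2 * (\<bar>g x\<bar> powr (p - 1) * e x * e x) + C * \<bar>e x\<bar> powr (p + 1)" for x
    proof -
      have "\<bar>?r x\<bar> = \<bar>\<bar>g x + e x\<bar> powr (p - 1) * (g x + e x) - \<bar>g x\<bar> powr (p - 1) * g x - p * \<bar>g x\<bar> powr (p - 1) * e x\<bar> * \<bar>e x\<bar>"
        unfolding abs_mult[symmetric] ue by (simp add: algebra_simps)
      also have "\<dots> \<le> (\<epsilon> / 2 / S\<^sup>2 * (\<bar>g x\<bar> powr (p - 1) * \<bar>e x\<bar>) + C * \<bar>e x\<bar> powr p) * \<bar>e x\<bar>"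
        by (intro mult_right_mono pt) auto
      also have "\<dots> = \<epsilon> / 2 / S\<^sup>2 * (\<bar>g x\<bar> powr (p - 1) * (\<bar>e x\<bar> * \<bar>e x\<bar>)) + C * (\<bar>e x\<bar> powr p * \<bar>e x\<bar>)"
        by (simp add: algebra_simps)
      finally show ?thesis by (simp add: powr_add mult.assoc)
    qed
    then have "\<bar>\<integral>x. ?r x \<partial>M\<bar> \<le> (\<integral>x. \<epsilon> / 2 / S\<^sup>2 * (\<bar>g x\<bar> powr (p - 1) * e x * e x) + C * \<bar>e x\<bar> powr (p + 1) \<partial>M)"
      by (intro order_trans[OF integral_abs_bound] integral_mono integrable_abs I
          Bochner_Integration.integrable_add integrable_mult_right W_integrable X_pow e g_mem)
    also have "\<dots> = \<epsilon> / 2 / S\<^sup>2 * W g e e + C * nrm e powr (p + 1)"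
      using W_integrable[OF g_mem e e] X_pow[OF e] p_gt by (simp add: W_def Lnorm_powr)
    also have "\<dots> \<le> \<epsilon> * (hn e)\<^sup>2" using abs e u by (simp add: e_def)
    also have "(\<integral>x. ?r x \<partial>M) = W u u e - W g g e - p * W g e e"
      using W_integrable[OF g_mem e e] W_integrable[OF g_mem g_mem e] W_integrable[OF u(1,1) e]
      by (simp add: W_def)
    finally show ?thesis unfolding e_def .
  qed
  then show ?thesis using \<delta> that by blast
qed

text \<open>Both \<open>u\<close> and \<open>g\<close> have norm 1, so the zeroth-order terms of the
  integrated expansion cancel. What remains says that the component of the error along
  \<open>g\<close> equals -p/2 \<open>W g e e\<close> up to o(E^2).\<close>

lemma potential_remainder:
  assumes "\<epsilon> > 0"
  obtains \<delta> where "\<delta> > 0"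
    "\<And>u. u \<in> X \<Longrightarrow> nrm u = 1 \<Longrightarrow> hn (err u) \<le> \<delta> \<Longrightarrow>
       \<bar>(p + 1) * W g g (err u) + (p + 1) * p / 2 * W g (err u) (err u)\<bar> \<le> \<epsilon> * (hn (err u))\<^sup>2"
proof -
  have \<epsilon>': "\<epsilon> / 2 / S\<^sup>2 > 0" using assms S_pos by simp
  obtain C where C: "C \<ge> 0"
    and pt: "\<And>g e :: real. \<bar>\<bar>g + e\<bar> powr (p + 1) - \<bar>g\<bar> powr (p + 1) - (p + 1) * (\<bar>g\<bar> powr (p - 1) * g * e)
          - (p + 1) * p / 2 * (\<bar>g\<bar> powr (p - 1) * e\<^sup>2)\<bar>
        \<le> \<epsilon> / 2 / S\<^sup>2 * (\<bar>g\<bar> powr (p - 1) * e\<^sup>2) + C * \<bar>e\<bar> powr (p + 1)"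
    using power_potential_expansion[OF p_gt \<epsilon>'] by blast
  obtain \<delta> where \<delta>: "\<delta> > 0"
    and abs: "\<And>e. e \<in> X \<Longrightarrow> hn e \<le> \<delta> \<Longrightarrow> \<epsilon> / 2 / S\<^sup>2 * W g e e + C * nrm e powr (p + 1) \<le> \<epsilon> * (hn e)\<^sup>2"
    using remainder_absorb[OF assms C] by blast
  have "\<bar>(p + 1) * W g g (err u) + (p + 1) * p / 2 * W g (err u) (err u)\<bar> \<le> \<epsilon> * (hn (err u))\<^sup>2"
    if u: "u \<in> X" "nrm u = 1" "hn (err u) \<le> \<delta>" for u
  proof -
    define e where "e = err u"
    have e: "e \<in> X" unfolding e_def by (rule err_mem[OF u(1)])
    have ue: "g x + e x = u x" for x by (simp add: e_def err_def)
    let ?r = "\<lambda>x. \<bar>u x\<bar> powr (p + 1) - \<bar>g x\<bar> powr (p + 1) - (p + 1) * (\<bar>g x\<bar> powr (p - 1) * g x * e x)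
      - (p + 1) * p / 2 * (\<bar>g x\<bar> powr (p - 1) * e x * e x)"
    have I: "integrable M ?r"
      by (intro Bochner_Integration.integrable_diff integrable_mult_right W_integrable X_pow u e g_mem)
    have "\<bar>?r x\<bar> \<le> \<epsilon> / 2 / S\<^sup>2 * (\<bar>g x\<bar> powr (p - 1) * e x * e x) + C * \<bar>e x\<bar> powr (p + 1)" for x
      using pt[of "g x" "e x"] unfolding ue by (simp add: power2_eq_square mult.assoc)
    then have "\<bar>\<integral>x. ?r x \<partial>M\<bar> \<le> (\<integral>x. \<epsilon> / 2 / S\<^sup>2 * (\<bar>g x\<bar> powr (p - 1) * e x * e x) + C * \<bar>e x\<bar> powr (p + 1) \<partial>M)"
      by (intro order_trans[OF integral_abs_bound] integral_mono integrable_abs I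
          Bochner_Integration.integrable_add integrable_mult_right W_integrable X_pow e g_mem)
    also have "\<dots> = \<epsilon> / 2 / S\<^sup>2 * W g e e + C * nrm e powr (p + 1)"
      using W_integrable[OF g_mem e e] X_pow[OF e] p_gt by (simp add: W_def Lnorm_powr)
    also have "\<dots> \<le> \<epsilon> * (hn e)\<^sup>2" using abs e u by (simp add: e_def)
    also have "(\<integral>x. ?r x \<partial>M) = nrm u powr (p + 1) - nrm g powr (p + 1) - (p + 1) * W g g e - (p + 1) * p / 2 * W g e e"
      using W_integrable[OF g_mem e e] W_integrable[OF g_mem g_mem e] X_pow[OF u(1)] X_pow[OF g_mem] p_gt
      by (simp add: W_def Lnorm_powr)
    finally show ?thesis unfolding e_def using u g_norm by simp
  qed
  then show ?thesis using \<delta> that by blast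
qed

lemma nonlinearity_Lipschitz:
  obtains L where "L \<ge> 0"
    "\<And>u v. u \<in> X \<Longrightarrow> v \<in> X \<Longrightarrow> hn (err u) \<le> 1 \<Longrightarrow> \<bar>W u u v - W g g v\<bar> \<le> L * hn (err u) * hn v"
proof -
  obtain C where C: "C \<ge> 0"
    and pt: "\<And>g e :: real. \<bar>\<bar>g + e\<bar> powr (p - 1) * (g + e) - \<bar>g\<bar> powr (p - 1) * g - p * \<bar>g\<bar> powr (p - 1) * e\<bar>
        \<le> 1 * (\<bar>g\<bar> powr (p - 1) * \<bar>e\<bar>) + C * \<bar>e\<bar> powr p"
    using power_nonlinearity_expansion[OF p_gt, of 1] by auto
  \<comment> \<open>The linear part contributes p + 1, namely p from the derivative and 1 from the
    tolerance. The part |e|^p is read as |e|^(p-1) |e|, and Hoelder leaves a factor (S E)^(p-1), at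
    most S^(p-1) since E <= 1.\<close>
  define L where "L = (p + 1) * S\<^sup>2 + C * (S powr (p - 1) * S\<^sup>2)"
  have "\<bar>W u u v - W g g v\<bar> \<le> L * hn (err u) * hn v"
    if u: "u \<in> X" "v \<in> X" "hn (err u) \<le> 1" for u v
  proof -
    define e where "e = err u"
    have e: "e \<in> X" unfolding e_def by (rule err_mem[OF u(1)])
    have ue: "g x + e x = u x" for x by (simp add: e_def err_def)
    let ?r = "\<lambda>x. \<bar>u x\<bar> powr (p - 1) * u x * v x - \<bar>g x\<bar> powr (p - 1) * g x * v x"
    have I: "integrable M ?r"
      by (intro Bochner_Integration.integrable_diff W_integrable u g_mem)
    have "\<bar>?r x\<bar> \<le> (p + 1) * \<bar>\<bar>g x\<bar> powr (p - 1) * e x * v x\<bar> + C * \<bar>\<bar>e x\<bar> powr (p - 1) * e x * v x\<bar>" for x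
    proof -
      have "\<bar>\<bar>g x + e x\<bar> powr (p - 1) * (g x + e x) - \<bar>g x\<bar> powr (p - 1) * g x\<bar>
         \<le> \<bar>p * \<bar>g x\<bar> powr (p - 1) * e x\<bar> + (\<bar>g x\<bar> powr (p - 1) * \<bar>e x\<bar> + C * \<bar>e x\<bar> powr p)"
        using pt[of "g x" "e x"] by linarith
      also have "\<dots> = (p + 1) * (\<bar>g x\<bar> powr (p - 1) * \<bar>e x\<bar>) + C * (\<bar>e x\<bar> powr (p - 1) * \<bar>e x\<bar>)"
      proof -
        have "\<bar>e x\<bar> powr p = \<bar>e x\<bar> powr (p - 1) * \<bar>e x\<bar>"
          by (cases "e x = 0") (auto simp: powr_diff)
        then show ?thesis using p_gt by (simp add: abs_mult algebra_simps)
      qed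
      finally have "\<bar>\<bar>g x + e x\<bar> powr (p - 1) * (g x + e x) - \<bar>g x\<bar> powr (p - 1) * g x\<bar> * \<bar>v x\<bar>
         \<le> ((p + 1) * (\<bar>g x\<bar> powr (p - 1) * \<bar>e x\<bar>) + C * (\<bar>e x\<bar> powr (p - 1) * \<bar>e x\<bar>)) * \<bar>v x\<bar>"
        by (rule mult_right_mono) simp
      then show ?thesis
        unfolding abs_mult[symmetric] ue by (simp add: abs_mult left_diff_distrib distrib_right mult.assoc)
    qed
    then have "\<bar>\<integral>x. ?r x \<partial>M\<bar> \<le> (\<integral>x. (p + 1) * \<bar>\<bar>g x\<bar> powr (p - 1) * e x * v x\<bar> + C * \<bar>\<bar>e x\<bar> powr (p - 1) * e x * v x\<bar> \<partial>M)"
      by (intro order_trans[OF integral_abs_bound] integral_mono integrable_abs I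
          Bochner_Integration.integrable_add integrable_mult_right W_integrable X_pow e g_mem u)
    also have "\<dots> = (p + 1) * (\<integral>x. \<bar>\<bar>g x\<bar> powr (p - 1) * e x * v x\<bar> \<partial>M) + C * (\<integral>x. \<bar>\<bar>e x\<bar> powr (p - 1) * e x * v x\<bar> \<partial>M)"
      using W_integrable[OF g_mem e u(2)] W_integrable[OF e e u(2)] by simp
    also have "\<dots> \<le> (p + 1) * (1 * (S * hn e) * (S * hn v)) + C * (S powr (p - 1) * (S * hn e) * (S * hn v))"
    proof (intro add_mono mult_left_mono)
      have "nrm e powr (p - 1) \<le> (S * hn e) powr (p - 1)"
        using nrm_le[OF e] p_gt by (intro powr_mono2) auto
      also have "\<dots> \<le> S powr (p - 1)"
        using u(3) S_pos e p_gt by (intro powr_mono2) (auto simp: e_def mult_left_le)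
      finally have "nrm e powr (p - 1) * nrm e * nrm v \<le> S powr (p - 1) * (S * hn e) * (S * hn v)"
        using nrm_le[OF e] nrm_le[OF u(2)] S_pos e by (intro mult_mono) auto
      then show "(\<integral>x. \<bar>\<bar>e x\<bar> powr (p - 1) * e x * v x\<bar> \<partial>M) \<le> S powr (p - 1) * (S * hn e) * (S * hn v)"
        using W_abs_bound[OF e e u(2)] by linarith
      have "nrm g powr (p - 1) * nrm e * nrm v \<le> 1 * (S * hn e) * (S * hn v)"
        using nrm_le[OF e] nrm_le[OF u(2)] S_pos e by (intro mult_mono) (auto simp: g_norm)
      then show "(\<integral>x. \<bar>\<bar>g x\<bar> powr (p - 1) * e x * v x\<bar> \<partial>M) \<le> 1 * (S * hn e) * (S * hn v)"
        using W_abs_bound[OF g_mem e u(2)] by linarith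
    qed (use p_gt C in auto)
    also have "\<dots> = L * hn e * hn v" by (simp add: L_def power2_eq_square algebra_simps)
    also have "(\<integral>x. ?r x \<partial>M) = W u u v - W g g v"
      using W_integrable[OF u(1,1,2)] W_integrable[OF g_mem g_mem u(2)] by (simp add: W_def)
    finally show ?thesis unfolding e_def .
  qed
  moreover have "L \<ge> 0" unfolding L_def using C p_gt S_pos by simp
  ultimately show ?thesis using that by blast
qed

end

section \<open>Convergence of the preconditioned descent\<close>

context nondegenerate_ground_state
begin

text \<open>Half the second variation at \<open>g\<close> of the Lagrangian q u u - (2 \<lambda> /
  (p+1)) times the integral of |u|^(p+1), with \<lambda> = \<open>q g g\<close>. Its coercivity on
  the tangent space is (ND).\<close>

definition T :: "('a \<Rightarrow> real) \<Rightarrow> ('a \<Rightarrow> real) \<Rightarrow> real" where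
  "T u v = q u v - p * q g g * W g u v"

definition G :: "('a \<Rightarrow> real) \<Rightarrow> ('a \<Rightarrow> real) \<Rightarrow> real" where
  "G u v = q u v - q u u * W u u v"

lemma T_form: "sym_form X T"
  unfolding T_def[abs_def] by (intro sym_form_intros q_form W_form g_mem)

lemma err_expand:
  assumes "sym_form X B" "u \<in> X"
  shows "B u u = B g g + 2 * B g (err u) + B (err u) (err u)"
  using form_expand[OF assms(1) g_mem err_mem[OF assms(2)], of 1] by (simp add: err_def)

lemma err_split:
  assumes "sym_form X B" "u \<in> X" "v \<in> X"
  shows "B u v = B g v + B (err u) v"
  using sym_form_lincomb[OF assms(1) g_mem err_mem[OF assms(2)] assms(3), of 1] by (simp add: err_def)

lemma T_bound:
  assumes "u \<in> X" "v \<in> X"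
  shows "\<bar>T u v\<bar> \<le> (Kq + p * q g g * S\<^sup>2) * hn u * hn v"
proof -
  have lam: "0 \<le> p * q g g" using p_gt q_nonneg[OF g_mem] by simp
  have "\<bar>W g u v\<bar> \<le> nrm u * nrm v"
    using W_bound[OF g_mem assms] by (simp add: g_norm)
  also have "\<dots> \<le> (S * hn u) * (S * hn v)"
    using nrm_le[OF assms(1)] nrm_le[OF assms(2)] S_pos assms by (intro mult_mono) auto
  finally have "p * q g g * \<bar>W g u v\<bar> \<le> p * q g g * ((S * hn u) * (S * hn v))"
    using lam by (rule mult_left_mono)
  moreover have "\<bar>T u v\<bar> \<le> \<bar>q u v\<bar> + p * q g g * \<bar>W g u v\<bar>"
    unfolding T_def using lam abs_mult[of "p * q g g" "W g u v"] by linarith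
  moreover have "\<bar>q u v\<bar> \<le> Kq * hn u * hn v" by (rule q_bound[OF assms])
  ultimately show ?thesis by (simp add: algebra_simps power2_eq_square)
qed

text \<open>A squeeze: the norming functional of \<open>g\<close> is maximal at \<open>g\<close> on
  the sphere, so \<open>W g g (err u) <= 0\<close>, and that of \<open>u\<close> is maximal at
  \<open>u\<close>, so \<open>W u u (err u) >= 0\<close>. The two values differ by a Lipschitz bound
  times the H1-error, hence by O(E^2), and both lie within that distance of 0.\<close>

lemma constraint_defect:
  obtains L where "L \<ge> 0"
    "\<And>u. u \<in> X \<Longrightarrow> nrm u = 1 \<Longrightarrow> W g g (err u) \<le> 0"
    "\<And>u. u \<in> X \<Longrightarrow> nrm u = 1 \<Longrightarrow> hn (err u) \<le> 1 \<Longrightarrow> \<bar>W g g (err u)\<bar> \<le> L * (hn (err u))\<^sup>2"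
proof -
  obtain L where L: "L \<ge> 0"
    and Lip: "\<And>u v. u \<in> X \<Longrightarrow> v \<in> X \<Longrightarrow> hn (err u) \<le> 1 \<Longrightarrow> \<bar>W u u v - W g g v\<bar> \<le> L * hn (err u) * hn v"
    using nonlinearity_Lipschitz by blast
  have neg: "W g g (err u) \<le> 0" if u: "u \<in> X" "nrm u = 1" for u
    using form_diff_right[OF W_form[OF g_mem] u(1) g_mem g_mem] unit_W_le[OF g_mem u(1) g_norm]
      nrm_unit_self[OF g_mem g_norm] u(2) by (simp add: err_def)
  have pos: "0 \<le> W u u (err u)" if u: "u \<in> X" "nrm u = 1" for u
    using form_diff_right[OF W_form[OF u(1)] u(1) g_mem u(1)] unit_W_le[OF u(1) g_mem u(2)]
      nrm_unit_self[OF u] g_norm by (simp add: err_def)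
  have "\<bar>W g g (err u)\<bar> \<le> L * (hn (err u))\<^sup>2" if u: "u \<in> X" "nrm u = 1" "hn (err u) \<le> 1" for u
    using Lip[OF u(1) err_mem[OF u(1)] u(3)] neg[OF u(1,2)] pos[OF u(1,2)]
    by (simp add: power2_eq_square)
  then show ?thesis using that L neg by blast
qed

text \<open>The error is tangential up to the component along \<open>g\<close>, which is of second order; correcting it
  costs only third-order terms.\<close>
lemma T_coercive:
  obtains \<delta> where "\<delta> > 0" "\<delta> \<le> 1"
    "\<And>u. u \<in> X \<Longrightarrow> nrm u = 1 \<Longrightarrow> hn (err u) \<le> \<delta> \<Longrightarrow> k / 2 * (hn (err u))\<^sup>2 \<le> T (err u) (err u)"
proof -
  obtain L where L: "L \<ge> 0"
    and defect: "\<And>u. u \<in> X \<Longrightarrow> nrm u = 1 \<Longrightarrow> hn (err u) \<le> 1 \<Longrightarrow> \<bar>W g g (err u)\<bar> \<le> L * (hn (err u))\<^sup>2"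
    using constraint_defect by metis
  define K where "K = Kq + p * q g g * S\<^sup>2 + k"
  have K: "K \<ge> 0" unfolding K_def using Kq_pos p_gt q_nonneg[OF g_mem] k_pos by simp
  \<comment> \<open>By (ND) this form is nonnegative on the tangent space; moving
    \<open>k * H\<close> into it means that only one form has to be corrected along
    \<open>g\<close>.\<close>
  let ?T = "\<lambda>u v. T u v - k * H u v"
  have form: "sym_form X ?T" by (intro sym_form_intros T_form H_form)
  have bound: "\<bar>?T u v\<bar> \<le> K * hn u * hn v" if "u \<in> X" "v \<in> X" for u v
  proof -
    have "\<bar>H u v\<bar> \<le> 1 * hn u * hn v" by (rule form_hn_bound[OF H_form]) (use that H_nonneg in auto)
    then have "k * \<bar>H u v\<bar> \<le> k * (hn u * hn v)" using k_pos by (intro mult_left_mono) auto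
    then show ?thesis
      using T_bound[OF that] abs_triangle_ineq4[of "T u v" "k * H u v"]
      unfolding K_def abs_mult[of k] abs_of_pos[OF k_pos] by (simp add: algebra_simps)
  qed
  define N where "N = 2 * L * K * hn g + L\<^sup>2 * K * (hn g)\<^sup>2"
  have N: "N \<ge> 0" unfolding N_def using L K g_mem by simp
  \<comment> \<open>For E <= 1 the two correction terms add up to at most N E times E^2, and this
    choice gives N E <= k / 2.\<close>
  define \<delta> where "\<delta> = min 1 (k / 2 / (N + 1))"
  have "k / 2 * (hn (err u))\<^sup>2 \<le> T (err u) (err u)"
    if u: "u \<in> X" "nrm u = 1" "hn (err u) \<le> \<delta>" for u
  proof -
    define e where "e = err u"
    define s where "s = W g g e"
    define E where "E = hn e"
    have e: "e \<in> X" unfolding e_def by (rule err_mem[OF u(1)])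
    have E: "0 \<le> E" "E \<le> 1" "E \<le> k / 2 / (N + 1)" using e u(3) by (auto simp: E_def e_def \<delta>_def)
    have s: "\<bar>s\<bar> \<le> L * E\<^sup>2"
      using defect[OF u(1,2)] E by (simp add: s_def e_def E_def)
    \<comment> \<open>Since \<open>W g g g = 1\<close>, subtracting s g lands in the tangent
      space.\<close>
    let ?\<xi> = "\<lambda>x. e x + (- s) * g x"
    have \<xi>: "?\<xi> \<in> X" by (rule lincomb_mem[OF e g_mem])
    have "W g ?\<xi> g = W g e g + (- s) * W g g g"
      by (rule sym_form_lincomb[OF W_form[OF g_mem] e g_mem g_mem])
    then have "W g g ?\<xi> = 0"
      using sym_form_commute[OF W_form[OF g_mem] g_mem \<xi>] sym_form_commute[OF W_form[OF g_mem] g_mem e]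
        nrm_unit_self[OF g_mem g_norm] by (simp add: s_def)
    then have "0 \<le> ?T ?\<xi> ?\<xi>" using nondeg[OF \<xi>] by (simp add: T_def)
    also have "?T ?\<xi> ?\<xi> = ?T e e + 2 * (- s) * ?T e g + (- s)\<^sup>2 * ?T g g"
      by (rule form_expand[OF form e g_mem])
    finally have "- ?T e e \<le> \<bar>2 * s * ?T e g\<bar> + s\<^sup>2 * \<bar>?T g g\<bar>"
    proof -
      assume *: "0 \<le> ?T e e + 2 * (- s) * ?T e g + (- s)\<^sup>2 * ?T g g"
      have "s\<^sup>2 * ?T g g \<le> s\<^sup>2 * \<bar>?T g g\<bar>" by (intro mult_left_mono) auto
      moreover have "- (2 * s * ?T e g) \<le> \<bar>2 * s * ?T e g\<bar>" by linarith
      ultimately show ?thesis using * by (simp only: power2_minus mult_minus_right mult_minus_left)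
    qed
    also have "\<dots> \<le> 2 * (L * E\<^sup>2) * (K * E * hn g) + (L * E\<^sup>2)\<^sup>2 * (K * hn g * hn g)"
    proof (intro add_mono)
      show "\<bar>2 * s * ?T e g\<bar> \<le> 2 * (L * E\<^sup>2) * (K * E * hn g)"
        unfolding abs_mult[of "2 * s"] using s bound[OF e g_mem] L by (intro mult_mono) (auto simp: E_def abs_mult)
      have "s\<^sup>2 \<le> (L * E\<^sup>2)\<^sup>2" using s by (metis abs_ge_zero power2_abs power_mono)
      then show "s\<^sup>2 * \<bar>?T g g\<bar> \<le> (L * E\<^sup>2)\<^sup>2 * (K * hn g * hn g)"
        using bound[OF g_mem g_mem] by (intro mult_mono) auto
    qed
    also have "\<dots> = (2 * L * K * hn g * E + L\<^sup>2 * K * (hn g)\<^sup>2 * (E * E)) * E\<^sup>2"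
      by (simp add: power2_eq_square algebra_simps)
    also have "\<dots> \<le> (k / 2) * E\<^sup>2"
    proof (rule mult_right_mono)
      have "E * E \<le> E" using E by (simp add: mult_left_le)
      then have "L\<^sup>2 * K * (hn g)\<^sup>2 * (E * E) \<le> L\<^sup>2 * K * (hn g)\<^sup>2 * E"
        using K by (intro mult_left_mono) auto
      then have "2 * L * K * hn g * E + L\<^sup>2 * K * (hn g)\<^sup>2 * (E * E) \<le> N * E"
        by (simp add: N_def distrib_right)
      also have "\<dots> \<le> N * (k / 2 / (N + 1))" using E N by (intro mult_left_mono) auto
      also have "\<dots> \<le> k / 2" using N k_pos by (simp add: field_simps)
      finally show "2 * L * K * hn g * E + L\<^sup>2 * K * (hn g)\<^sup>2 * (E * E) \<le> k / 2" .
    qed simp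
    finally have "- ?T e e \<le> k / 2 * E\<^sup>2" .
    moreover have "H e e = E\<^sup>2" using hn_sq[OF e] by (simp add: E_def)
    ultimately show ?thesis unfolding e_def[symmetric] E_def[symmetric] by simp
  qed
  moreover have "\<delta> > 0" "\<delta> \<le> 1" unfolding \<delta>_def using k_pos N by auto
  ultimately show ?thesis using that by blast
qed

text \<open>The Euler-Lagrange equation turns the first-order term into the multiplier times the
  normal component of the error, which is itself of second order.\<close>

lemma energy_gap_expand:
  assumes u: "u \<in> X"
  shows "q u u - q g g = 2 * q g g * W g g (err u) + q (err u) (err u)"
  using err_expand[OF q_form u] Euler_Lagrange[OF err_mem[OF u]] by simp

lemma energy_gap_upper:
  assumes u: "u \<in> X" "nrm u = 1"
  shows "q u u - q g g \<le> Kq * (hn (err u))\<^sup>2"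
proof -
  have "W g g (err u) \<le> 0" using constraint_defect u by metis
  then have "q g g * W g g (err u) \<le> 0" using q_nonneg[OF g_mem] by (simp add: mult_nonneg_nonpos)
  moreover have "q (err u) (err u) \<le> Kq * hn (err u) * hn (err u)"
    using q_bound[OF err_mem err_mem, OF u(1) u(1)] by linarith
  ultimately show ?thesis using energy_gap_expand[OF u(1)] by (simp add: power2_eq_square)
qed

text \<open>Quadratic growth of the energy, a Polyak-Lojasiewicz type inequality tested with the
  error, and a bound for \<open>G\<close> that vanishes with the error. The first two start from T
  (err u) (err u) >= k/2 E^2 and lose k/4 in total to the remainders.\<close>

lemma local_estimates:
  obtains \<delta> C where "\<delta> > 0" "\<delta> \<le> 1" "C > 0"
    "\<And>u. u \<in> X \<Longrightarrow> nrm u = 1 \<Longrightarrow> hn (err u) \<le> \<delta> \<Longrightarrow> k / 4 * (hn (err u))\<^sup>2 \<le> q u u - q g g"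
    "\<And>u. u \<in> X \<Longrightarrow> nrm u = 1 \<Longrightarrow> hn (err u) \<le> \<delta> \<Longrightarrow> k / 4 * (hn (err u))\<^sup>2 \<le> G u (err u)"
    "\<And>u v. u \<in> X \<Longrightarrow> nrm u = 1 \<Longrightarrow> hn (err u) \<le> \<delta> \<Longrightarrow> v \<in> X \<Longrightarrow> \<bar>G u v\<bar> \<le> C * hn (err u) * hn v"
proof -
  let ?l = "q g g"
  have l: "0 \<le> ?l" by (rule q_nonneg[OF g_mem])
  obtain \<delta>1 where \<delta>1: "\<delta>1 > 0" "\<delta>1 \<le> 1" and coer:
    "\<And>u. u \<in> X \<Longrightarrow> nrm u = 1 \<Longrightarrow> hn (err u) \<le> \<delta>1 \<Longrightarrow> k / 2 * (hn (err u))\<^sup>2 \<le> T (err u) (err u)"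
    using T_coercive by metis
  \<comment> \<open>Tolerances are divided by \<open>?l + 1\<close>, as \<open>?l\<close> may be 0;
    multiplied by \<open>?l\<close> they cost at most k/8. The factor p + 1 cancels against the one
    in the potential expansion.\<close>
  have "k * (p + 1) / (8 * (?l + 1)) > 0" using k_pos p_gt l by simp
  then obtain \<delta>2 where \<delta>2: "\<delta>2 > 0" and pot: "\<And>u. u \<in> X \<Longrightarrow> nrm u = 1 \<Longrightarrow> hn (err u) \<le> \<delta>2 \<Longrightarrow>
       \<bar>(p + 1) * W g g (err u) + (p + 1) * p / 2 * W g (err u) (err u)\<bar> \<le> k * (p + 1) / (8 * (?l + 1)) * (hn (err u))\<^sup>2"
    using potential_remainder by metis
  have "k / (8 * (?l + 1)) > 0" using k_pos l by simp
  then obtain \<delta>3 where \<delta>3: "\<delta>3 > 0" and nonl: "\<And>u. u \<in> X \<Longrightarrow> hn (err u) \<le> \<delta>3 \<Longrightarrow>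
       \<bar>W u u (err u) - W g g (err u) - p * W g (err u) (err u)\<bar> \<le> k / (8 * (?l + 1)) * (hn (err u))\<^sup>2"
    using nonlinearity_remainder by metis
  obtain L where L: "L \<ge> 0"
    and Lip: "\<And>u v. u \<in> X \<Longrightarrow> v \<in> X \<Longrightarrow> hn (err u) \<le> 1 \<Longrightarrow> \<bar>W u u v - W g g v\<bar> \<le> L * hn (err u) * hn v"
    using nonlinearity_Lipschitz by metis
  \<comment> \<open>The last entry makes the cubic term Kq S E^3 at most k/8 E^2.\<close>
  define \<delta> where "\<delta> = Min {\<delta>1, \<delta>2, \<delta>3, k / (8 * (Kq * S))}"
  define C where "C = Kq + ?l * L + Kq * S"
  have KS: "Kq * S > 0" using Kq_pos S_pos by simp
  have \<delta>: "\<delta> > 0" "\<delta> \<le> 1" using \<delta>1 \<delta>2 \<delta>3 k_pos KS by (auto simp: \<delta>_def min_le_iff_disj)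
  have C: "C > 0" unfolding C_def using Kq_pos l L KS by (simp add: add_pos_nonneg add_nonneg_pos)
  have smallness: "x \<le> k / 8 * E" if "\<bar>y\<bar> \<le> k / (8 * (?l + 1)) * E" "x = ?l * y \<or> x = - (?l * y)" "0 \<le> E" for x y E
  proof -
    have "x \<le> ?l * \<bar>y\<bar>" using that(2) l by (auto simp: abs_if mult_left_mono mult_nonneg_nonpos)
    also have "\<dots> \<le> ?l * (k / (8 * (?l + 1)) * E)" using that l by (intro mult_left_mono) auto
    also have "\<dots> \<le> k / 8 * E"
    proof -
      have "?l * (k / (8 * (?l + 1))) \<le> k / 8" using l k_pos by (simp add: field_simps)
      then show ?thesis using that(3) by (metis mult.assoc mult_right_mono)
    qed
    finally show ?thesis .
  qed
  have gap: "k / 4 * (hn (err u))\<^sup>2 \<le> q u u - ?l"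
    if u: "u \<in> X" "nrm u = 1" "hn (err u) \<le> \<delta>" for u
  proof -
    define e where "e = err u"
    let ?z = "W g g e + p / 2 * W g e e"
    have "\<bar>(p + 1) * ?z\<bar> \<le> k * (p + 1) / (8 * (?l + 1)) * (hn e)\<^sup>2"
      using pot[OF u(1,2)] u(3) by (simp add: \<delta>_def e_def distrib_left mult.assoc)
    then have "(p + 1) * \<bar>?z\<bar> \<le> (p + 1) * (k / (8 * (?l + 1)) * (hn e)\<^sup>2)"
      using p_gt by (simp add: abs_mult mult_ac)
    then have "\<bar>?z\<bar> \<le> k / (8 * (?l + 1)) * (hn e)\<^sup>2"
      using p_gt by (simp only: mult_le_cancel_left_pos)
    then have "- (?l * ?z) \<le> k / 8 * (hn e)\<^sup>2"
      by (rule smallness) auto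
    moreover have "q u u - ?l = T e e + 2 * (?l * ?z)"
      unfolding energy_gap_expand[OF u(1)] e_def T_def by (simp add: algebra_simps)
    moreover have "k / 2 * (hn e)\<^sup>2 \<le> T e e" using coer[OF u(1,2)] u(3) by (simp add: \<delta>_def e_def)
    ultimately show ?thesis unfolding e_def by simp
  qed
  have gap_nonneg: "0 \<le> q u u - ?l" if "u \<in> X" "nrm u = 1" for u
    using g_min[OF that] by simp
  have PL: "k / 4 * (hn (err u))\<^sup>2 \<le> G u (err u)"
    if u: "u \<in> X" "nrm u = 1" "hn (err u) \<le> \<delta>" for u
  proof -
    define e where "e = err u"
    have e: "e \<in> X" unfolding e_def by (rule err_mem[OF u(1)])
    let ?z = "W u u e - W g g e - p * W g e e"
    have "\<bar>?z\<bar> \<le> k / (8 * (?l + 1)) * (hn e)\<^sup>2"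
      using nonl[OF u(1)] u(3) by (simp add: \<delta>_def e_def)
    then have z: "?l * ?z \<le> k / 8 * (hn e)\<^sup>2"
      by (rule smallness) auto
    \<comment> \<open>The Rayleigh quotient in \<open>G\<close> is \<open>q u u\<close>, not
      \<open>?l\<close>. Replacing it costs a product of the gap, O(E^2), with a functional that is
      O(E).\<close>
    have "(q u u - ?l) * W u u e \<le> (Kq * (hn e)\<^sup>2) * (S * hn e)"
    proof -
      have "(q u u - ?l) * W u u e \<le> (q u u - ?l) * (S * hn e)"
        using unit_W_le[OF u(1) e u(2)] nrm_le[OF e] gap_nonneg[OF u(1,2)] by (intro mult_left_mono) auto
      also have "\<dots> \<le> (Kq * (hn e)\<^sup>2) * (S * hn e)"
        using energy_gap_upper[OF u(1,2)] S_pos e by (intro mult_right_mono) (auto simp: e_def)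
      finally show ?thesis .
    qed
    also have "\<dots> = (Kq * S * hn e) * (hn e)\<^sup>2" by (simp add: mult_ac)
    also have "\<dots> \<le> k / 8 * (hn e)\<^sup>2"
    proof (rule mult_right_mono)
      have "Kq * S * hn e \<le> Kq * S * (k / (8 * (Kq * S)))"
        using u(3) KS by (intro mult_left_mono) (auto simp: \<delta>_def e_def)
      then show "Kq * S * hn e \<le> k / 8" using KS
      proof -
        have "Y * (k / (8 * Y)) = k / 8" if "Y > 0" for Y :: real using that by simp
        from this[OF KS] show ?thesis using \<open>Kq * S * hn e \<le> Kq * S * (k / (8 * (Kq * S)))\<close> by simp
      qed
    qed simp
    finally have D: "(q u u - ?l) * W u u e \<le> k / 8 * (hn e)\<^sup>2" .
    have "G u e = T e e - ?l * ?z - (q u u - ?l) * W u u e"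
      unfolding G_def T_def err_split[OF q_form u(1) e] Euler_Lagrange[OF e] e_def[symmetric]
      by (simp add: algebra_simps)
    moreover have "k / 2 * (hn e)\<^sup>2 \<le> T e e" using coer[OF u(1,2)] u(3) by (simp add: \<delta>_def e_def)
    ultimately show ?thesis using z D unfolding e_def by simp
  qed
  have Gb: "\<bar>G u v\<bar> \<le> C * hn (err u) * hn v"
    if u: "u \<in> X" "nrm u = 1" "hn (err u) \<le> \<delta>" and v: "v \<in> X" for u v
  proof -
    define e where "e = err u"
    have e: "e \<in> X" unfolding e_def by (rule err_mem[OF u(1)])
    have E: "0 \<le> hn e" "hn e \<le> 1" using e u(3) \<delta> by (auto simp: e_def)
    have eq: "G u v = q e v - ?l * (W u u v - W g g v) - (q u u - ?l) * W u u v"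
      unfolding G_def err_split[OF q_form u(1) v] Euler_Lagrange[OF v] e_def[symmetric]
      by (simp add: algebra_simps)
    have 1: "\<bar>q e v\<bar> \<le> Kq * hn e * hn v" by (rule q_bound[OF e v])
    have 2: "\<bar>?l * (W u u v - W g g v)\<bar> \<le> ?l * (L * hn e * hn v)"
      using Lip[OF u(1) v] E l by (simp add: abs_mult e_def mult_left_mono)
    have "\<bar>(q u u - ?l) * W u u v\<bar> \<le> (Kq * hn e) * (S * hn v)"
      unfolding abs_mult
    proof (rule mult_mono)
      have "q u u - ?l \<le> Kq * (hn e)\<^sup>2" using energy_gap_upper[OF u(1,2)] by (simp add: e_def)
      also have "\<dots> \<le> Kq * hn e"
        using E Kq_pos by (intro mult_left_mono) (auto simp: power2_eq_square mult_left_le)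
      finally show "\<bar>q u u - ?l\<bar> \<le> Kq * hn e" using gap_nonneg[OF u(1,2)] by simp
      show "\<bar>W u u v\<bar> \<le> S * hn v" using unit_W_le[OF u(1) v u(2)] nrm_le[OF v] by linarith
    qed (use E Kq_pos in auto)
    then show ?thesis using 1 2 unfolding eq C_def e_def[symmetric] by (simp add: algebra_simps)
  qed
  show ?thesis by (rule that[OF \<delta> C gap PL Gb])
qed

text \<open>The preconditioner of the scheme: a step is \<open>u' = (u + w) / nrm (u + w)\<close> with
  \<open>precond \<tau> \<alpha> w = - G u\<close>.\<close>
definition precond :: "real \<Rightarrow> real \<Rightarrow> ('a \<Rightarrow> real) \<Rightarrow> ('a \<Rightarrow> real) \<Rightarrow> real" where
  "precond \<tau> \<alpha> u v = ip u v / \<tau> + gr u v / 2 + \<alpha> * ip u v"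

lemma precond_form: "sym_form X (precond \<tau> \<alpha>)"
  unfolding precond_def[abs_def] by (intro sym_form_intros gr_form ip_form)

lemma precond_nonneg: "\<tau> > 0 \<Longrightarrow> \<alpha> \<ge> 0 \<Longrightarrow> u \<in> X \<Longrightarrow> 0 \<le> precond \<tau> \<alpha> u u"
  unfolding precond_def using gr_nonneg ip_nonneg by simp

context
  fixes \<alpha> :: real
  assumes \<alpha>_ge: "\<alpha> \<ge> 1 / 2"
    and \<alpha>_V: "AE x in M. V x + \<omega> \<le> 2 * \<alpha> - 1"
begin

lemma potential_le_alpha:
  assumes w: "w \<in> X"
  shows "Vf w w + \<omega> * ip w w \<le> (2 * \<alpha> - 1) * ip w w"
proof -
  have "Vf w w + \<omega> * ip w w = (\<integral>x. V x * w x * w x + \<omega> * (w x * w x) \<partial>M)"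
    using V_integrable[OF w w] ip_integrable[OF w w] by (simp add: Vf_def ip_def)
  also have "\<dots> \<le> (\<integral>x. (2 * \<alpha> - 1) * (w x * w x) \<partial>M)"
  proof (rule integral_mono_AE)
    show "AE x in M. V x * w x * w x + \<omega> * (w x * w x) \<le> (2 * \<alpha> - 1) * (w x * w x)"
      using \<alpha>_V
    proof eventually_elim
      case (elim x)
      then have "(V x + \<omega>) * (w x * w x) \<le> (2 * \<alpha> - 1) * (w x * w x)" by (intro mult_right_mono) auto
      then show ?case by (simp add: algebra_simps)
    qed
  qed (intro Bochner_Integration.integrable_add integrable_mult_right V_integrable ip_integrable w)+
  also have "\<dots> = (2 * \<alpha> - 1) * ip w w" by (simp add: ip_def)
  finally show ?thesis .
qed

text \<open>The lower bound on \<open>\<alpha>\<close> makes the explicit treatment of the potential dissipative for every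
  step size.\<close>
lemma dissipation:
  assumes w: "w \<in> X" and \<tau>: "\<tau> > 0"
  shows "precond \<tau> \<alpha> w w \<le> (1 + \<alpha>) * (2 * precond \<tau> \<alpha> w w - q w w)"
proof -
  have ip: "0 \<le> ip w w / \<tau>" using ip_nonneg \<tau> by simp
  \<comment> \<open>In 2 B - q the gradient terms leave gr / 2, and 2 \<alpha> minus the bound 2
    \<alpha> - 1 for the potential leaves one full L2 term.\<close>
  have "2 * (ip w w / \<tau>) + gr w w / 2 + ip w w \<le> 2 * precond \<tau> \<alpha> w w - q w w"
    using potential_le_alpha[OF w] unfolding precond_def q_def by (simp add: algebra_simps)
  then have "(1 + \<alpha>) * (2 * (ip w w / \<tau>) + gr w w / 2 + ip w w) \<le> (1 + \<alpha>) * (2 * precond \<tau> \<alpha> w w - q w w)"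
    using \<alpha>_ge by (intro mult_left_mono) auto
  moreover have "precond \<tau> \<alpha> w w \<le> (1 + \<alpha>) * (2 * (ip w w / \<tau>) + gr w w / 2 + ip w w)"
  proof -
    have "x + y / 2 + \<alpha> * z \<le> (1 + \<alpha>) * (2 * x + y / 2 + z)" if "0 \<le> x" "0 \<le> y" "0 \<le> z" for x y z
      using mult_nonneg_nonneg[of \<alpha> x] mult_nonneg_nonneg[of \<alpha> y] that \<alpha>_ge
      by (simp add: algebra_simps add_divide_distrib)
    from this[OF ip gr_nonneg[OF w] ip_nonneg] show ?thesis unfolding precond_def .
  qed
  ultimately show ?thesis by linarith
qed

text \<open>The term with 1 / \<tau> is dropped, so the constant is independent of the step size; gr
  / 2 and \<alpha> >= 1 / 2 supply the two halves of the H1-norm.\<close>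

lemma precond_lower:
  assumes w: "w \<in> X" and \<tau>: "\<tau> > 0"
  shows "(hn w)\<^sup>2 \<le> 2 * precond \<tau> \<alpha> w w"
proof -
  have "0 \<le> ip w w / \<tau>" using ip_nonneg \<tau> by simp
  moreover have "1 / 2 * ip w w \<le> \<alpha> * ip w w" using \<alpha>_ge ip_nonneg by (intro mult_right_mono) auto
  ultimately show ?thesis unfolding hn_sq[OF w] precond_def H_def by simp
qed

text \<open>(1 + \<tau>) / \<tau> = 1 / \<tau> + 1: the first summand pays for the L2 term of the
  time step, the second for the elliptic part. Its inverse becomes the convergence rate.\<close>

lemma precond_upper:
  assumes w: "w \<in> X" and \<tau>: "\<tau> > 0"
  shows "precond \<tau> \<alpha> w w \<le> (1 + \<alpha>) * ((1 + \<tau>) / \<tau>) * (hn w)\<^sup>2"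
proof -
  have ip: "0 \<le> ip w w / \<tau>" using ip_nonneg \<tau> by simp
  have "(1 + \<alpha>) * ((1 + \<tau>) / \<tau>) * (hn w)\<^sup>2 = (1 + \<alpha>) * (H w w / \<tau> + H w w)"
    using \<tau> by (simp add: hn_sq[OF w] field_simps)
  also have "\<dots> = (1 + \<alpha>) * (ip w w / \<tau> + gr w w / \<tau> + ip w w + gr w w)"
    by (simp add: H_def add_divide_distrib)
  finally have eq: "(1 + \<alpha>) * ((1 + \<tau>) / \<tau>) * (hn w)\<^sup>2 = (1 + \<alpha>) * (ip w w / \<tau> + gr w w / \<tau> + ip w w + gr w w)" .
  have gr: "0 \<le> gr w w / \<tau>" using gr_nonneg[OF w] \<tau> by simp
  have "x + y / 2 + \<alpha> * z \<le> (1 + \<alpha>) * (x + y' + z + y)" if "0 \<le> x" "0 \<le> y" "0 \<le> y'" "0 \<le> z" for x y y' z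
    using mult_nonneg_nonneg[of \<alpha> x] mult_nonneg_nonneg[of \<alpha> y] mult_nonneg_nonneg[of \<alpha> y'] that \<alpha>_ge
    by (simp add: algebra_simps)
  from this[OF ip gr_nonneg[OF w] gr ip_nonneg] show ?thesis unfolding eq precond_def .
qed

text \<open>Besides the energy decrease it records that the error grows at most by a fixed factor.
  This crude bound is what later allows quadratic growth to be applied to the new iterate.\<close>

lemma one_step:
  obtains \<delta> C \<kappa> where "\<delta> > 0" "C \<ge> 1" "\<kappa> > 0"
    "\<And>u. u \<in> X \<Longrightarrow> nrm u = 1 \<Longrightarrow> hn (err u) \<le> \<delta> \<Longrightarrow> k / 4 * (hn (err u))\<^sup>2 \<le> q u u - q g g"
    "\<And>\<tau> u ut. \<tau> > 0 \<Longrightarrow> u \<in> X \<Longrightarrow> nrm u = 1 \<Longrightarrow> hn (err u) \<le> \<delta> \<Longrightarrow> ut \<in> X \<Longrightarrow>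
      \<forall>v\<in>X. precond \<tau> \<alpha> (\<lambda>x. ut x - u x) v = - G u v \<Longrightarrow>
      nrm (\<lambda>x. ut x / nrm ut) = 1 \<and> hn (err (\<lambda>x. ut x / nrm ut)) \<le> C * hn (err u) \<and>
      q (\<lambda>x. ut x / nrm ut) (\<lambda>x. ut x / nrm ut) \<le> q u u - \<kappa> * (\<tau> / (1 + \<tau>)) * (hn (err u))\<^sup>2"
proof -
  obtain \<delta>1 C1 where \<delta>1: "\<delta>1 > 0" "\<delta>1 \<le> 1" and C1: "C1 > 0" and
    gap: "\<And>u. u \<in> X \<Longrightarrow> nrm u = 1 \<Longrightarrow> hn (err u) \<le> \<delta>1 \<Longrightarrow> k / 4 * (hn (err u))\<^sup>2 \<le> q u u - q g g" and
    PL: "\<And>u. u \<in> X \<Longrightarrow> nrm u = 1 \<Longrightarrow> hn (err u) \<le> \<delta>1 \<Longrightarrow> k / 4 * (hn (err u))\<^sup>2 \<le> G u (err u)" and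
    Gb: "\<And>u v. u \<in> X \<Longrightarrow> nrm u = 1 \<Longrightarrow> hn (err u) \<le> \<delta>1 \<Longrightarrow> v \<in> X \<Longrightarrow> \<bar>G u v\<bar> \<le> C1 * hn (err u) * hn v"
    by (rule local_estimates) (rule that)
  \<comment> \<open>The second entry forces \<open>nrm w <= 1 / 2\<close>, hence 1/2 <= r <= 3/2 for
    the normalising factor r.\<close>
  define \<delta> where "\<delta> = min \<delta>1 (1 / (4 * S * C1))"
  define C where "C = 2 * (1 + 2 * C1 + 2 * S * C1 * hn g)"
  \<comment> \<open>(k/4)^2 comes from squaring the inequality for \<open>G u (err u)\<close>, one
    factor 1 + \<alpha> from \<open>precond_upper\<close>, the other from
    \<open>dissipation\<close>, and 4/9 from division by r^2 with r <= 3/2.\<close>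
  define \<kappa> where "\<kappa> = 4 / 9 * (k / 4)\<^sup>2 / (1 + \<alpha>)\<^sup>2"
  have \<delta>: "\<delta> > 0" "\<delta> \<le> \<delta>1" using \<delta>1 S_pos C1 by (auto simp: \<delta>_def)
  have C: "C \<ge> 1" unfolding C_def using C1 S_pos g_mem by (simp add: add_increasing2)
  have \<kappa>: "\<kappa> > 0" unfolding \<kappa>_def using k_pos \<alpha>_ge by simp
  have step: "nrm (\<lambda>x. ut x / nrm ut) = 1 \<and> hn (err (\<lambda>x. ut x / nrm ut)) \<le> C * hn (err u) \<and>
      q (\<lambda>x. ut x / nrm ut) (\<lambda>x. ut x / nrm ut) \<le> q u u - \<kappa> * (\<tau> / (1 + \<tau>)) * (hn (err u))\<^sup>2"
    if \<tau>: "\<tau> > 0" and u: "u \<in> X" "nrm u = 1" "hn (err u) \<le> \<delta>" and ut: "ut \<in> X"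
      and eq': "\<forall>v\<in>X. precond \<tau> \<alpha> (\<lambda>x. ut x - u x) v = - G u v" for \<tau> u ut
  proof -
    define w where "w = (\<lambda>x. ut x - u x)"
    define E where "E = hn (err u)"
    define r where "r = nrm ut"
    define B where "B = precond \<tau> \<alpha> w w"
    note eq = bspec[OF eq']
    have w: "w \<in> X" unfolding w_def by (rule diff_mem[OF ut u(1)])
    have e: "err u \<in> X" by (rule err_mem[OF u(1)])
    have uw: "(\<lambda>x. u x + 1 * w x) = ut" by (simp add: w_def)
    have E0: "0 \<le> E" using e by (simp add: E_def)
    have B_eq: "B = - G u w" using eq[OF w] by (simp add: B_def w_def)
    have u1: "hn (err u) \<le> \<delta>1" using u(3) \<delta> by simp
    \<comment> \<open>Since \<open>B = - G u w\<close>, a lower bound quadratic in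
      \<open>hn w\<close> meets an upper bound linear in \<open>hn w\<close>, and one factor
      cancels.\<close>
    have hw: "hn w \<le> 2 * C1 * E"
    proof (cases "hn w = 0")
      case True
      then show ?thesis using C1 E0 by simp
    next
      case False
      have "(hn w)\<^sup>2 \<le> 2 * B" unfolding B_def by (rule precond_lower[OF w \<tau>])
      also have "\<dots> \<le> 2 * (C1 * E * hn w)"
        using Gb[OF u(1,2) u1 w] unfolding B_eq E_def by linarith
      finally have "hn w * hn w \<le> hn w * (2 * C1 * E)" by (simp add: power2_eq_square mult_ac)
      then show ?thesis using False hn_nonneg[OF w] by (simp add: mult_le_cancel_left)
    qed
    have nw: "nrm w \<le> 2 * S * C1 * E"
    proof -
      have "nrm w \<le> S * hn w" by (rule nrm_le[OF w])
      also have "\<dots> \<le> S * (2 * C1 * E)" using hw S_pos by (intro mult_left_mono) auto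
      finally show ?thesis by (simp add: mult_ac)
    qed
    have half: "2 * S * C1 * E \<le> 1 / 2"
    proof -
      have "2 * S * C1 * E \<le> 2 * S * C1 * (1 / (4 * S * C1))"
        using u(3) S_pos C1 by (intro mult_left_mono) (auto simp: E_def \<delta>_def)
      then show ?thesis using S_pos C1 by simp
    qed
    have r_ge: "1 - nrm w \<le> r"
    proof -
      have "W u ut u = W u u u + 1 * W u w u"
        using sym_form_lincomb[OF W_form[OF u(1)] u(1) w u(1), of 1] unfolding uw .
      then have "W u u ut = 1 + W u u w"
        using sym_form_commute[OF W_form[OF u(1)] u(1) ut] sym_form_commute[OF W_form[OF u(1)] u(1) w]
          nrm_unit_self[OF u(1,2)] by simp
      then show ?thesis using unit_W_le[OF u(1) ut u(2)] unit_W_le[OF u(1) w u(2)] by (simp add: r_def)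
    qed
    then have r_half: "1 / 2 \<le> r" using nw half by linarith
    \<comment> \<open>The triangle inequality for \<open>nrm\<close>, obtained by applying the
      norming functional of \<open>ut\<close> to ut = u + w.\<close>
    have r_le: "r \<le> 1 + nrm w"
    proof -
      have "W ut ut ut = W ut u ut + 1 * W ut w ut"
        using sym_form_lincomb[OF W_form[OF ut] u(1) w ut, of 1] unfolding uw .
      also have "\<dots> \<le> r powr (p - 1) * 1 * r + r powr (p - 1) * nrm w * r"
        using W_bound[OF ut u(1) ut] W_bound[OF ut w ut] u(2) by (simp add: r_def)
      also have "\<dots> = r powr (p - 1) * r * (1 + nrm w)" by (simp add: algebra_simps)
      also have "W ut ut ut = r powr (p - 1) * r * r"
      proof -
        have "W ut ut ut = r powr ((p - 1) + 1 + 1)" by (simp add: W_self r_def)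
        also have "\<dots> = r powr (p - 1) * r powr 1 * r powr 1" by (simp only: powr_add)
        finally show ?thesis using r_half by simp
      qed
      finally have "(r powr (p - 1) * r) * r \<le> (r powr (p - 1) * r) * (1 + nrm w)" .
      moreover have "r powr (p - 1) * r > 0" using r_half by simp
      ultimately show ?thesis by (simp only: mult_le_cancel_left_pos)
    qed
    then have r_32: "r \<le> 3 / 2" using nw half by linarith
    let ?u' = "\<lambda>x. ut x / nrm ut"
    have u'_eq: "?u' = (\<lambda>x. (1 / r) * ut x)" by (simp add: r_def)
    have 1: "nrm ?u' = 1"
      unfolding u'_eq using r_half p_gt by (subst Lnorm_scale) (auto simp: r_def)
    have 2: "hn (err ?u') \<le> C * E"
    proof -
      let ?a = "\<lambda>x. err u x + 1 * w x"
      have a: "?a \<in> X" by (rule lincomb_mem[OF e w])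
      let ?b = "\<lambda>x. ?a x + (1 - r) * g x"
      have b: "?b \<in> X" by (rule lincomb_mem[OF a g_mem])
      \<comment> \<open>ut / r - g = ((u - g) + w + (1 - r) g) / r splits the new error into the old
        one, the increment and the effect of normalising.\<close>
      have "err ?u' = (\<lambda>x. (1 / r) * ?b x)"
        unfolding u'_eq using r_half by (auto simp: err_def w_def field_simps fun_eq_iff)
      then have "hn (err ?u') = \<bar>1 / r\<bar> * hn ?b" by (simp only: hn_scale[OF b])
      also have "\<dots> \<le> 2 * hn ?b"
        using r_half b by (intro mult_right_mono) (auto simp: field_simps)
      also have "hn ?b \<le> hn ?a + \<bar>1 - r\<bar> * hn g" by (rule hn_lincomb[OF a g_mem])
      also have "hn ?a \<le> hn (err u) + \<bar>1\<bar> * hn w" by (rule hn_lincomb[OF e w])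
      also have "\<bar>1 - r\<bar> * hn g \<le> (2 * S * C1 * E) * hn g"
        using r_ge r_le nw g_mem by (intro mult_right_mono) auto
      finally have "hn (err ?u') \<le> 2 * (E + hn w + 2 * S * C1 * E * hn g)" by (simp add: E_def)
      also have "\<dots> \<le> C * E" using hw unfolding C_def by (simp add: algebra_simps)
      finally show ?thesis .
    qed
    have 3: "q ?u' ?u' \<le> q u u - \<kappa> * (\<tau> / (1 + \<tau>)) * E\<^sup>2"
    proof -
      let ?D = "2 * B - q w w"
      have "q ut ut = q u u + 2 * q u w + q w w"
        using form_expand[OF q_form u(1) w, of 1] unfolding uw by simp
      also have "q u w = q u u * W u u w - B" unfolding B_eq G_def by simp
      finally have qut: "q ut ut = q u u * (1 + 2 * 1 * W u u w) - ?D" by (simp add: algebra_simps)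
      also have "\<dots> \<le> q u u * r\<^sup>2 - ?D"
        using unit_nrm_sq_ge[OF u(1) w u(2), of 1] q_nonneg[OF u(1)]
        unfolding uw r_def by (intro diff_right_mono mult_left_mono) auto
      finally have "q ut ut \<le> q u u * r\<^sup>2 - ?D" .
      moreover have "q ?u' ?u' = q ut ut / r\<^sup>2"
        unfolding u'_eq form_scale_both[OF q_form ut] by (simp add: power_divide)
      ultimately have dec: "q ?u' ?u' \<le> q u u - ?D / r\<^sup>2"
        using r_half by (simp add: field_simps)
      have BD: "B \<le> (1 + \<alpha>) * ?D" unfolding B_def by (rule dissipation[OF w \<tau>])
      have B_low: "(k / 4)\<^sup>2 / (1 + \<alpha>) * (\<tau> / (1 + \<tau>)) * E\<^sup>2 \<le> B"
      proof (cases "E = 0")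
        case True
        then show ?thesis using precond_nonneg[OF \<tau> _ w] \<alpha>_ge by (simp add: B_def)
      next
        case False
        have "(k / 4 * E\<^sup>2)\<^sup>2 \<le> (G u (err u))\<^sup>2"
          using PL[OF u(1,2) u1] k_pos by (intro power_mono) (auto simp: E_def)
        also have "\<dots> = (precond \<tau> \<alpha> w (err u))\<^sup>2" using eq[OF e] by (simp add: w_def)
        also have "\<dots> \<le> precond \<tau> \<alpha> w w * precond \<tau> \<alpha> (err u) (err u)"
          using \<alpha>_ge by (intro form_Cauchy_Schwarz[OF precond_form] precond_nonneg \<tau> w e) auto
        also have "\<dots> \<le> B * ((1 + \<alpha>) * ((1 + \<tau>) / \<tau>) * E\<^sup>2)"
          unfolding B_def E_def using \<alpha>_ge by (intro mult_left_mono precond_upper precond_nonneg \<tau> w e) auto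
        finally have "(k / 4)\<^sup>2 * E\<^sup>2 * E\<^sup>2 \<le> B * ((1 + \<alpha>) * ((1 + \<tau>) / \<tau>)) * E\<^sup>2"
          by (simp add: power2_eq_square mult_ac)
        then have "(k / 4)\<^sup>2 * E\<^sup>2 \<le> B * ((1 + \<alpha>) * ((1 + \<tau>) / \<tau>))"
          using False by (simp only: mult_le_cancel_right_pos zero_less_power2 not_False_eq_True)
        then have "(k / 4)\<^sup>2 * E\<^sup>2 / ((1 + \<alpha>) * ((1 + \<tau>) / \<tau>)) \<le> B"
          using \<tau> \<alpha>_ge by (subst pos_divide_le_eq) auto
        then show ?thesis by (simp add: mult_ac)
      qed
      have D_low: "(k / 4)\<^sup>2 / (1 + \<alpha>)\<^sup>2 * (\<tau> / (1 + \<tau>)) * E\<^sup>2 \<le> ?D"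
      proof -
        have "(1 + \<alpha>) * ((k / 4)\<^sup>2 / (1 + \<alpha>)\<^sup>2 * (\<tau> / (1 + \<tau>)) * E\<^sup>2) = (k / 4)\<^sup>2 / (1 + \<alpha>) * (\<tau> / (1 + \<tau>)) * E\<^sup>2"
        proof -
          have "a * (x / a\<^sup>2 * y * z) = x / a * y * z" if "a > 0" for a x y z :: real
            using that by (simp add: power2_eq_square)
          then show ?thesis by this (use \<alpha>_ge in simp)
        qed
        also have "\<dots> \<le> (1 + \<alpha>) * ?D" using B_low BD by linarith
        finally show ?thesis using \<alpha>_ge by (subst (asm) mult_le_cancel_left_pos) auto
      qed
      have D0: "0 \<le> ?D" by (rule order_trans[OF _ D_low]) (use \<tau> in auto)
      have "\<kappa> * (\<tau> / (1 + \<tau>)) * E\<^sup>2 = 4 / 9 * ((k / 4)\<^sup>2 / (1 + \<alpha>)\<^sup>2 * (\<tau> / (1 + \<tau>)) * E\<^sup>2)"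
        by (simp add: \<kappa>_def)
      also have "\<dots> \<le> 4 / 9 * ?D" using D_low by (intro mult_left_mono) auto
      also have "\<dots> \<le> ?D / r\<^sup>2"
      proof -
        have "r\<^sup>2 \<le> (3 / 2)\<^sup>2" using r_32 r_half by (intro power_mono) auto
        then have "4 * r\<^sup>2 \<le> 9" by (simp add: power2_eq_square)
        then have "?D * (4 * r\<^sup>2) \<le> ?D * 9" using D0 by (intro mult_left_mono) auto
        then show ?thesis using r_half by (simp add: field_simps)
      qed
      finally show ?thesis using dec by linarith
    qed
    show ?thesis using 1 2 3 unfolding E_def by blast
  qed
  have gap': "k / 4 * (hn (err u))\<^sup>2 \<le> q u u - q g g" if "u \<in> X" "nrm u = 1" "hn (err u) \<le> \<delta>" for u
    using gap[OF that(1,2)] that(3) \<delta> by simp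
  show ?thesis by (rule that[OF \<delta>(1) C \<kappa> gap' step])
qed

text \<open>The induction keeps the error below \<open>\<delta>1 / C1\<close> rather than
  \<open>\<delta>1\<close>: one step may multiply it by \<open>C1\<close> and still stays where
  quadratic growth holds, and the decayed gap then brings it back below
  \<open>\<delta>1 / C1\<close>. The step equation is assumed for unit iterates only, because only
  there does \<open>lambda_tilde\<close> coincide with the energy.\<close>

lemma exponential_convergence:
  obtains \<delta> C a where "\<delta> > 0" "C > 0" "a > 0"
    "\<And>\<tau> u ut. \<tau> > 0 \<Longrightarrow> u 0 \<in> X \<Longrightarrow> nrm (u 0) = 1 \<Longrightarrow> hn (err (u 0)) \<le> \<delta> \<Longrightarrow>
      (\<And>n. ut (Suc n) \<in> X) \<Longrightarrow>
      (\<And>n. u (Suc n) = (\<lambda>x. ut (Suc n) x / nrm (ut (Suc n)))) \<Longrightarrow>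
      (\<And>n v. u n \<in> X \<Longrightarrow> nrm (u n) = 1 \<Longrightarrow> v \<in> X \<Longrightarrow> precond \<tau> \<alpha> (\<lambda>x. ut (Suc n) x - u n x) v = - G (u n) v) \<Longrightarrow>
      (\<And>n. hn (err (u n)) \<le> C * exp (- a * real n * \<tau> / (1 + \<tau>)))"
proof -
  obtain \<delta>1 C1 \<kappa> where \<delta>1: "\<delta>1 > 0" and C1: "C1 \<ge> 1" and \<kappa>: "\<kappa> > 0" and
    gap: "\<And>u. u \<in> X \<Longrightarrow> nrm u = 1 \<Longrightarrow> hn (err u) \<le> \<delta>1 \<Longrightarrow> k / 4 * (hn (err u))\<^sup>2 \<le> q u u - q g g" and
    step: "\<And>\<tau> u ut. \<tau> > 0 \<Longrightarrow> u \<in> X \<Longrightarrow> nrm u = 1 \<Longrightarrow> hn (err u) \<le> \<delta>1 \<Longrightarrow> ut \<in> X \<Longrightarrow>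
      \<forall>v\<in>X. precond \<tau> \<alpha> (\<lambda>x. ut x - u x) v = - G u v \<Longrightarrow>
      nrm (\<lambda>x. ut x / nrm ut) = 1 \<and> hn (err (\<lambda>x. ut x / nrm ut)) \<le> C1 * hn (err u) \<and>
      q (\<lambda>x. ut x / nrm ut) (\<lambda>x. ut x / nrm ut) \<le> q u u - \<kappa> * (\<tau> / (1 + \<tau>)) * (hn (err u))\<^sup>2"
    by (rule one_step) (rule that)
  \<comment> \<open>Square root of the quotient of the upper constant Kq and the lower constant k/4
    in the comparison of gap and squared error.\<close>
  define K where "K = sqrt (4 * Kq / k)"
  \<comment> \<open>The first entry starts the induction; the second makes
    \<open>K * \<delta>\<close> at most \<open>\<delta>1 / C1\<close>.\<close>
  define \<delta> where "\<delta> = min (\<delta>1 / C1) (\<delta>1 / C1 / (K + 1))"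
  \<comment> \<open>The decrease is \<kappa> E^2 times the rate, and E^2 is at least the gap divided
    by Kq. The gap thus decays at rate c and the error, its square root, at c / 2.\<close>
  define c where "c = \<kappa> / Kq"
  have K: "K \<ge> 0" and K2: "K\<^sup>2 = 4 * Kq / k" using Kq_pos k_pos by (auto simp: K_def)
  have dC: "\<delta>1 / C1 > 0" using \<delta>1 C1 by simp
  have \<delta>: "\<delta> > 0" unfolding \<delta>_def using dC K by (intro min_less_iff_conj[THEN iffD2] conjI divide_pos_pos[OF dC]) auto
  have \<delta>1': "\<delta>1 / C1 \<le> \<delta>1" using \<delta>1 C1 by (simp add: field_simps)
  have c: "c > 0" using \<kappa> Kq_pos by (simp add: c_def)
  define C where "C = K * \<delta> + 1"
  have "hn (err (u n)) \<le> C * exp (- (c / 2) * real n * \<tau> / (1 + \<tau>))"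
    if \<tau>: "\<tau> > 0" and u0: "u 0 \<in> X" "nrm (u 0) = 1" "hn (err (u 0)) \<le> \<delta>"
      and ut: "\<And>n. ut (Suc n) \<in> X"
      and u_Suc: "\<And>n. u (Suc n) = (\<lambda>x. ut (Suc n) x / nrm (ut (Suc n)))"
      and eq: "\<And>n v. u n \<in> X \<Longrightarrow> nrm (u n) = 1 \<Longrightarrow> v \<in> X \<Longrightarrow> precond \<tau> \<alpha> (\<lambda>x. ut (Suc n) x - u n x) v = - G (u n) v"
    for \<tau> u ut n
  proof -
    let ?D = "\<lambda>n. q (u n) (u n) - q g g"
    have X: "u n \<in> X" for n
    proof (cases n)
      case (Suc m)
      then show ?thesis
        using scale_mem[OF ut, of "1 / nrm (ut (Suc m))" m] by (simp add: u_Suc)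
    qed (simp add: u0)
    define \<theta> where "\<theta> = c * (\<tau> / (1 + \<tau>))"
    have from_gap: "hn (err (u n)) \<le> K * \<delta> * exp (- \<theta> * real n / 2)"
      if n: "nrm (u n) = 1" "hn (err (u n)) \<le> \<delta>1" "?D n \<le> Kq * \<delta>\<^sup>2 * exp (- \<theta> * real n)" for n
    proof -
      have "k / 4 * (hn (err (u n)))\<^sup>2 \<le> Kq * \<delta>\<^sup>2 * exp (- \<theta> * real n)"
        using gap[OF X n(1,2)] n(3) by linarith
      then have "(hn (err (u n)))\<^sup>2 \<le> K\<^sup>2 * \<delta>\<^sup>2 * exp (- \<theta> * real n)"
        unfolding K2 using k_pos by (simp add: field_simps)
      also have "exp (- \<theta> * real n) = (exp (- \<theta> * real n / 2))\<^sup>2"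
        by (simp add: power2_eq_square exp_add[symmetric])
      finally have "(hn (err (u n)))\<^sup>2 \<le> (K * \<delta> * exp (- \<theta> * real n / 2))\<^sup>2"
        by (simp add: power_mult_distrib)
      then show ?thesis by (rule power2_le_imp_le) (use K \<delta> in auto)
    qed
    have inv: "nrm (u n) = 1 \<and> hn (err (u n)) \<le> \<delta>1 / C1 \<and> ?D n \<le> Kq * \<delta>\<^sup>2 * exp (- \<theta> * real n)" for n
    proof (induction n)
      case 0
      have "?D 0 \<le> Kq * (hn (err (u 0)))\<^sup>2" by (rule energy_gap_upper[OF u0(1,2)])
      also have "\<dots> \<le> Kq * \<delta>\<^sup>2"
        using Kq_pos u0(3) err_mem[OF u0(1)] by (intro mult_left_mono power_mono) auto
      finally show ?case using u0 by (auto simp: \<delta>_def)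
    next
      case (Suc n)
      define E where "E = hn (err (u n))"
      have n: "nrm (u n) = 1" "hn (err (u n)) \<le> \<delta>1" using Suc \<delta>1' by auto
      have s: "nrm (u (Suc n)) = 1" "hn (err (u (Suc n))) \<le> C1 * E"
        "q (u (Suc n)) (u (Suc n)) \<le> q (u n) (u n) - \<kappa> * (\<tau> / (1 + \<tau>)) * E\<^sup>2"
      proof -
        have "\<forall>v\<in>X. precond \<tau> \<alpha> (\<lambda>x. ut (Suc n) x - u n x) v = - G (u n) v"
          by (intro ballI eq X n(1))
        from step[OF \<tau> X n ut this]
        show "nrm (u (Suc n)) = 1" "hn (err (u (Suc n))) \<le> C1 * E"
          "q (u (Suc n)) (u (Suc n)) \<le> q (u n) (u n) - \<kappa> * (\<tau> / (1 + \<tau>)) * E\<^sup>2"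
          unfolding u_Suc[of n] E_def by blast+
      qed
      have "C1 * E \<le> \<delta>1" using Suc C1 by (simp add: E_def field_simps)
      then have le1: "hn (err (u (Suc n))) \<le> \<delta>1" using s(2) by linarith
      have "\<theta> * ?D n \<le> \<theta> * (Kq * E\<^sup>2)"
        using energy_gap_upper[OF X n(1)] c \<tau> by (intro mult_left_mono) (auto simp: \<theta>_def E_def)
      also have "\<dots> = \<kappa> * (\<tau> / (1 + \<tau>)) * E\<^sup>2" using Kq_pos by (simp add: \<theta>_def c_def)
      finally have "?D (Suc n) \<le> (1 - \<theta>) * ?D n" using s(3) by (simp add: algebra_simps)
      also have "\<dots> \<le> exp (- \<theta>) * ?D n"
        using exp_ge_add_one_self[of "- \<theta>"] g_min[OF X n(1)] by (intro mult_right_mono) auto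
      also have "\<dots> \<le> exp (- \<theta>) * (Kq * \<delta>\<^sup>2 * exp (- \<theta> * real n))"
        using Suc by (intro mult_left_mono) auto
      also have "\<dots> = Kq * \<delta>\<^sup>2 * exp (- \<theta> * real (Suc n))"
        by (simp add: exp_add[symmetric] algebra_simps)
      finally have D: "?D (Suc n) \<le> Kq * \<delta>\<^sup>2 * exp (- \<theta> * real (Suc n))" .
      have "hn (err (u (Suc n))) \<le> K * \<delta> * exp (- \<theta> * real (Suc n) / 2)"
        by (rule from_gap[OF s(1) le1 D])
      also have "\<dots> \<le> K * \<delta> * 1"
        using K \<delta> c \<tau> by (intro mult_left_mono) (auto simp: \<theta>_def)
      also have "\<dots> \<le> K * (\<delta>1 / C1 / (K + 1))"
        unfolding mult_1_right using K by (intro mult_left_mono) (auto simp: \<delta>_def)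
      also have "\<dots> = (\<delta>1 / C1) * (K / (K + 1))" by simp
      also have "\<dots> \<le> (\<delta>1 / C1) * 1" using dC K by (intro mult_left_mono) auto
      finally show ?case using s(1) D by simp
    qed
    have "hn (err (u n)) \<le> K * \<delta> * exp (- \<theta> * real n / 2)"
      using inv[of n] \<delta>1' by (intro from_gap) auto
    also have "\<dots> \<le> C * exp (- \<theta> * real n / 2)" by (simp add: C_def)
    also have "- \<theta> * real n / 2 = - (c / 2) * real n * \<tau> / (1 + \<tau>)" by (simp add: \<theta>_def ac_simps)
    finally show ?thesis .
  qed
  moreover have "C > 0" unfolding C_def using K \<delta> by (simp add: add_nonneg_pos)
  moreover have "c / 2 > 0" using c by simp
  ultimately show ?thesis using that[OF \<delta>, of C "c / 2"] by blast
qed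

end

end

section \<open>Smooth functions and bump functions\<close>

definition smooth1 :: "(real \<Rightarrow> real) \<Rightarrow> bool" where
  "smooth1 f \<longleftrightarrow> (\<forall>n x. (deriv ^^ n) f differentiable (at x))"

text \<open>Coinduction for smoothness: it suffices to exhibit a class of differentiable functions
  closed under \<open>deriv\<close>, so no formula for n-th derivatives is needed.\<close>

lemma smooth1_coinduct:
  assumes "f \<in> P" and step: "\<And>f. f \<in> P \<Longrightarrow> (\<forall>x. f differentiable (at x)) \<and> deriv f \<in> P"
  shows "smooth1 f"
proof -
  have "(deriv ^^ n) f \<in> P" for n by (induction n) (use assms in auto)
  then show ?thesis using step by (auto simp: smooth1_def)
qed

lemma smooth1_differentiable: "smooth1 f \<Longrightarrow> f differentiable (at x)"
  unfolding smooth1_def by (drule spec[where x = 0]) simp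

lemma smooth1_deriv: "smooth1 f \<Longrightarrow> smooth1 (deriv f)"
  unfolding smooth1_def
proof (intro allI)
  fix n x assume "\<forall>n x. (deriv ^^ n) f differentiable (at x)"
  then show "(deriv ^^ n) (deriv f) differentiable (at x)"
    by (drule_tac spec[where x = "Suc n"]) (simp add: funpow_swap1)
qed

lemma smooth1_has_derivative: "smooth1 f \<Longrightarrow> (f has_real_derivative deriv f x) (at x)"
  using smooth1_differentiable DERIV_deriv_iff_real_differentiable by blast

lemma deriv_eqI: "(\<And>x. (f has_real_derivative f' x) (at x)) \<Longrightarrow> deriv f = f'"
  using DERIV_imp_deriv by blast

text \<open>The derivative of a product is a sum of two products, so the invariant class has to
  contain sums as well.\<close>

inductive_set product_algebra :: "(real \<Rightarrow> real) set" where
  base: "smooth1 f \<Longrightarrow> smooth1 g \<Longrightarrow> (\<lambda>x. f x * g x) \<in> product_algebra"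
| add: "f \<in> product_algebra \<Longrightarrow> g \<in> product_algebra \<Longrightarrow> (\<lambda>x. f x + g x) \<in> product_algebra"

lemma smooth1_mult:
  assumes "smooth1 f" "smooth1 g"
  shows "smooth1 (\<lambda>x. f x * g x)"
proof (rule smooth1_coinduct)
  show "(\<lambda>x. f x * g x) \<in> product_algebra" by (rule product_algebra.base assms)+
  fix h assume "h \<in> product_algebra"
  then have "\<exists>h'. (\<forall>x. (h has_real_derivative h' x) (at x)) \<and> h' \<in> product_algebra"
  proof induction
    case (base f g)
    show ?case
    proof (intro exI conjI allI)
      show "((\<lambda>x. f x * g x) has_real_derivative deriv f x * g x + f x * deriv g x) (at x)" for x
        using smooth1_has_derivative[OF base(1)] smooth1_has_derivative[OF base(2)]
        by (auto intro!: derivative_eq_intros)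
      show "(\<lambda>x. deriv f x * g x + f x * deriv g x) \<in> product_algebra"
        by (intro product_algebra.intros smooth1_deriv base)
    qed
  next
    case (add f g)
    then obtain f' g' where "\<forall>x. (f has_real_derivative f' x) (at x)" "f' \<in> product_algebra"
      "\<forall>x. (g has_real_derivative g' x) (at x)" "g' \<in> product_algebra" by blast
    then show ?case
      by (intro exI[of _ "\<lambda>x. f' x + g' x"]) (auto intro!: derivative_eq_intros product_algebra.add)
  qed
  then obtain h' where h': "\<And>x. (h has_real_derivative h' x) (at x)" "h' \<in> product_algebra" by blast
  then show "(\<forall>x. h differentiable (at x)) \<and> deriv h \<in> product_algebra"
    using deriv_eqI[of h h'] real_differentiable_def by auto
qed

lemma smooth1_affine:
  assumes "smooth1 f"
  shows "smooth1 (\<lambda>x. f (m * x + b))"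
proof (rule smooth1_coinduct)
  let ?P = "{h. \<exists>a f. smooth1 f \<and> h = (\<lambda>x. a * f (m * x + b))}"
  show "(\<lambda>x. f (m * x + b)) \<in> ?P" using assms by (auto intro!: exI[of _ 1])
  fix h assume "h \<in> ?P"
  then obtain a f where f: "smooth1 f" and h: "h = (\<lambda>x. a * f (m * x + b))" by auto
  have d: "(h has_real_derivative (a * m) * deriv f (m * x + b)) (at x)" for x
  proof -
    have "((\<lambda>x. f (m * x + b)) has_real_derivative deriv f (m * x + b) * m) (at x)"
      by (rule DERIV_chain2[OF smooth1_has_derivative[OF f]]) (auto intro!: derivative_eq_intros)
    then show ?thesis unfolding h by (auto intro!: derivative_eq_intros)
  qed
  then show "(\<forall>x. h differentiable (at x)) \<and> deriv h \<in> ?P"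
    using deriv_eqI[OF d] smooth1_deriv[OF f] real_differentiable_def by blast
qed

text \<open>For k = 0 the standard smooth function that is flat at 0; the powers of 1/s make the
  family closed under differentiation up to linear combinations.\<close>

definition flat :: "nat \<Rightarrow> real \<Rightarrow> real" where
  "flat k s = (if s > 0 then (1 / s) ^ k * exp (- (1 / s)) else 0)"

lemma flat_tendsto_0: "((\<lambda>s. flat k s) \<longlongrightarrow> 0) (at 0)"
proof -
  have "((\<lambda>y::real. y ^ k / exp y) \<longlongrightarrow> 0) at_top" by (rule tendsto_power_div_exp_0)
  then have "((\<lambda>s::real. (inverse s) ^ k / exp (inverse s)) \<longlongrightarrow> 0) (at_right 0)"
    by (rule filterlim_compose[OF _ filterlim_inverse_at_top_right])
  then have "((\<lambda>s. flat k s) \<longlongrightarrow> 0) (at_right 0)"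
    by (rule Lim_transform_eventually)
       (auto simp: flat_def eventually_at_filter exp_minus field_simps)
  moreover have "((\<lambda>s. flat k s) \<longlongrightarrow> 0) (at_left 0)"
    by (rule Lim_transform_eventually[of "\<lambda>_. 0"]) (auto simp: flat_def eventually_at_filter)
  ultimately show ?thesis by (simp add: filterlim_split_at_real)
qed

lemma flat_has_derivative:
  "(flat k has_real_derivative flat (k + 2) s - real k * flat (k + 1) s) (at s)"
proof -
  consider "s > 0" | "s < 0" | "s = 0" by linarith
  then show ?thesis
  proof cases
    case 1
    have "((\<lambda>s. (1 / s) ^ k * exp (- (1 / s))) has_real_derivative flat (k + 2) s - real k * flat (k + 1) s) (at s)"
    proof (cases k)
      case 0
      then show ?thesis using 1 by (auto intro!: derivative_eq_intros simp: flat_def power2_eq_square field_simps)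
    next
      case (Suc j)
      have "((\<lambda>s. 1 / s) has_real_derivative - (1 / s)\<^sup>2) (at s)"
        using 1 by (auto intro!: derivative_eq_intros simp: power2_eq_square)
      note h = this
      show ?thesis
        by (rule DERIV_cong[OF DERIV_mult[OF DERIV_power[OF h, of k] DERIV_fun_exp[OF DERIV_minus[OF h]]]])
           (use 1 Suc in \<open>simp add: flat_def power2_eq_square mult_ac\<close>)
    qed
    moreover have "\<forall>\<^sub>F t in nhds s. (1 / t) ^ k * exp (- (1 / t)) = flat k t"
      using eventually_nhds_in_open[of "{0<..}" s] 1 by (auto elim!: eventually_mono simp: flat_def)
    ultimately show ?thesis by (subst DERIV_cong_ev[OF refl _ refl, symmetric]) auto
  next
    case 2
    have "((\<lambda>s. 0) has_real_derivative flat (k + 2) s - real k * flat (k + 1) s) (at s)"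
      using 2 by (auto simp: flat_def)
    moreover have "\<forall>\<^sub>F t in nhds s. 0 = flat k t"
      using eventually_nhds_in_open[of "{..<0}" s] 2 by (auto elim!: eventually_mono simp: flat_def)
    ultimately show ?thesis by (subst DERIV_cong_ev[OF refl _ refl, symmetric]) auto
  next
    case 3
    \<comment> \<open>At 0 the difference quotient of \<open>flat k\<close> is
      \<open>flat (k + 1)\<close>.\<close>
    have "((\<lambda>h. (flat k (0 + h) - flat k 0) / h) \<longlongrightarrow> 0) (at 0)"
      by (rule Lim_transform_eventually[OF flat_tendsto_0[of "k + 1"]])
         (auto simp: flat_def eventually_at_filter)
    then show ?thesis using 3 by (simp add: DERIV_def flat_def)
  qed
qed

inductive_set flat_span :: "(real \<Rightarrow> real) set" where
  base: "flat k \<in> flat_span"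
| lin: "f \<in> flat_span \<Longrightarrow> g \<in> flat_span \<Longrightarrow> (\<lambda>x. f x - c * g x) \<in> flat_span"

lemma smooth1_flat: "smooth1 (flat k)"
proof (rule smooth1_coinduct)
  show "flat k \<in> flat_span" by (rule flat_span.base)
  fix h assume "h \<in> flat_span"
  then have "\<exists>h'. (\<forall>x. (h has_real_derivative h' x) (at x)) \<and> h' \<in> flat_span"
  proof induction
    case (base k)
    show ?case
      by (intro exI[of _ "\<lambda>s. flat (k + 2) s - real k * flat (k + 1) s"] conjI allI
          flat_has_derivative flat_span.lin flat_span.base)
  next
    case (lin f g c)
    then obtain f' g' where "\<forall>x. (f has_real_derivative f' x) (at x)" "f' \<in> flat_span"
      "\<forall>x. (g has_real_derivative g' x) (at x)" "g' \<in> flat_span" by blast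
    then show ?case
      by (intro exI[of _ "\<lambda>x. f' x - c * g' x"]) (auto intro!: derivative_eq_intros flat_span.lin)
  qed
  then obtain h' where h': "\<And>x. (h has_real_derivative h' x) (at x)" "h' \<in> flat_span" by blast
  then show "(\<forall>x. h differentiable (at x)) \<and> deriv h \<in> flat_span"
    using deriv_eqI[of h h'] real_differentiable_def by auto
qed

text \<open>The shift by 1 keeps the support inside \<open>[l + 1/(n+1), r - 1/(n+1)]\<close>, so that products of these
  functions have compact support in an open box even if that box is all of \<open>Omega\<close>.\<close>
definition bump1 :: "real \<Rightarrow> real \<Rightarrow> nat \<Rightarrow> real \<Rightarrow> real" where
  "bump1 l r n t = flat 0 (real (Suc n) * t + (- real (Suc n) * l - 1)) *
                   flat 0 (- real (Suc n) * t + (real (Suc n) * r - 1))"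

lemma smooth1_bump1: "smooth1 (bump1 l r n)"
  unfolding bump1_def[abs_def] by (intro smooth1_mult smooth1_affine smooth1_flat)

lemma flat_0_bounds: "0 \<le> flat 0 s" "flat 0 s \<le> 1"
  by (auto simp: flat_def)

lemma bump1_bounds: "0 \<le> bump1 l r n t" "bump1 l r n t \<le> 1"
  using flat_0_bounds by (auto simp: bump1_def intro!: mult_le_one)

lemma bump1_nonzero:
  assumes "bump1 l r n t \<noteq> 0"
  shows "l + 1 / real (Suc n) \<le> t \<and> t \<le> r - 1 / real (Suc n)"
proof -
  have "real (Suc n) * t + (- real (Suc n) * l - 1) > 0" "- real (Suc n) * t + (real (Suc n) * r - 1) > 0"
    using assms by (auto simp: bump1_def flat_def split: if_splits)
  then have "real (Suc n) * (l + 1 / real (Suc n)) \<le> real (Suc n) * t"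
    "real (Suc n) * t \<le> real (Suc n) * (r - 1 / real (Suc n))"
    by (simp_all add: distrib_left right_diff_distrib del: of_nat_Suc)
  then show ?thesis by (simp del: of_nat_Suc)
qed

lemma flat_0_at_top: "(flat 0 \<longlongrightarrow> 1) at_top"
proof -
  have "((\<lambda>s::real. exp (- inverse s)) \<longlongrightarrow> exp (- 0)) at_top"
    by (intro tendsto_intros tendsto_inverse_0_at_top filterlim_ident)
  then have "((\<lambda>s::real. exp (- inverse s)) \<longlongrightarrow> 1) at_top" by simp
  then show ?thesis
    by (rule Lim_transform_eventually)
       (use eventually_gt_at_top[of 0] in \<open>auto elim!: eventually_mono simp: flat_def inverse_eq_divide\<close>)
qed

lemma bump1_tendsto: "(\<lambda>n. bump1 l r n t) \<longlonglongrightarrow> indicator {l<..<r} t"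
proof (cases "t \<in> {l<..<r}")
  case True
  have lim: "(\<lambda>n. flat 0 (real (Suc n) * y - 1)) \<longlonglongrightarrow> 1" if "y > 0" for y
  proof (rule filterlim_compose[OF flat_0_at_top])
    have "filterlim (\<lambda>n. y * real (Suc n) ) at_top sequentially"
      using that by (intro filterlim_tendsto_pos_mult_at_top[OF tendsto_const]
          filterlim_compose[OF filterlim_real_sequentially filterlim_Suc])
    then have "filterlim (\<lambda>n. (- 1) + y * real (Suc n) ) at_top sequentially"
      by (intro filterlim_tendsto_add_at_top[OF tendsto_const])
    then show "filterlim (\<lambda>n. real (Suc n) * y - 1) at_top sequentially"
      by (simp add: algebra_simps)
  qed
  have "(\<lambda>n. flat 0 (real (Suc n) * (t - l) - 1) * flat 0 (real (Suc n) * (r - t) - 1)) \<longlonglongrightarrow> 1 * 1"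
    using True by (intro tendsto_mult lim) auto
  then show ?thesis using True by (simp add: bump1_def algebra_simps)
next
  case False
  then have "bump1 l r n t = 0" for n
    using bump1_nonzero[of l r n t] by (smt (verit) divide_nonneg_nonneg greaterThanLessThan_iff of_nat_0_le_iff
        zero_less_divide_1_iff of_nat_0_less_iff zero_less_Suc)
  then show ?thesis using False by simp
qed

section \<open>Iterated partial derivatives and tensor products of one-variable functions\<close>

lemma pd_append: "pd (is @ js) f = pd is (pd js f)"
  by (induction "is") auto

lemma smooth_pd: "smooth f \<Longrightarrow> smooth (pd is f)"
  unfolding smooth_def pd_append[symmetric] by blast

lemma smooth_continuous: "smooth f \<Longrightarrow> continuous_on UNIV f"
  unfolding smooth_def by (drule spec[where x = "[]"]) simp

text \<open>\<open>smooth\<close> speaks of t = 0 only, but at every base point; moving the base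
  point along the axis gives the derivative at every t.\<close>

lemma smooth_has_partial:
  assumes "smooth f"
  shows "((\<lambda>t. f (x + t *\<^sub>R axis i 1)) has_real_derivative pd [i] f (x + t *\<^sub>R axis i 1)) (at t)"
proof -
  let ?y = "x + t *\<^sub>R axis i 1"
  have "(\<lambda>s. f (?y + s *\<^sub>R axis i 1)) differentiable (at 0)"
    using assms unfolding smooth_def by (drule_tac spec[where x = "[]"]) auto
  then have "((\<lambda>s. f (?y + s *\<^sub>R axis i 1)) has_real_derivative pd [i] f ?y) (at 0)"
    by (simp add: DERIV_deriv_iff_real_differentiable[symmetric])
  then have "((\<lambda>s. f (?y + (s - t) *\<^sub>R axis i 1)) has_real_derivative pd [i] f ?y) (at t)"
    using DERIV_shift[of "\<lambda>s. f (?y + (s - t) *\<^sub>R axis i 1)" "pd [i] f ?y" 0 t] by simp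
  then show ?thesis by (simp add: scaleR_left.diff)
qed

lemma pd_lincomb:
  assumes "smooth f" "smooth g"
  shows "pd is (\<lambda>x. f x + c * g x) = (\<lambda>x. pd is f x + c * pd is g x)"
proof (induction "is")
  case (Cons i "is")
  have "((\<lambda>t. pd is f (x + t *\<^sub>R axis i 1) + c * pd is g (x + t *\<^sub>R axis i 1)) has_real_derivative
      pd (i # is) f x + c * pd (i # is) g x) (at 0)" for x
    using smooth_has_partial[OF smooth_pd[OF assms(1)], of "is" x i 0]
      smooth_has_partial[OF smooth_pd[OF assms(2)], of "is" x i 0]
    by (auto intro!: derivative_eq_intros)
  note D = DERIV_imp_deriv[OF this]
  show ?case
    by (rule ext) (simp only: pd.simps(2)[of i "is" "\<lambda>x. f x + c * g x"] Cons D)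
qed simp

lemma smooth_lincomb:
  assumes "smooth f" "smooth g"
  shows "smooth (\<lambda>x. f x + c * g x)"
  unfolding smooth_def pd_lincomb[OF assms]
proof (intro allI conjI)
  fix "is"
  show "continuous_on UNIV (\<lambda>x. pd is f x + c * pd is g x)"
    using assms by (intro continuous_intros smooth_continuous smooth_pd)
  fix i x
  show "(\<lambda>t. pd is f (x + t *\<^sub>R axis i 1) + c * pd is g (x + t *\<^sub>R axis i 1)) differentiable (at 0)"
    unfolding real_differentiable_def
    by (rule exI, rule DERIV_add[OF smooth_has_partial[OF smooth_pd[OF assms(1)]]
          DERIV_cmult[OF smooth_has_partial[OF smooth_pd[OF assms(2)]]]])
qed

text \<open>Each partial derivative differentiates one factor, so an iterated one is again a tensor
  product, whose i-th factor is differentiated as often as i occurs in the list.\<close>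

lemma smooth_product:
  fixes F :: "'d::finite \<Rightarrow> real \<Rightarrow> real"
  assumes "\<And>i. smooth1 (F i)"
  shows "smooth (\<lambda>x. \<Prod>i\<in>UNIV. F i (x $ i))"
proof -
  have s: "smooth1 ((deriv ^^ n) (F i))" for n i
    by (induction n) (auto intro: assms smooth1_deriv)
  have d: "((\<lambda>t. \<Prod>j\<in>UNIV. G j ((x + t *\<^sub>R axis i 1) $ j)) has_real_derivative
       (\<Prod>j\<in>UNIV. (if j = i then deriv (G i) else G j) (x $ j))) (at 0)"
    if G: "\<And>j. smooth1 (G j)" for G :: "'d \<Rightarrow> real \<Rightarrow> real" and x i
  proof -
    have "((\<lambda>t. G i (x $ i + t) * (\<Prod>j\<in>UNIV - {i}. G j (x $ j))) has_real_derivative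
        deriv (G i) (x $ i) * (\<Prod>j\<in>UNIV - {i}. G j (x $ j))) (at 0)"
      using smooth1_has_derivative[OF G, of i "x $ i"] DERIV_shift[of "G i" _ 0 "x $ i"]
      by (auto intro!: derivative_eq_intros simp: add.commute)
    moreover have "(\<Prod>j\<in>UNIV. G j ((x + t *\<^sub>R axis i 1) $ j)) = G i (x $ i + t) * (\<Prod>j\<in>UNIV - {i}. G j (x $ j))" for t
      by (subst prod.remove[of _ i]) (auto simp: axis_def intro!: prod.cong)
    moreover have "(\<Prod>j\<in>UNIV. (if j = i then deriv (G i) else G j) (x $ j)) = deriv (G i) (x $ i) * (\<Prod>j\<in>UNIV - {i}. G j (x $ j))"
      by (subst prod.remove[of _ i]) (auto intro!: prod.cong)
    ultimately show ?thesis by simp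
  qed
  have pd: "pd is (\<lambda>x. \<Prod>i\<in>UNIV. F i (x $ i)) = (\<lambda>x. \<Prod>j\<in>UNIV. (deriv ^^ count_list is j) (F j) (x $ j))" for "is"
  proof (induct "is")
    case (Cons i "is")
    show ?case
    proof
      fix x
      have "pd (i # is) (\<lambda>x. \<Prod>i\<in>UNIV. F i (x $ i)) x =
         (\<Prod>j\<in>UNIV. (if j = i then deriv ((deriv ^^ count_list is i) (F i)) else (deriv ^^ count_list is j) (F j)) (x $ j))"
        unfolding pd.simps Cons by (rule DERIV_imp_deriv[OF d]) (rule s)
      also have "\<dots> = (\<Prod>j\<in>UNIV. (deriv ^^ count_list (i # is) j) (F j) (x $ j))"
        by (rule prod.cong) auto
      finally show "pd (i # is) (\<lambda>x. \<Prod>i\<in>UNIV. F i (x $ i)) x = (\<Prod>j\<in>UNIV. (deriv ^^ count_list (i # is) j) (F j) (x $ j))" .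
    qed
  qed simp
  show ?thesis
    unfolding smooth_def pd
  proof (intro allI conjI)
    fix "is" :: "'d list" and i :: 'd and x :: "real^'d"
    have "continuous_on UNIV ((deriv ^^ count_list is j) (F j))" for j
      by (intro continuous_at_imp_continuous_on ballI differentiable_imp_continuous_within smooth1_differentiable s)
    then have "continuous_on UNIV (\<lambda>x::real^'d. (deriv ^^ count_list is j) (F j) (x $ j))" for j
      by (rule continuous_on_compose2) (auto intro!: continuous_intros)
    then show "continuous_on UNIV (\<lambda>x::real^'d. \<Prod>j\<in>UNIV. (deriv ^^ count_list is j) (F j) (x $ j))"
      by (intro continuous_on_prod) 
    show "(\<lambda>t. \<Prod>j\<in>UNIV. (deriv ^^ count_list is j) (F j) ((x + t *\<^sub>R axis i 1) $ j)) differentiable (at 0)"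
      unfolding real_differentiable_def by (rule exI, rule d[OF s])
  qed
qed

definition bump :: "real^'d \<Rightarrow> real^'d \<Rightarrow> nat \<Rightarrow> real^'d \<Rightarrow> real" where
  "bump l r n x = (\<Prod>i\<in>UNIV. bump1 (l $ i) (r $ i) n (x $ i))"

lemma bump_test_fun:
  fixes l r a b :: "real^'d"
  assumes sub: "box l r \<subseteq> Omega a b"
  shows "test_fun a b (bump l r n)"
  unfolding test_fun_def
proof (intro conjI exI)
  show "smooth (bump l r n)" unfolding bump_def[abs_def] by (intro smooth_product smooth1_bump1)
  let ?K = "cbox (\<chi> i. l $ i + 1 / real (Suc n)) (\<chi> i. r $ i - 1 / real (Suc n))"
  show "compact ?K" by (rule compact_cbox)
  have "?K \<subseteq> box l r"
    by (auto simp: mem_box_cart simp del: of_nat_Suc)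
       (smt (verit) divide_pos_pos of_nat_0_less_iff zero_less_Suc)+
  then show "?K \<subseteq> Omega a b" using sub by blast
  show "\<forall>x. x \<notin> ?K \<longrightarrow> bump l r n x = 0"
  proof (intro allI impI)
    fix x assume "x \<notin> ?K"
    then obtain i where "\<not> (l $ i + 1 / real (Suc n) \<le> x $ i \<and> x $ i \<le> r $ i - 1 / real (Suc n))"
      by (auto simp: mem_box_cart simp del: of_nat_Suc)
    then have "bump1 (l $ i) (r $ i) n (x $ i) = 0" using bump1_nonzero by blast
    then show "bump l r n x = 0" unfolding bump_def by (intro prod_zero) auto
  qed
qed

lemma bump_bounds: "0 \<le> bump l r n x" "bump l r n x \<le> 1"
  unfolding bump_def using bump1_bounds by (auto intro!: prod_nonneg prod_le_1)

lemma bump_tendsto: "(\<lambda>n. bump l r n x) \<longlonglongrightarrow> indicator (box l r) x"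
proof -
  have "(\<lambda>n. bump l r n x) \<longlonglongrightarrow> (\<Prod>i\<in>UNIV. indicator {l $ i<..<r $ i} (x $ i))"
    unfolding bump_def by (intro tendsto_prod bump1_tendsto)
  also have "(\<Prod>i\<in>UNIV. indicator {l $ i<..<r $ i} (x $ i)) = (indicator (box l r) x :: real)"
    by (auto simp: indicator_def mem_box_cart intro!: prod.neutral prod_zero)
  finally show ?thesis .
qed

lemma test_fun_smooth: "test_fun a b \<phi> \<Longrightarrow> smooth \<phi>"
  by (simp add: test_fun_def)

lemma test_fun_lincomb:
  assumes "test_fun a b \<phi>" "test_fun a b \<psi>"
  shows "test_fun a b (\<lambda>x. \<phi> x + c * \<psi> x)"
proof -
  obtain K L where "compact K" "K \<subseteq> Omega a b" "\<forall>x. x \<notin> K \<longrightarrow> \<phi> x = 0"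
    "compact L" "L \<subseteq> Omega a b" "\<forall>x. x \<notin> L \<longrightarrow> \<psi> x = 0"
    using assms unfolding test_fun_def by blast
  then show ?thesis
    using smooth_lincomb[OF assms[THEN test_fun_smooth]] unfolding test_fun_def
    by (intro conjI exI[of _ "K \<union> L"]) auto
qed

text \<open>\<open>smooth\<close> only provides continuous partial derivatives, whereas
  differentiation along the paths of the Sobolev argument needs a total derivative. The increment is
  switched on one coordinate at a time, with the mean value theorem for each coordinate.\<close>

lemma smooth_has_derivative:
  fixes f :: "real^'d \<Rightarrow> real"
  assumes f: "smooth f"
  shows "(f has_derivative (\<lambda>h. (\<chi> i. pd [i] f x) \<bullet> h)) (at x)"
proof -
  \<comment> \<open>Keeps the coordinates of h in \<open>I\<close>; the induction on
    \<open>I\<close> telescopes f (x + h) - f x.\<close>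
  let ?R = "\<lambda>I h. (\<chi> i. if i \<in> I then h $ i else 0) :: real^'d"
  have small: "\<exists>d>0. \<forall>h. norm h < d \<longrightarrow> \<bar>f (x + h) - f x - (\<chi> i. pd [i] f x) \<bullet> h\<bar> \<le> \<epsilon> * norm h" if "\<epsilon> > 0" for \<epsilon>
  proof -
    define \<eta> where "\<eta> = \<epsilon> / CARD('d)"
    have \<eta>: "\<eta> > 0" using that by (simp add: \<eta>_def)
    have "\<exists>d>0. \<forall>y. norm (y - x) < d \<longrightarrow> \<bar>pd [i] f y - pd [i] f x\<bar> < \<eta>" for i
      using smooth_continuous[OF smooth_pd[OF f, of "[i]"]] \<eta>
      unfolding continuous_on_iff by (auto simp: dist_norm)
    then obtain d' where d': "\<And>i. d' i > 0" "\<And>i y. norm (y - x) < d' i \<Longrightarrow> \<bar>pd [i] f y - pd [i] f x\<bar> < \<eta>"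
      by metis
    define d where "d = Min (range d')"
    have d: "d > 0" "\<And>i. d \<le> d' i" using d' by (auto simp: d_def)
    have "\<bar>f (x + h) - f x - (\<chi> i. pd [i] f x) \<bullet> h\<bar> \<le> \<epsilon> * norm h" if h: "norm h < d" for h
    proof -
      have partial: "\<bar>f (x + ?R I h) - f x - (\<Sum>i\<in>I. pd [i] f x * h $ i)\<bar> \<le> card I * (\<eta> * norm h)" if "finite I" for I
        using that
      proof (induction I)
        case empty
        have "?R {} h = 0" by (simp add: vec_eq_iff)
        then show ?case by simp
      next
        case (insert j I)
        have eq: "?R (insert j I) h = ?R I h + h $ j *\<^sub>R axis j 1"
          using insert by (auto simp: vec_eq_iff axis_def)
        let ?y = "x + ?R I h"
        have "((\<lambda>t. f (?y + (t * h $ j) *\<^sub>R axis j 1)) has_real_derivative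
            pd [j] f (?y + (t * h $ j) *\<^sub>R axis j 1) * h $ j) (at t)" for t
          by (rule DERIV_chain2[OF smooth_has_partial[OF f]]) (auto intro!: derivative_eq_intros)
        then obtain \<theta> where \<theta>: "0 < \<theta>" "\<theta> < 1" and m: "f (?y + (1 * h $ j) *\<^sub>R axis j 1) - f (?y + (0 * h $ j) *\<^sub>R axis j 1)
          = pd [j] f (?y + (\<theta> * h $ j) *\<^sub>R axis j 1) * h $ j"
          using MVT2[of 0 1 "\<lambda>t. f (?y + (t * h $ j) *\<^sub>R axis j 1)" "\<lambda>t. pd [j] f (?y + (t * h $ j) *\<^sub>R axis j 1) * h $ j"] by auto
        have "norm (?y + (\<theta> * h $ j) *\<^sub>R axis j 1 - x) \<le> norm h"
        proof (rule norm_le_componentwise_cart)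
          fix i
          have "\<bar>\<theta> * h $ j\<bar> \<le> \<bar>h $ j\<bar>" using \<theta> by (simp add: abs_mult mult_left_le_one_le)
          then show "norm ((?y + (\<theta> * h $ j) *\<^sub>R axis j 1 - x) $ i) \<le> norm (h $ i)"
            using insert by (auto simp: axis_def)
        qed
        then have "\<bar>pd [j] f (?y + (\<theta> * h $ j) *\<^sub>R axis j 1) - pd [j] f x\<bar> < \<eta>"
          using h d(2)[of j] by (intro d'(2)) linarith
        then have "\<bar>pd [j] f (?y + (\<theta> * h $ j) *\<^sub>R axis j 1) - pd [j] f x\<bar> * \<bar>h $ j\<bar> \<le> \<eta> * norm h"
          using component_le_norm_cart[of h j] by (intro mult_mono) auto
        then have "\<bar>f (x + ?R (insert j I) h) - f ?y - pd [j] f x * h $ j\<bar> \<le> \<eta> * norm h"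
          using m unfolding eq by (simp add: abs_mult[symmetric] left_diff_distrib add.assoc)
        then show ?case using insert by (simp add: algebra_simps)
      qed
      have "?R UNIV h = h" by (simp add: vec_eq_iff)
      then have "\<bar>f (x + h) - f x - (\<Sum>i\<in>UNIV. pd [i] f x * h $ i)\<bar> \<le> CARD('d) * (\<eta> * norm h)"
        using partial[of UNIV] by simp
      then show ?thesis by (simp add: inner_vec_def \<eta>_def)
    qed
    then show ?thesis using d by blast
  qed
  show ?thesis
    unfolding has_derivative_at_alt
  proof (intro conjI allI impI bounded_linear_inner_right)
    fix \<epsilon> :: real assume "\<epsilon> > 0"
    then obtain d where "d > 0"
      and d: "\<And>h. norm h < d \<Longrightarrow> \<bar>f (x + h) - f x - (\<chi> i. pd [i] f x) \<bullet> h\<bar> \<le> \<epsilon> * norm h"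
      using small by blast
    have "norm (f y - f x - (\<chi> i. pd [i] f x) \<bullet> (y - x)) \<le> \<epsilon> * norm (y - x)" if "norm (y - x) < d" for y
      using d[OF that] by simp
    then show "\<exists>d>0. \<forall>y. norm (y - x) < d \<longrightarrow> norm (f y - f x - (\<chi> i. pd [i] f x) \<bullet> (y - x)) \<le> \<epsilon> * norm (y - x)"
      using \<open>d > 0\<close> by blast
  qed
qed

section \<open>Weak gradients\<close>

lemma Omega_sets [measurable, simp]: "Omega a b \<in> sets lebesgue"
  by (simp add: Omega_def)

lemma finite_measure_Omega: "finite_measure (lebesgue_on (Omega a b))"
  by (intro finite_measureI) (simp add: emeasure_restrict_space Omega_def emeasure_lborel_box_eq)

lemma borel_measurable_lebesgue_on: "f \<in> borel_measurable borel \<Longrightarrow> f \<in> borel_measurable (lebesgue_on S)"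
  by (intro measurable_restrict_space1 measurable_completion) simp

lemma continuous_measurable_Omega:
  "continuous_on UNIV f \<Longrightarrow> f \<in> borel_measurable (lebesgue_on S)"
  for f :: "real^'d \<Rightarrow> 'b::topological_space"
  by (intro borel_measurable_lebesgue_on borel_measurable_continuous_onI)

lemma Lint_eq_lborel:
  assumes "f \<in> borel_measurable borel"
  shows "Lint a b f = (\<integral>x. indicator (Omega a b) x * f x \<partial>lborel)"
proof -
  have "Lint a b f = (\<integral>x. indicator (Omega a b) x *\<^sub>R f x \<partial>lebesgue)"
    unfolding Lint_def by (rule integral_restrict_space) simp
  also have "\<dots> = (\<integral>x. indicator (Omega a b) x *\<^sub>R f x \<partial>lborel)"
    using assms by (intro integral_completion) (auto simp: Omega_def)
  finally show ?thesis by simp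
qed

lemma bounded_integrable_Omega:
  fixes f :: "real^'d \<Rightarrow> real"
  assumes "f \<in> borel_measurable (lebesgue_on (Omega a b))"
    and "\<And>x. x \<in> Omega a b \<Longrightarrow> \<bar>f x\<bar> \<le> B"
  shows "integrable (lebesgue_on (Omega a b)) f"
proof -
  interpret finite_measure "lebesgue_on (Omega a b)" by (rule finite_measure_Omega)
  show ?thesis using assms by (intro integrable_const_bound[of _ B]) (auto intro!: AE_I2)
qed

lemma smooth_bounded_Omega:
  assumes "smooth \<phi>"
  obtains B where "\<And>x. x \<in> Omega a b \<Longrightarrow> \<bar>\<phi> x\<bar> \<le> B"
proof -
  have "bounded (\<phi> ` cbox a b)"
    using smooth_continuous[OF assms] continuous_on_subset
    by (intro compact_imp_bounded compact_continuous_image compact_cbox) blast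
  then obtain B where "\<forall>x\<in>cbox a b. \<bar>\<phi> x\<bar> \<le> B" by (auto simp: bounded_iff)
  then have "\<bar>\<phi> x\<bar> \<le> B" if "x \<in> Omega a b" for x
    using that box_subset_cbox[of a b] by (auto simp: Omega_def)
  then show ?thesis by (rule that)
qed

lemma L2_smooth:
  assumes "smooth \<phi>" shows "L2 a b \<phi>"
  unfolding L2_def
proof
  show m: "\<phi> \<in> borel_measurable (lebesgue_on (Omega a b))"
    by (intro continuous_measurable_Omega smooth_continuous assms)
  obtain B where "\<And>x. x \<in> Omega a b \<Longrightarrow> \<bar>\<phi> x\<bar> \<le> B"
    by (rule smooth_bounded_Omega[OF assms, where a = a and b = b]) (rule that)
  then show "integrable (lebesgue_on (Omega a b)) (\<lambda>x. (\<phi> x)\<^sup>2)"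
    using m by (intro bounded_integrable_Omega[of _ _ _ "B\<^sup>2"]) (auto simp: abs_le_square_iff[symmetric] intro: order_trans[OF _ abs_ge_self])
qed

lemma L2_mult_integrable:
  assumes "L2 a b u" "L2 a b v"
  shows "integrable (lebesgue_on (Omega a b)) (\<lambda>x. u x * v x)"
proof (rule Bochner_Integration.integrable_bound)
  show "integrable (lebesgue_on (Omega a b)) (\<lambda>x. (u x)\<^sup>2 + (v x)\<^sup>2)"
    using assms by (auto simp: L2_def)
  show "(\<lambda>x. u x * v x) \<in> borel_measurable (lebesgue_on (Omega a b))"
    using assms by (auto simp: L2_def)
  have "\<bar>s * t\<bar> \<le> s\<^sup>2 + t\<^sup>2" for s t :: real
    using sum_squares_bound[of "\<bar>s\<bar>" "\<bar>t\<bar>"] mult_nonneg_nonneg[of "\<bar>s\<bar>" "\<bar>t\<bar>"]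
    unfolding abs_mult power2_abs by linarith
  then show "AE x in lebesgue_on (Omega a b). norm (u x * v x) \<le> norm ((u x)\<^sup>2 + (v x)\<^sup>2)"
    by (intro AE_I2) (simp add: abs_of_nonneg)
qed

lemma L2_lincomb:
  assumes "L2 a b u" "L2 a b v" shows "L2 a b (\<lambda>x. u x + c * v x)"
proof -
  have "(\<lambda>x. (u x + c * v x)\<^sup>2) = (\<lambda>x. (u x)\<^sup>2 + 2 * c * (u x * v x) + c\<^sup>2 * (v x)\<^sup>2)"
    by (auto simp: power2_eq_square algebra_simps)
  then show ?thesis
    using assms L2_mult_integrable[OF assms] by (auto simp: L2_def)
qed

lemma L2_integrable:
  assumes "L2 a b u" shows "integrable (lebesgue_on (Omega a b)) u"
proof -
  interpret finite_measure "lebesgue_on (Omega a b)" by (rule finite_measure_Omega)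
  have "L2 a b (\<lambda>_. 1)" by (simp add: L2_def)
  from L2_mult_integrable[OF assms this] show ?thesis by simp
qed

text \<open>The positive and negative parts of \<open>f\<close> are densities of two measures that
  agree on boxes. Boxes are stable under intersection, generate the Borel sets and exhaust the space
  with finite measure, so the measures coincide and so do their densities almost everywhere.\<close>

lemma AE_zero_if_box_integrals_zero:
  fixes f :: "'a::euclidean_space \<Rightarrow> real"
  assumes f: "integrable lborel f"
    and zero: "\<And>l r. (\<integral>x. indicator (box l r) x * f x \<partial>lborel) = 0"
  shows "AE x in lborel. f x = 0"
proof -
  have [measurable]: "f \<in> borel_measurable borel" using f by (simp add: borel_measurable_integrable)
  let ?p = "\<lambda>x. ennreal (f x)" let ?n = "\<lambda>x. ennreal (- f x)"
  have eq_box: "emeasure (density lborel ?p) (box l r) = emeasure (density lborel ?n) (box l r)" for l r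
  proof -
    let ?g = "\<lambda>x. indicator (box l r) x * f x"
    have I: "integrable lborel ?g" using f by (simp add: integrable_mult_indicator[where 'b = real, simplified])
    have "(\<integral>\<^sup>+x. ?p x * indicator (box l r) x \<partial>lborel) = (\<integral>\<^sup>+x. ennreal (?g x) \<partial>lborel)"
      by (intro nn_integral_cong) (auto simp: indicator_def)
    moreover have "(\<integral>\<^sup>+x. ?n x * indicator (box l r) x \<partial>lborel) = (\<integral>\<^sup>+x. ennreal (- ?g x) \<partial>lborel)"
      by (intro nn_integral_cong) (auto simp: indicator_def)
    moreover have "(\<integral>\<^sup>+x. ennreal (?g x) \<partial>lborel) = (\<integral>\<^sup>+x. ennreal (- ?g x) \<partial>lborel)"
    proof -
      have fin: "(\<integral>\<^sup>+x. ennreal (?g x) \<partial>lborel) \<noteq> \<infinity>" "(\<integral>\<^sup>+x. ennreal (- ?g x) \<partial>lborel) \<noteq> \<infinity>"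
        using I by (auto simp: real_integrable_def)
      have "enn2real (\<integral>\<^sup>+x. ennreal (?g x) \<partial>lborel) = enn2real (\<integral>\<^sup>+x. ennreal (- ?g x) \<partial>lborel)"
        using zero[of l r] real_lebesgue_integral_def[OF I] by simp
      then show ?thesis using fin
        by (cases "\<integral>\<^sup>+x. ennreal (?g x) \<partial>lborel"; cases "\<integral>\<^sup>+x. ennreal (- ?g x) \<partial>lborel") simp_all
    qed
    ultimately show ?thesis by (simp add: emeasure_density)
  qed
  have "density lborel ?p = density lborel ?n"
  proof (rule measure_eqI_generator_eq)
    let ?E = "range (\<lambda>(a, b). box a b::'a set)"
    show "Int_stable ?E" by (auto simp: Int_stable_def box_Int_box)
    show "?E \<subseteq> Pow UNIV" "sets (density lborel ?p) = sigma_sets UNIV ?E" "sets (density lborel ?n) = sigma_sets UNIV ?E"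
      by (simp_all add: borel_eq_box)
    let ?A = "\<lambda>n::nat. box (- (real n *\<^sub>R One)) (real n *\<^sub>R One) :: 'a set"
    show "range ?A \<subseteq> ?E" "(\<Union>i. ?A i) = UNIV" unfolding UN_box_eq_UNIV by auto
    show "emeasure (density lborel ?p) (?A i) \<noteq> \<infinity>" for i
    proof -
      have "emeasure (density lborel ?p) (?A i) \<le> (\<integral>\<^sup>+x. ?p x \<partial>lborel)"
        by (auto simp: emeasure_density intro!: nn_integral_mono simp: indicator_def)
      then show ?thesis using f by (auto simp: real_integrable_def top_unique)
    qed
    show "emeasure (density lborel ?p) X = emeasure (density lborel ?n) X" if "X \<in> ?E" for X
      using that eq_box by auto
  qed
  then have "AE x in lborel. ?p x = ?n x"
    by (intro sigma_finite_measure.density_unique[OF sigma_finite_lborel]) auto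
  then show ?thesis
  proof eventually_elim
    case (elim x)
    then show ?case by (cases "f x \<ge> 0") (auto simp: ennreal_neg dest: sym)
  qed
qed

text \<open>The bump functions of the box converge pointwise to its indicator with values in [0, 1],
  so dominated convergence applies with dominating function |h|.\<close>

lemma Lint_box_eq_0_if_test_fun:
  fixes h :: "real^'d \<Rightarrow> real"
  assumes h: "integrable (lebesgue_on (Omega a b)) h"
    and zero: "\<And>\<phi>. test_fun a b \<phi> \<Longrightarrow> Lint a b (\<lambda>x. h x * \<phi> x) = 0"
    and sub: "box l r \<subseteq> Omega a b"
  shows "Lint a b (\<lambda>x. h x * indicator (box l r) x) = 0"
proof -
  have "(\<lambda>n. Lint a b (\<lambda>x. h x * bump l r n x)) \<longlonglongrightarrow> Lint a b (\<lambda>x. h x * indicator (box l r) x)"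
    unfolding Lint_def
  proof (rule integral_dominated_convergence[where w = "\<lambda>x. \<bar>h x\<bar>"])
    show "(\<lambda>x. h x * bump l r n x) \<in> borel_measurable (lebesgue_on (Omega a b))" for n
      using h test_fun_smooth[OF bump_test_fun[OF sub]]
      by (intro borel_measurable_times borel_measurable_integrable continuous_measurable_Omega smooth_continuous)
    show "(\<lambda>x. h x * indicator (box l r) x) \<in> borel_measurable (lebesgue_on (Omega a b))"
      using borel_measurable_integrable[OF h] by (rule borel_measurable_times) (intro borel_measurable_lebesgue_on, simp)
    show "AE x in lebesgue_on (Omega a b). (\<lambda>n. h x * bump l r n x) \<longlonglongrightarrow> h x * indicator (box l r) x"
      by (intro AE_I2 tendsto_mult tendsto_const bump_tendsto)
    show "AE x in lebesgue_on (Omega a b). norm (h x * bump l r n x) \<le> \<bar>h x\<bar>" for n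
      using bump_bounds[of l r n] by (intro AE_I2) (simp add: abs_mult mult_left_le)
  qed (use h in auto)
  then show ?thesis
    using zero[OF bump_test_fun[OF sub]] by (simp add: LIMSEQ_const_iff)
qed

lemma fundamental_lemma_of_variations:
  fixes h :: "real^'d \<Rightarrow> real"
  assumes h: "integrable (lebesgue_on (Omega a b)) h"
    and zero: "\<And>\<phi>. test_fun a b \<phi> \<Longrightarrow> Lint a b (\<lambda>x. h x * \<phi> x) = 0"
  shows "AE x in lebesgue_on (Omega a b). h x = 0"
proof -
  let ?f = "\<lambda>x. indicator (Omega a b) x * h x"
  have f: "integrable lebesgue ?f"
    using h by (simp add: integrable_restrict_space)
  then have "?f \<in> borel_measurable lebesgue" by (rule borel_measurable_integrable)
  \<comment> \<open>The box criterion lives on Borel measure, so the extension of h by zero is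
    replaced by a Borel representative.\<close>
  then obtain f' where [measurable]: "f' \<in> borel_measurable lborel" and ae: "AE x in lborel. ?f x = f' x"
    using completion_ex_borel_measurable_real by blast
  have ae': "AE x in lebesgue. ?f x = f' x" using ae by (rule AE_completion)
  have f': "integrable lborel f'"
  proof -
    have "integrable lebesgue f'"
      using f ae' by (subst integrable_cong_AE[of f' lebesgue ?f]) (auto intro: measurable_completion)
    then show ?thesis by (simp add: integrable_completion)
  qed
  have "AE x in lborel. f' x = 0"
  proof (rule AE_zero_if_box_integrals_zero[OF f'])
    fix l r :: "real^'d"
    \<comment> \<open>The intersection of two boxes is a box, now contained in the domain, so its
      bump functions are admissible test functions.\<close>
    obtain l' r' where I: "box l r \<inter> Omega a b = box l' r'"
      unfolding Omega_def box_Int_box by blast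
    have "(\<integral>x. indicator (box l r) x * f' x \<partial>lborel) = (\<integral>x. indicator (box l r) x * f' x \<partial>lebesgue)"
      by (rule integral_completion[symmetric]) auto
    also have "\<dots> = (\<integral>x. indicator (Omega a b) x *\<^sub>R (h x * indicator (box l' r') x) \<partial>lebesgue)"
    proof (rule integral_cong_AE)
      show "AE x in lebesgue. indicator (box l r) x * f' x = indicator (Omega a b) x *\<^sub>R (h x * indicator (box l' r') x)"
        using ae'
      proof eventually_elim
        case (elim x)
        then show ?case using arg_cong[OF I, of "\<lambda>A. x \<in> A"] by (auto simp: indicator_def)
      qed
      show "(\<lambda>x. indicator (Omega a b) x *\<^sub>R (h x * indicator (box l' r') x)) \<in> borel_measurable lebesgue"
      proof -
        have "(\<lambda>x. ?f x * indicator (box l' r') x) \<in> borel_measurable lebesgue"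
          using borel_measurable_integrable[OF f] by (rule borel_measurable_times) (intro measurable_completion, simp)
        then show ?thesis by (simp add: mult.assoc)
      qed
    qed (auto intro: measurable_completion)
    also have "\<dots> = Lint a b (\<lambda>x. h x * indicator (box l' r') x)"
      unfolding Lint_def by (rule integral_restrict_space[symmetric]) simp
    also have "\<dots> = 0" using I by (intro Lint_box_eq_0_if_test_fun h zero) auto
    finally show "(\<integral>x. indicator (box l r) x * f' x \<partial>lborel) = 0" .
  qed
  then have "AE x in lebesgue. f' x = 0" by (rule AE_completion)
  with ae' have "AE x in lebesgue. x \<in> Omega a b \<longrightarrow> h x = 0"
    by eventually_elim (auto simp: indicator_def)
  then show ?thesis by (simp add: AE_restrict_space_iff)
qed

section \<open>Uniqueness and linearity of weak gradients\<close>

lemma smooth_mult_integrable: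
  assumes "L2 a b u" "smooth \<phi>"
  shows "integrable (lebesgue_on (Omega a b)) (\<lambda>x. u x * \<phi> x)"
  by (intro L2_mult_integrable L2_smooth assms)

lemma weak_grad_L2: "is_weak_grad a b u g \<Longrightarrow> L2 a b (\<lambda>x. g x $ i)"
  by (simp add: is_weak_grad_def)

lemma weak_grad_unique:
  assumes "is_weak_grad a b u g" "is_weak_grad a b u g'"
  shows "AE x in lebesgue_on (Omega a b). g x = g' x"
proof -
  have "AE x in lebesgue_on (Omega a b). g x $ i - g' x $ i = 0" for i
  proof (rule fundamental_lemma_of_variations)
    note L = weak_grad_L2[OF assms(1), of i] weak_grad_L2[OF assms(2), of i]
    show "integrable (lebesgue_on (Omega a b)) (\<lambda>x. g x $ i - g' x $ i)"
      by (intro Bochner_Integration.integrable_diff L2_integrable L)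
    fix \<phi> assume \<phi>: "test_fun a b \<phi>"
    have "Lint a b (\<lambda>x. g x $ i * \<phi> x) = Lint a b (\<lambda>x. g' x $ i * \<phi> x)"
    proof -
      have "Lint a b (\<lambda>x. u x * pd [i] \<phi> x) = - Lint a b (\<lambda>x. g x $ i * \<phi> x)"
        "Lint a b (\<lambda>x. u x * pd [i] \<phi> x) = - Lint a b (\<lambda>x. g' x $ i * \<phi> x)"
        using assms \<phi> unfolding is_weak_grad_def by blast+
      then show ?thesis by linarith
    qed
    then show "Lint a b (\<lambda>x. (g x $ i - g' x $ i) * \<phi> x) = 0"
      using smooth_mult_integrable[OF L(1) test_fun_smooth[OF \<phi>]]
        smooth_mult_integrable[OF L(2) test_fun_smooth[OF \<phi>]]
      by (simp add: Lint_def left_diff_distrib)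
  qed
  then have "AE x in lebesgue_on (Omega a b). \<forall>i. g x $ i - g' x $ i = 0"
    by (simp add: AE_all_countable)
  then show ?thesis by eventually_elim (simp add: vec_eq_iff)
qed

lemma weak_grad_lincomb:
  assumes u: "L2 a b u" "is_weak_grad a b u g" and v: "L2 a b v" "is_weak_grad a b v h"
  shows "is_weak_grad a b (\<lambda>x. u x + c * v x) (\<lambda>x. g x + c *\<^sub>R h x)"
  unfolding is_weak_grad_def
proof (intro allI conjI impI)
  fix i
  note L = weak_grad_L2[OF u(2), of i] weak_grad_L2[OF v(2), of i]
  show "L2 a b (\<lambda>x. (g x + c *\<^sub>R h x) $ i)" using L2_lincomb[OF L, of c] by simp
  fix \<phi> assume \<phi>: "test_fun a b \<phi>"
  note s = test_fun_smooth[OF \<phi>]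
  have "Lint a b (\<lambda>x. (u x + c * v x) * pd [i] \<phi> x)
      = Lint a b (\<lambda>x. u x * pd [i] \<phi> x) + c * Lint a b (\<lambda>x. v x * pd [i] \<phi> x)"
    using smooth_mult_integrable[OF u(1) smooth_pd[OF s]] smooth_mult_integrable[OF v(1) smooth_pd[OF s]]
    by (simp add: Lint_def distrib_right mult.assoc del: pd.simps)
  also have "\<dots> = - (Lint a b (\<lambda>x. g x $ i * \<phi> x) + c * Lint a b (\<lambda>x. h x $ i * \<phi> x))"
    using u(2) v(2) \<phi> by (simp add: is_weak_grad_def algebra_simps del: pd.simps)
  also have "Lint a b (\<lambda>x. g x $ i * \<phi> x) + c * Lint a b (\<lambda>x. h x $ i * \<phi> x)
      = Lint a b (\<lambda>x. (g x + c *\<^sub>R h x) $ i * \<phi> x)"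
    using smooth_mult_integrable[OF L(1) s] smooth_mult_integrable[OF L(2) s]
    by (simp add: Lint_def distrib_right mult.assoc)
  finally show "Lint a b (\<lambda>x. (u x + c * v x) * pd [i] \<phi> x) = - Lint a b (\<lambda>x. (g x + c *\<^sub>R h x) $ i * \<phi> x)" .
qed

lemma wgrad_weak: "H1 a b u \<Longrightarrow> is_weak_grad a b u (wgrad a b u)"
  unfolding wgrad_def H1_def by (auto intro: someI[of "is_weak_grad a b u"])

lemma H1_lincomb: "H1 a b u \<Longrightarrow> H1 a b v \<Longrightarrow> H1 a b (\<lambda>x. u x + c * v x)"
  unfolding H1_def using L2_lincomb weak_grad_lincomb by blast

text \<open>A choice operator does not commute with linear combinations; uniqueness restores this
  almost everywhere, which is enough under the integral.\<close>

lemma wgrad_lincomb: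
  assumes "H1 a b u" "H1 a b v"
  shows "AE x in lebesgue_on (Omega a b). wgrad a b (\<lambda>x. u x + c * v x) x = wgrad a b u x + c *\<^sub>R wgrad a b v x"
proof (rule weak_grad_unique)
  show "is_weak_grad a b (\<lambda>x. u x + c * v x) (wgrad a b (\<lambda>x. u x + c * v x))"
    by (intro wgrad_weak H1_lincomb assms)
  show "is_weak_grad a b (\<lambda>x. u x + c * v x) (\<lambda>x. wgrad a b u x + c *\<^sub>R wgrad a b v x)"
    using assms by (intro weak_grad_lincomb wgrad_weak) (auto simp: H1_def)
qed

definition grad_form :: "real^'d \<Rightarrow> real^'d \<Rightarrow> (real^'d \<Rightarrow> real) \<Rightarrow> (real^'d \<Rightarrow> real) \<Rightarrow> real" where
  "grad_form a b u v = Lint a b (\<lambda>x. inner (wgrad a b u x) (wgrad a b v x))"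

lemma grad_sq_eq: "grad_sq a b u = grad_form a b u u"
  by (simp add: grad_sq_def grad_form_def power2_norm_eq_inner)

lemma wgrad_measurable:
  assumes "H1 a b u"
  shows "wgrad a b u \<in> borel_measurable (lebesgue_on (Omega a b))"
proof -
  have "(\<lambda>x. wgrad a b u x \<bullet> axis i 1) \<in> borel_measurable (lebesgue_on (Omega a b))" for i
    using weak_grad_L2[OF wgrad_weak[OF assms], of i] by (simp add: L2_def inner_axis)
  then show ?thesis
    by (subst borel_measurable_euclidean_space) (auto simp: Basis_vec_def)
qed

lemma grad_integrable:
  assumes "H1 a b u" "H1 a b v"
  shows "integrable (lebesgue_on (Omega a b)) (\<lambda>x. inner (wgrad a b u x) (wgrad a b v x))"
  unfolding inner_vec_def inner_real_def
  by (intro Bochner_Integration.integrable_sum L2_mult_integrable weak_grad_L2[OF wgrad_weak] assms)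

lemma grad_form_sym_form: "sym_form {u. H1 a b u} (grad_form a b)"
  unfolding sym_form_def
proof (intro conjI ballI allI)
  fix u v w c assume "u \<in> {u. H1 a b u}" "v \<in> {u. H1 a b u}" "w \<in> {u. H1 a b u}"
  then have u: "H1 a b u" and v: "H1 a b v" and w: "H1 a b w" by auto
  have "grad_form a b (\<lambda>x. u x + c * v x) w
     = Lint a b (\<lambda>x. inner (wgrad a b u x) (wgrad a b w x) + c * inner (wgrad a b v x) (wgrad a b w x))"
    unfolding grad_form_def Lint_def
  proof (rule integral_cong_AE)
    show "AE x in lebesgue_on (Omega a b). wgrad a b (\<lambda>x. u x + c * v x) x \<bullet> wgrad a b w x =
        wgrad a b u x \<bullet> wgrad a b w x + c * (wgrad a b v x \<bullet> wgrad a b w x)"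
      using wgrad_lincomb[OF u v, of c] by eventually_elim (simp add: inner_left_distrib)
  qed (intro borel_measurable_add borel_measurable_times borel_measurable_const borel_measurable_inner
      wgrad_measurable H1_lincomb u v w)+
  also have "\<dots> = grad_form a b u w + c * grad_form a b v w"
    using grad_integrable[OF u w] grad_integrable[OF v w] by (simp add: grad_form_def Lint_def)
  finally show "grad_form a b (\<lambda>x. u x + c * v x) w = grad_form a b u w + c * grad_form a b v w" .
qed (simp add: grad_form_def inner_commute)

lemma grad_form_nonneg: "0 \<le> grad_form a b u u"
  unfolding grad_form_def Lint_def by (intro integral_nonneg_AE AE_I2) simp

interpretation H1_space: function_space "{u. H1 a b u}" for a b
  by unfold_locales (auto intro: H1_lincomb)

section \<open>The H1-norm as the seminorm of a semidefinite form\<close>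

definition H1_form :: "real^'d \<Rightarrow> real^'d \<Rightarrow> (real^'d \<Rightarrow> real) \<Rightarrow> (real^'d \<Rightarrow> real) \<Rightarrow> real" where
  "H1_form a b u v = Lint a b (\<lambda>x. u x * v x) + grad_form a b u v"

lemma L2_form_sym_form: "sym_form {u. L2 a b u} (\<lambda>u v. Lint a b (\<lambda>x. u x * v x))"
  unfolding sym_form_def
proof (intro conjI ballI allI)
  fix u v w c assume "u \<in> {u. L2 a b u}" "v \<in> {u. L2 a b u}" "w \<in> {u. L2 a b u}"
  then show "Lint a b (\<lambda>x. (u x + c * v x) * w x) = Lint a b (\<lambda>x. u x * w x) + c * Lint a b (\<lambda>x. v x * w x)"
    using L2_mult_integrable[of a b u w] L2_mult_integrable[of a b v w]
    by (simp add: Lint_def distrib_right mult.assoc)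
qed (simp add: mult.commute)

lemma sym_form_subset: "sym_form X B \<Longrightarrow> Y \<subseteq> X \<Longrightarrow> sym_form Y B"
  unfolding sym_form_def by blast

lemma H1_form_sym_form: "sym_form {u. H1 a b u} (H1_form a b)"
  unfolding H1_form_def[abs_def]
  by (intro sym_form_add grad_form_sym_form sym_form_subset[OF L2_form_sym_form]) (auto simp: H1_def)

lemma H1_form_nonneg: "0 \<le> H1_form a b u u"
  unfolding H1_form_def Lint_def
  by (intro add_nonneg_nonneg grad_form_nonneg integral_nonneg_AE AE_I2) simp

lemma H1_norm_eq: "H1_norm a b u = sqrt (H1_form a b u u)"
  by (simp add: H1_norm_def H1_form_def grad_sq_eq power2_eq_square)

lemma H1_norm_nonneg: "0 \<le> H1_norm a b u"
  by (simp add: H1_norm_eq H1_form_nonneg)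

lemma H1_norm_lincomb:
  assumes "H1 a b u" "H1 a b v"
  shows "H1_norm a b (\<lambda>x. u x + c * v x) \<le> H1_norm a b u + \<bar>c\<bar> * H1_norm a b v"
  unfolding H1_norm_eq by (rule H1_space.form_triangle[OF H1_form_sym_form H1_form_nonneg]) (use assms in auto)

text \<open>The integral of a difference quotient vanishes by translation invariance of Lebesgue
  measure, and the quotients converge boundedly to the partial derivative. This replaces a
  slice-wise fundamental theorem with Fubini.\<close>

lemma integral_partial_derivative_eq_0:
  fixes F F' :: "real^'d \<Rightarrow> real"
  assumes cont: "continuous_on UNIV F" "continuous_on UNIV F'"
    and deriv: "\<And>x t. ((\<lambda>t. F (x + t *\<^sub>R axis i 1)) has_real_derivative F' (x + t *\<^sub>R axis i 1)) (at t)"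
    and K: "compact K" "\<And>x. x \<notin> K \<Longrightarrow> F x = 0" "\<And>x. x \<notin> K \<Longrightarrow> F' x = 0"
  shows "integrable lborel F'" and "(\<integral>x. F' x \<partial>lborel) = 0"
proof -
  have [measurable]: "F \<in> borel_measurable borel" "F' \<in> borel_measurable borel"
    using cont by (auto intro: borel_measurable_continuous_onI)
  obtain R where R: "\<And>x. x \<in> K \<Longrightarrow> norm x \<le> R" "R \<ge> 0"
    using compact_imp_bounded[OF K(1)] by (metis bounded_pos less_imp_le)
  obtain B where B: "\<And>x. \<bar>F' x\<bar> \<le> B" "B \<ge> 0"
  proof -
    have "bounded (F' ` K)"
      using cont(2) continuous_on_subset K(1) by (intro compact_imp_bounded compact_continuous_image) blast+
    then obtain B where "\<forall>x\<in>K. \<bar>F' x\<bar> \<le> B" "B > 0" by (auto simp: bounded_pos)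
    then show ?thesis using K(3) that by (metis abs_zero less_imp_le)
  qed
  have int: "integrable lborel f" if [measurable]: "f \<in> borel_measurable borel"
    and le: "\<And>x. \<bar>f x\<bar> \<le> B * indicator (cball 0 (R + 1)) x" for f :: "real^'d \<Rightarrow> real"
  proof (rule Bochner_Integration.integrable_bound)
    show "integrable lborel (\<lambda>x. B * indicator (cball 0 (R + 1)) (x :: real^'d))"
      using emeasure_compact_finite[OF compact_cball, of "0::real^'d" "R + 1"]
      by (intro integrable_mult_right integrable_real_indicator) auto
    show "AE x in lborel. norm (f x) \<le> norm (B * indicator (cball 0 (R + 1)) x)"
      using le B(2) by (intro AE_I2) (simp add: abs_mult)
  qed auto
  show "integrable lborel F'"
  proof (rule int)
    show "\<bar>F' x\<bar> \<le> B * indicator (cball 0 (R + 1)) x" for x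
      using B(1)[of x] K(3)[of x] R(1)[of x] by (cases "x \<in> K") (auto simp: indicator_def)
  qed simp
  \<comment> \<open>Steps of length at most 1 keep all shifted supports in the ball of radius R + 1,
    which carries the dominating function.\<close>
  define h where "h n = 1 / real (Suc n)" for n
  define D where "D n x = (F (x + h n *\<^sub>R axis i 1) - F x) / h n" for n x
  have h: "0 < h n" "h n \<le> 1" for n by (auto simp: h_def)
  have h0: "h \<longlonglongrightarrow> 0" unfolding h_def[abs_def] by (rule LIMSEQ_Suc[OF lim_1_over_n])
  have lim: "(\<lambda>n. D n x) \<longlonglongrightarrow> F' x" for x
  proof -
    have "((\<lambda>s. (F (x + s *\<^sub>R axis i 1) - F x) / s) \<longlongrightarrow> F' x) (at 0)"
      using deriv[of x 0] by (simp add: DERIV_def)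
    moreover have "filterlim h (at 0) sequentially"
      using h0 less_imp_neq[OF h(1), symmetric] by (auto simp: filterlim_at intro!: always_eventually)
    ultimately show ?thesis unfolding D_def by (rule filterlim_compose)
  qed
  have [measurable]: "D n \<in> borel_measurable borel" for n
    unfolding D_def[abs_def] using cont(1)
    by (intro borel_measurable_continuous_onI continuous_intros continuous_on_compose2[OF cont(1)]) (auto simp: h(1)[THEN less_imp_neq, symmetric])
  have Dle: "\<bar>D n x\<bar> \<le> B * indicator (cball 0 (R + 1)) x" for n x
  proof (cases "norm x \<le> R + 1")
    case True
    obtain z where "F (x + h n *\<^sub>R axis i 1) - F (x + 0 *\<^sub>R axis i 1) = (h n - 0) * F' (x + z *\<^sub>R axis i 1)"
      using MVT2[of 0 "h n" "\<lambda>t. F (x + t *\<^sub>R axis i 1)" "\<lambda>t. F' (x + t *\<^sub>R axis i 1)"] h(1)[of n] deriv by auto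
    then have "D n x = F' (x + z *\<^sub>R axis i 1)" using h(1)[of n] by (simp add: D_def)
    then show ?thesis using True B(1) by (simp add: indicator_def)
  next
    case False
    have "norm x \<le> norm (x + h n *\<^sub>R axis i 1) + norm (h n *\<^sub>R axis i 1 :: real^'d)"
      by (metis add_diff_cancel_right' norm_triangle_ineq4)
    then have "norm (x + h n *\<^sub>R axis i 1) > R" using False h[of n] by simp
    then have "x + h n *\<^sub>R axis i 1 \<notin> K" "x \<notin> K" using R False by fastforce+
    then show ?thesis using K(2) False by (simp add: D_def)
  qed
  have D0: "(\<integral>x. D n x \<partial>lborel) = 0" for n
  proof -
    obtain BF where BF: "\<And>x. \<bar>F x\<bar> \<le> BF"
    proof -
      have "bounded (F ` K)"
        using cont(1) continuous_on_subset K(1) by (intro compact_imp_bounded compact_continuous_image) blast+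
      then obtain B where "\<forall>x\<in>K. \<bar>F x\<bar> \<le> B" "B > 0" by (auto simp: bounded_pos)
      then show ?thesis using K(2) that by (metis abs_zero less_imp_le)
    qed
    have iF: "integrable lborel F"
    proof (rule Bochner_Integration.integrable_bound)
      show "integrable lborel (\<lambda>x. BF * indicator (cball 0 R) (x :: real^'d))"
        using emeasure_compact_finite[OF compact_cball, of "0::real^'d" R]
        by (intro integrable_mult_right integrable_real_indicator) auto
      show "AE x in lborel. norm (F x) \<le> norm (BF * indicator (cball 0 R) x)"
      proof (intro AE_I2)
        fix x show "norm (F x) \<le> norm (BF * indicator (cball 0 R) x)"
          using BF[of x] K(2)[of x] R(1)[of x] by (cases "x \<in> K") (auto simp: indicator_def)
      qed
    qed simp
    have tr: "integrable lborel (\<lambda>x. F (x + y)) \<and> (\<integral>x. F (x + y) \<partial>lborel) = (\<integral>x. F x \<partial>lborel)" for y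
    proof -
      have eq: "lborel = distr lborel borel (\<lambda>x. y + x)" by (simp add: lborel_distr_plus)
      have "integrable (distr lborel borel (\<lambda>x. y + x)) F" using iF eq by simp
      then have 1: "integrable lborel (\<lambda>x. F (y + x))" by (subst (asm) integrable_distr_eq) auto
      have "(\<integral>x. F x \<partial>distr lborel borel (\<lambda>x. y + x)) = (\<integral>x. F (y + x) \<partial>lborel)"
        by (rule integral_distr) auto
      then show ?thesis using 1 eq by (simp add: add.commute)
    qed
    show ?thesis unfolding D_def using tr[of "h n *\<^sub>R axis i 1"] iF by simp
  qed
  have "(\<lambda>n. \<integral>x. D n x \<partial>lborel) \<longlonglongrightarrow> (\<integral>x. F' x \<partial>lborel)"
  proof (rule integral_dominated_convergence)
    show "integrable lborel (\<lambda>x. B * indicator (cball 0 (R + 1)) (x :: real^'d))"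
      by (rule int) (auto simp: indicator_def B(2))
  qed (use Dle lim in \<open>auto intro!: AE_I2\<close>)
  then show "(\<integral>x. F' x \<partial>lborel) = 0" by (simp add: D0 LIMSEQ_const_iff)
qed

text \<open>Integration by parts: the product with a test function has compact support in the box,
  so its partial derivative integrates to 0 over the whole space and hence over the box.\<close>

lemma smooth_weak_grad:
  assumes \<phi>: "smooth \<phi>"
  shows "is_weak_grad a b \<phi> (\<lambda>x. \<chi> i. pd [i] \<phi> x)"
  unfolding is_weak_grad_def
proof (intro allI conjI impI)
  fix i
  show "L2 a b (\<lambda>x. (\<chi> i. pd [i] \<phi> x) $ i)" using L2_smooth[OF smooth_pd[OF \<phi>, of "[i]"]] by simp
  fix \<psi> assume \<psi>: "test_fun a b \<psi>"
  then have s: "smooth \<psi>" by (rule test_fun_smooth)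
  obtain K where K: "compact K" "K \<subseteq> Omega a b" "\<And>x. x \<notin> K \<Longrightarrow> \<psi> x = 0"
    using \<psi> unfolding test_fun_def by blast
  have K': "pd [i] \<psi> x = 0" if "x \<notin> K" for x
  \<comment> \<open>Passing to a neighbourhood is essential: vanishing at x alone says nothing about
    the derivative, but the complement of \<open>K\<close> is open.\<close>
  proof -
    have "open (- K)" using K(1) by (simp add: compact_imp_closed open_Compl)
    then have "open ((\<lambda>t. x + t *\<^sub>R axis i 1) -` (- K))"
      by (intro open_vimage) (auto intro!: continuous_intros)
    then have "\<forall>\<^sub>F t in nhds 0. t \<in> (\<lambda>t. x + t *\<^sub>R axis i 1) -` (- K)"
      using that by (intro eventually_nhds_in_open) auto
    then have "\<forall>\<^sub>F t in nhds 0. 0 = \<psi> (x + t *\<^sub>R axis i 1)"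
      by eventually_elim (simp add: K(3))
    from DERIV_cong_ev[OF refl this refl, of 0]
    have "((\<lambda>t. \<psi> (x + t *\<^sub>R axis i 1)) has_real_derivative 0) (at 0)" by simp
    then show ?thesis by (simp add: DERIV_imp_deriv)
  qed
  let ?F = "\<lambda>x. \<phi> x * \<psi> x" let ?F' = "\<lambda>x. \<phi> x * pd [i] \<psi> x + pd [i] \<phi> x * \<psi> x"
  have c: "continuous_on UNIV \<phi>" "continuous_on UNIV \<psi>" "continuous_on UNIV (pd [i] \<phi>)" "continuous_on UNIV (pd [i] \<psi>)"
    by (intro smooth_continuous smooth_pd \<phi> s)+
  have d: "((\<lambda>t. ?F (x + t *\<^sub>R axis i 1)) has_real_derivative ?F' (x + t *\<^sub>R axis i 1)) (at t)" for x t
    using DERIV_mult[OF smooth_has_partial[OF \<phi>] smooth_has_partial[OF s]]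
    by (simp add: algebra_simps del: pd.simps)
  have "(\<integral>x. ?F' x \<partial>lborel) = 0"
    by (rule integral_partial_derivative_eq_0(2)[OF _ _ d K(1)])
       (use c K(3) K' in \<open>auto intro!: continuous_intros simp del: pd.simps\<close>)
  moreover have "Lint a b ?F' = (\<integral>x. ?F' x \<partial>lborel)"
  proof -
    have "?F' \<in> borel_measurable borel"
      using c by (intro borel_measurable_continuous_onI continuous_intros)
    then have "Lint a b ?F' = (\<integral>x. indicator (Omega a b) x * ?F' x \<partial>lborel)" by (rule Lint_eq_lborel)
    also have "\<dots> = (\<integral>x. ?F' x \<partial>lborel)"
    proof (intro Bochner_Integration.integral_cong refl)
      fix x show "indicator (Omega a b) x * ?F' x = ?F' x"
        using K(2) K(3)[of x] K'[of x] by (cases "x \<in> K") (auto simp: indicator_def simp del: pd.simps)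
    qed
    finally show ?thesis .
  qed
  moreover have "Lint a b ?F' = Lint a b (\<lambda>x. \<phi> x * pd [i] \<psi> x) + Lint a b (\<lambda>x. pd [i] \<phi> x * \<psi> x)"
    using smooth_mult_integrable[OF L2_smooth[OF \<phi>] smooth_pd[OF s]]
      smooth_mult_integrable[OF L2_smooth[OF smooth_pd[OF \<phi>]] s]
    by (simp add: Lint_def del: pd.simps)
  ultimately show "Lint a b (\<lambda>x. \<phi> x * pd [i] \<psi> x) = - Lint a b (\<lambda>x. (\<chi> i. pd [i] \<phi> x) $ i * \<psi> x)"
    by (simp del: pd.simps)
qed

lemma H1_smooth: "smooth \<phi> \<Longrightarrow> H1 a b \<phi>"
  unfolding H1_def using L2_smooth smooth_weak_grad by blast

lemma wgrad_smooth:
  assumes "smooth \<phi>"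
  shows "AE x in lebesgue_on (Omega a b). wgrad a b \<phi> x = (\<chi> i. pd [i] \<phi> x)"
  by (intro weak_grad_unique[OF wgrad_weak] H1_smooth smooth_weak_grad assms)

section \<open>The space X: smooth approximation and closure under linear combinations\<close>

lemma Xsp_H1: "Xsp c a b u \<Longrightarrow> H1 a b u"
  by (auto simp: Xsp_def H1_0_def H1_per_def split: bc.splits)

lemma Xsp_smooth_approx:
  assumes "Xsp c a b u" "\<epsilon> > 0"
  obtains \<phi> where "smooth \<phi>" "H1_norm a b (\<lambda>x. u x - \<phi> x) < \<epsilon>"
proof -
  have "\<exists>\<phi>. smooth \<phi> \<and> H1_norm a b (\<lambda>x. u x - \<phi> x) < \<epsilon>"
  proof (cases c)
    case Dirichlet
    then have "\<exists>\<phi>. test_fun a b \<phi> \<and> H1_norm a b (\<lambda>x. u x - \<phi> x) < \<epsilon>"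
      using assms by (simp add: Xsp_def H1_0_def)
    then show ?thesis using test_fun_smooth by blast
  next
    case Periodic
    then have "\<exists>\<phi>. smooth \<phi> \<and> box_periodic a b \<phi> \<and> H1_norm a b (\<lambda>x. u x - \<phi> x) < \<epsilon>"
      using assms by (simp add: Xsp_def H1_per_def)
    then show ?thesis by blast
  qed
  then show ?thesis using that by blast
qed

text \<open>\<open>P\<close> stands for the approximating class, so test functions and smooth
  periodic functions share one argument.\<close>

lemma H1_approx_lincomb:
  assumes H: "H1 a b u" "H1 a b v"
    and P: "\<And>\<phi> \<psi>. P \<phi> \<Longrightarrow> P \<psi> \<Longrightarrow> P (\<lambda>x. \<phi> x + c * \<psi> x)" "\<And>\<phi>. P \<phi> \<Longrightarrow> smooth \<phi>"
    and u: "\<forall>\<epsilon>>0. \<exists>\<phi>. P \<phi> \<and> H1_norm a b (\<lambda>x. u x - \<phi> x) < \<epsilon>"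
    and v: "\<forall>\<epsilon>>0. \<exists>\<phi>. P \<phi> \<and> H1_norm a b (\<lambda>x. v x - \<phi> x) < \<epsilon>"
  shows "\<forall>\<epsilon>>0. \<exists>\<phi>. P \<phi> \<and> H1_norm a b (\<lambda>x. (u x + c * v x) - \<phi> x) < \<epsilon>"
proof (intro allI impI)
  fix \<epsilon> :: real assume \<epsilon>: "\<epsilon> > 0"
  obtain \<phi> where \<phi>: "P \<phi>" "H1_norm a b (\<lambda>x. u x - \<phi> x) < \<epsilon> / 2" using u \<epsilon> by (metis half_gt_zero)
  have "\<epsilon> / 2 / (\<bar>c\<bar> + 1) > 0" using \<epsilon> by simp
  then obtain \<psi> where \<psi>: "P \<psi>" "H1_norm a b (\<lambda>x. v x - \<psi> x) < \<epsilon> / 2 / (\<bar>c\<bar> + 1)" using v by blast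
  have D: "H1 a b (\<lambda>x. w x - \<eta> x)" if "H1 a b w" "P \<eta>" for w \<eta>
    using H1_lincomb[OF that(1) H1_smooth[OF P(2)[OF that(2)]], of "-1"] by simp
  have "H1_norm a b (\<lambda>x. (u x - \<phi> x) + c * (v x - \<psi> x)) \<le> H1_norm a b (\<lambda>x. u x - \<phi> x) + \<bar>c\<bar> * H1_norm a b (\<lambda>x. v x - \<psi> x)"
    by (rule H1_norm_lincomb[OF D D]) fact+
  also have "\<bar>c\<bar> * H1_norm a b (\<lambda>x. v x - \<psi> x) \<le> \<bar>c\<bar> * (\<epsilon> / 2 / (\<bar>c\<bar> + 1))"
    using \<psi>(2) by (intro mult_left_mono) auto
  also have "\<bar>c\<bar> * (\<epsilon> / 2 / (\<bar>c\<bar> + 1)) \<le> \<epsilon> / 2" using \<epsilon> by (simp add: field_simps)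
  finally have "H1_norm a b (\<lambda>x. (u x - \<phi> x) + c * (v x - \<psi> x)) < \<epsilon>" using \<phi>(2) by linarith
  moreover have "(\<lambda>x. (u x - \<phi> x) + c * (v x - \<psi> x)) = (\<lambda>x. (u x + c * v x) - (\<phi> x + c * \<psi> x))"
    by (simp add: algebra_simps)
  ultimately show "\<exists>\<phi>. P \<phi> \<and> H1_norm a b (\<lambda>x. (u x + c * v x) - \<phi> x) < \<epsilon>"
    using P(1)[OF \<phi>(1) \<psi>(1)] by (intro exI[of _ "\<lambda>x. \<phi> x + c * \<psi> x"]) simp
qed

lemma Xsp_lincomb:
  assumes "Xsp bc a b u" "Xsp bc a b v"
  shows "Xsp bc a b (\<lambda>x. u x + c * v x)"
proof (cases bc)
  case Dirichlet
  have "\<forall>\<epsilon>>0. \<exists>\<phi>. test_fun a b \<phi> \<and> H1_norm a b (\<lambda>x. (u x + c * v x) - \<phi> x) < \<epsilon>"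
    by (rule H1_approx_lincomb) (use assms Dirichlet in \<open>auto simp: Xsp_def H1_0_def test_fun_lincomb test_fun_smooth\<close>)
  then show ?thesis using assms Dirichlet by (simp add: Xsp_def H1_0_def H1_lincomb)
next
  case Periodic
  have "\<forall>\<epsilon>>0. \<exists>\<phi>. (smooth \<phi> \<and> box_periodic a b \<phi>) \<and> H1_norm a b (\<lambda>x. (u x + c * v x) - \<phi> x) < \<epsilon>"
    by (rule H1_approx_lincomb) (use assms Periodic in \<open>auto simp: Xsp_def H1_per_def box_periodic_def smooth_lincomb\<close>)
  then show ?thesis using assms Periodic by (simp add: Xsp_def H1_per_def H1_lincomb)
qed

section \<open>The Sobolev inequality on a box\<close>

lemma integrable_on_cbox_if_continuous:
  fixes f :: "'a::euclidean_space \<Rightarrow> real"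
  assumes "continuous_on UNIV f"
  shows "f integrable_on cbox a b"
  using assms continuous_on_subset by (intro integrable_continuous) blast

text \<open>The contraction towards x maps the box into itself by convexity, and the change of
  variables costs t^(-d); enlarging the image to the whole box is harmless for a nonnegative
  integrand.\<close>

lemma integral_contraction_le:
  fixes f :: "'a::euclidean_space \<Rightarrow> real"
  assumes f: "continuous_on UNIV f" "\<And>x. 0 \<le> f x" and t: "0 < t" "t \<le> 1" and x: "x \<in> cbox a b"
  shows "integral (cbox a b) (\<lambda>y. f (x + t *\<^sub>R (y - x))) \<le> integral (cbox a b) f / t ^ DIM('a)"
proof -
  let ?c = "(1 - t) *\<^sub>R x"
  \<comment> \<open>The preimage of the box under the contraction; it contains the box because x
    lies in the box.\<close>
  let ?S = "cbox ((a - ?c) /\<^sub>R t) ((b - ?c) /\<^sub>R t)"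
  have eq: "x + t *\<^sub>R (y - x) = t *\<^sub>R y + ?c" for y by (simp add: algebra_simps)
  have "((\<lambda>y. f (t *\<^sub>R y + ?c)) has_integral (integral (cbox a b) f /\<^sub>R t ^ DIM('a))) ?S"
    by (intro has_integral_affinity' integrable_integral integrable_on_cbox_if_continuous f t)
  then have I: "integral ?S (\<lambda>y. f (x + t *\<^sub>R (y - x))) = integral (cbox a b) f / t ^ DIM('a)"
    unfolding eq by (simp add: integral_unique divide_inverse mult.commute)
  have "cbox a b \<subseteq> ?S"
  proof
    fix y assume y: "y \<in> cbox a b"
    show "y \<in> ?S"
      unfolding mem_box
    proof
      fix i :: 'a assume i: "i \<in> Basis"
      have y': "a \<bullet> i \<le> y \<bullet> i" "y \<bullet> i \<le> b \<bullet> i" and x': "a \<bullet> i \<le> x \<bullet> i" "x \<bullet> i \<le> b \<bullet> i"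
        using x y i by (auto simp: mem_box)
      have "(1 - t) * (a \<bullet> i) \<le> (1 - t) * (x \<bullet> i)" "(1 - t) * (x \<bullet> i) \<le> (1 - t) * (b \<bullet> i)"
        "t * (a \<bullet> i) \<le> t * (y \<bullet> i)" "t * (y \<bullet> i) \<le> t * (b \<bullet> i)"
        using x' y' t by (auto intro!: mult_left_mono)
      then have "a \<bullet> i - (1 - t) * (x \<bullet> i) \<le> t * (y \<bullet> i)" "t * (y \<bullet> i) \<le> b \<bullet> i - (1 - t) * (x \<bullet> i)"
        by (simp_all add: algebra_simps)
      moreover have "((w - ?c) /\<^sub>R t) \<bullet> i = (w \<bullet> i - (1 - t) * (x \<bullet> i)) / t" for w
        by (simp add: inner_diff_left divide_inverse mult.commute)
      ultimately show "((a - ?c) /\<^sub>R t) \<bullet> i \<le> y \<bullet> i \<and> y \<bullet> i \<le> ((b - ?c) /\<^sub>R t) \<bullet> i"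
        using t by (simp only: pos_divide_le_eq pos_le_divide_eq mult.commute)
    qed
  qed
  moreover have "continuous_on UNIV (\<lambda>y. f (x + t *\<^sub>R (y - x)))"
    by (intro continuous_on_compose2[OF f(1)] continuous_intros) auto
  ultimately have "integral (cbox a b) (\<lambda>y. f (x + t *\<^sub>R (y - x))) \<le> integral ?S (\<lambda>y. f (x + t *\<^sub>R (y - x)))"
    by (intro integral_subset_le integrable_on_cbox_if_continuous) (auto simp: f)
  then show ?thesis by (simp only: I)
qed

text \<open>Cauchy-Schwarz against the constant 1, from the discriminant of the integral of (f +
  t)^2.\<close>

lemma integral_square_le:
  fixes f :: "'a::euclidean_space \<Rightarrow> real"
  assumes f: "continuous_on UNIV f"
  shows "(integral (cbox a b) f)\<^sup>2 \<le> integral (cbox a b) (\<lambda>x. (f x)\<^sup>2) * measure lborel (cbox a b)"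
proof (rule discriminant_le)
  fix t
  have i: "f integrable_on cbox a b" "(\<lambda>x. (f x)\<^sup>2) integrable_on cbox a b"
    using f by (auto intro!: integrable_on_cbox_if_continuous continuous_intros)
  have "0 \<le> integral (cbox a b) (\<lambda>x. (f x + t)\<^sup>2)"
    using f by (intro integral_nonneg integrable_on_cbox_if_continuous continuous_intros) auto
  also have "(\<lambda>x. (f x + t)\<^sup>2) = (\<lambda>x. (f x)\<^sup>2 + (2 * t * f x + t\<^sup>2))"
    by (auto simp: power2_eq_square algebra_simps)
  also have "integral (cbox a b) \<dots> = integral (cbox a b) (\<lambda>x. (f x)\<^sup>2) + (2 * t * integral (cbox a b) f + t\<^sup>2 * measure lborel (cbox a b))"
  proof (rule integral_unique)
    have "((\<lambda>x. t\<^sup>2) has_integral t\<^sup>2 * measure lborel (cbox a b)) (cbox a b)"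
      using has_integral_const[of "t\<^sup>2" a b] by (simp add: mult.commute)
    then show "((\<lambda>x. (f x)\<^sup>2 + (2 * t * f x + t\<^sup>2)) has_integral
      integral (cbox a b) (\<lambda>x. (f x)\<^sup>2) + (2 * t * integral (cbox a b) f + t\<^sup>2 * measure lborel (cbox a b))) (cbox a b)"
      by (intro has_integral_add has_integral_mult_right integrable_integral i)
  qed
  finally show "0 \<le> integral (cbox a b) (\<lambda>x. (f x)\<^sup>2) + 2 * t * integral (cbox a b) f + t\<^sup>2 * measure lborel (cbox a b)"
    by (simp add: add.assoc)
qed simp

text \<open>The path \<open>s \<mapsto> x + s^k (y - x)\<close> slows down near \<open>x\<close>; the weight \<open>s^(k-1)\<close> gained in this way later
  absorbs the singularity \<open>s^(-kd/2)\<close> of averages over shrinking boxes.\<close>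
lemma oscillation_along_path:
  fixes u :: "'a::euclidean_space \<Rightarrow> real" and Du :: "'a \<Rightarrow> 'a"
  assumes u: "\<And>x. (u has_derivative (\<lambda>h. Du x \<bullet> h)) (at x)" and Du: "continuous_on UNIV Du"
    and D: "norm (y - x) \<le> D" and k: "k > 0"
  shows "\<bar>u x\<bar> \<le> \<bar>u y\<bar> + integral (cbox 0 1) (\<lambda>s. D * real k * s ^ (k - 1) * norm (Du (x + s ^ k *\<^sub>R (y - x))))"
proof -
  let ?z = "\<lambda>s::real. x + s ^ k *\<^sub>R (y - x)"
  let ?f' = "\<lambda>s. Du (?z s) \<bullet> ((real k * s ^ (k - 1)) *\<^sub>R (y - x))"
  have cz: "continuous_on UNIV ?z" by (intro continuous_intros)
  have cD: "continuous_on UNIV (\<lambda>s. Du (?z s))" by (rule continuous_on_compose2[OF Du cz]) auto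
  have "((\<lambda>s. u (?z s)) has_vector_derivative ?f' s) (at s within {0..1})" for s
  proof -
    have "((\<lambda>s. s ^ k) has_real_derivative real k * s ^ (k - 1)) (at s within {0..1})"
      by (auto intro!: derivative_eq_intros)
    then have "(?z has_vector_derivative (real k * s ^ (k - 1)) *\<^sub>R (y - x)) (at s within {0..1})"
      by (auto intro!: derivative_eq_intros simp: has_real_derivative_iff_has_vector_derivative)
    then have "(?z has_derivative (\<lambda>t. t *\<^sub>R ((real k * s ^ (k - 1)) *\<^sub>R (y - x)))) (at s within {0..1})"
      by (simp only: has_vector_derivative_def)
    from has_derivative_compose[OF this u] show ?thesis
      by (simp add: has_vector_derivative_def mult.assoc)
  qed
  then have "(?f' has_integral (u (?z 1) - u (?z 0))) {0..1}"
    by (intro fundamental_theorem_of_calculus) auto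
  then have FTC: "integral (cbox 0 1) ?f' = u y - u x" and int: "?f' integrable_on cbox 0 1"
    using k by (auto simp: zero_power integral_unique integrable_on_def cbox_interval)
  have "norm (integral (cbox 0 1) ?f') \<le> integral (cbox 0 1) (\<lambda>s. D * real k * s ^ (k - 1) * norm (Du (?z s)))"
  proof (rule integral_norm_bound_integral[OF int])
    show "(\<lambda>s. D * real k * s ^ (k - 1) * norm (Du (?z s))) integrable_on cbox 0 1"
      using cD by (intro integrable_on_cbox_if_continuous continuous_intros)
    fix s :: real assume s: "s \<in> cbox 0 1"
    have "norm (?f' s) \<le> norm (Du (?z s)) * norm ((real k * s ^ (k - 1)) *\<^sub>R (y - x))"
      using Cauchy_Schwarz_ineq2 by (simp only: real_norm_def)
    also have "\<dots> = norm (Du (?z s)) * (real k * s ^ (k - 1)) * norm (y - x)"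
      using s by (simp add: abs_mult)
    also have "\<dots> \<le> norm (Du (?z s)) * (real k * s ^ (k - 1)) * D"
      using s by (intro mult_left_mono D) auto
    finally show "norm (?f' s) \<le> D * real k * s ^ (k - 1) * norm (Du (?z s))" by (simp add: mult_ac)
  qed
  then show ?thesis unfolding FTC by simp
qed

text \<open>For s > 0 this is the mean of \<open>g\<close> over the copy of the box shrunk towards x
  by the factor s^k.\<close>

definition path_avg :: "'a::euclidean_space \<Rightarrow> 'a \<Rightarrow> ('a \<Rightarrow> real) \<Rightarrow> nat \<Rightarrow> 'a \<Rightarrow> real \<Rightarrow> real" where
  "path_avg a b g k x s =
     integral (cbox a b) (\<lambda>y. g (x + s ^ k *\<^sub>R (y - x))) / measure lborel (cbox a b)"

context
  fixes a b :: "'a::euclidean_space" and g :: "'a \<Rightarrow> real" and k :: nat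
  assumes g: "continuous_on UNIV g" and g_nonneg: "\<And>x. 0 \<le> g x"
    and content_pos: "measure lborel (cbox a b) > 0"
begin

lemma path_avg_nonneg: "0 \<le> path_avg a b g k x s"
  unfolding path_avg_def
  by (intro divide_nonneg_nonneg integral_nonneg integrable_on_cbox_if_continuous
      continuous_on_compose2[OF g] continuous_intros g_nonneg) auto

lemma path_avg_continuous: "continuous_on UNIV (\<lambda>p. path_avg a b g k (fst p) (snd p))"
  unfolding path_avg_def using content_pos
  by (intro continuous_on_divide integral_continuous_on_param continuous_on_const)
     (auto simp: split_beta intro!: continuous_on_compose2[OF g] continuous_intros)

lemma path_avg_continuous_snd: "continuous_on UNIV (path_avg a b g k x)"
proof -
  have "continuous_on UNIV (\<lambda>s. path_avg a b g k (fst (x, s)) (snd (x, s)))"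
    by (rule continuous_on_compose2[OF path_avg_continuous]) (auto intro!: continuous_intros)
  then show ?thesis by simp
qed

lemma path_avg_continuous_fst: "continuous_on UNIV (\<lambda>x. path_avg a b g k x s)"
proof -
  have "continuous_on UNIV (\<lambda>x. path_avg a b g k (fst (x, s)) (snd (x, s)))"
    by (rule continuous_on_compose2[OF path_avg_continuous]) (auto intro!: continuous_intros)
  then show ?thesis by simp
qed

lemma path_avg_le:
  assumes "x \<in> cbox a b" "0 < s" "s \<le> 1"
  shows "path_avg a b g k x s \<le> integral (cbox a b) g / (s ^ k) ^ DIM('a) / measure lborel (cbox a b)"
  unfolding path_avg_def using assms content_pos
  by (intro divide_right_mono integral_contraction_le g g_nonneg) (auto simp: power_le_one)

text \<open>The bound must not degenerate as s tends to 0. If s^k >= 1/2 the pointwise bound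
  suffices; otherwise the order of integration is exchanged and, for fixed y, the map in x is a
  contraction towards y by the factor 1 - s^k > 1/2.\<close>

lemma integral_path_avg_le:
  assumes s: "0 \<le> s" "s \<le> 1"
  shows "integral (cbox a b) (\<lambda>x. path_avg a b g k x s) \<le> 2 ^ DIM('a) * integral (cbox a b) g"
proof -
  let ?t = "s ^ k" let ?Q = "cbox a b" let ?v = "measure lborel (cbox a b)"
  have t: "0 \<le> ?t" "?t \<le> 1" using s by (auto simp: power_le_one)
  have G: "0 \<le> integral ?Q g"
    by (intro integral_nonneg integrable_on_cbox_if_continuous g g_nonneg)
  have const: "integral ?Q (\<lambda>x. f x) \<le> ?v * c" if "\<And>x. x \<in> ?Q \<Longrightarrow> f x \<le> c" "continuous_on UNIV f" for f c
  proof -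
    have "integral ?Q f \<le> integral ?Q (\<lambda>_. c)"
      by (intro integral_le integrable_on_cbox_if_continuous that continuous_on_const)
    then show ?thesis by simp
  qed
  have half: "integral ?Q g / r ^ DIM('a) \<le> 2 ^ DIM('a) * integral ?Q g" if "1 / 2 \<le> r" for r :: real
  proof -
    have "(1 / 2) ^ DIM('a) \<le> r ^ DIM('a)" using that by (intro power_mono) auto
    then have "1 / r ^ DIM('a) \<le> 2 ^ DIM('a)" using that by (simp add: power_divide field_simps)
    then show ?thesis using mult_right_mono[OF _ G] by fastforce
  qed
  show ?thesis
  proof (cases "1 / 2 \<le> ?t")
    case True
    have "integral ?Q (\<lambda>x. path_avg a b g k x s) \<le> ?v * (2 ^ DIM('a) * integral ?Q g / ?v)"
    proof (rule const[OF _ path_avg_continuous_fst])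
      fix x assume x: "x \<in> ?Q"
      have "path_avg a b g k x s \<le> integral ?Q g / ?t ^ DIM('a) / ?v"
        unfolding path_avg_def using True t content_pos x
        by (intro divide_right_mono integral_contraction_le g g_nonneg) auto
      also have "\<dots> \<le> 2 ^ DIM('a) * integral ?Q g / ?v"
        using content_pos by (intro divide_right_mono half True) auto
      finally show "path_avg a b g k x s \<le> 2 ^ DIM('a) * integral ?Q g / ?v" .
    qed
    then show ?thesis using content_pos by simp
  next
    case False
    have c: "continuous_on UNIV (\<lambda>(x, y). g (x + ?t *\<^sub>R (y - x)))"
      by (auto simp: split_beta intro!: continuous_on_compose2[OF g] continuous_intros)
    have "integral ?Q (\<lambda>x. path_avg a b g k x s) = integral ?Q (\<lambda>x. integral ?Q (\<lambda>y. g (x + ?t *\<^sub>R (y - x)))) / ?v"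
      unfolding path_avg_def by simp
    also have "integral ?Q (\<lambda>x. integral ?Q (\<lambda>y. g (x + ?t *\<^sub>R (y - x)))) = integral ?Q (\<lambda>y. integral ?Q (\<lambda>x. g (x + ?t *\<^sub>R (y - x))))"
      by (rule integral_swap_continuous) (use c continuous_on_subset in blast)
    also have "\<dots> \<le> ?v * (2 ^ DIM('a) * integral ?Q g)"
    proof (rule const)
      fix y assume y: "y \<in> ?Q"
      have "integral ?Q (\<lambda>x. g (x + ?t *\<^sub>R (y - x))) = integral ?Q (\<lambda>x. g (y + (1 - ?t) *\<^sub>R (x - y)))"
        by (simp add: algebra_simps)
      also have "\<dots> \<le> integral ?Q g / (1 - ?t) ^ DIM('a)"
        using False t y by (intro integral_contraction_le g g_nonneg) auto
      also have "\<dots> \<le> 2 ^ DIM('a) * integral ?Q g" by (rule half) (use False in auto)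
      finally show "integral ?Q (\<lambda>x. g (x + ?t *\<^sub>R (y - x))) \<le> 2 ^ DIM('a) * integral ?Q g" .
    next
      show "continuous_on UNIV (\<lambda>y. integral ?Q (\<lambda>x. g (x + ?t *\<^sub>R (y - x))))"
        by (rule integral_continuous_on_param)
           (auto simp: split_beta intro!: continuous_on_compose2[OF g] continuous_intros)
    qed
    finally show ?thesis using content_pos by (simp add: divide_right_mono field_simps)
  qed
qed

end

text \<open>The convex function z^q lies above its tangent at F. Integrated over the unit interval
  with F the mean of \<phi>, this gives Jensen's inequality.\<close>

lemma Young_tangent:
  fixes \<phi> F q :: real
  assumes "q > 1" "\<phi> \<ge> 0" "F \<ge> 0"
  shows "q * F powr (q - 1) * \<phi> \<le> \<phi> powr q + (q - 1) * F powr q"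
proof -
  have "\<phi> * F powr (q - 1) \<le> \<phi> powr q / q + (F powr (q - 1)) powr (q / (q - 1)) / (q / (q - 1))"
    using assms by (intro Youngs_inequality) (auto simp: field_simps)
  also have "(F powr (q - 1)) powr (q / (q - 1)) = F powr q"
    using assms by (simp add: powr_powr)
  finally have "q * (\<phi> * F powr (q - 1)) \<le> q * (\<phi> powr q / q + F powr q / (q / (q - 1)))"
    using assms by (intro mult_left_mono) auto
  also have "\<dots> = \<phi> powr q + (q - 1) * F powr q"
    using assms by (simp add: distrib_left)
  finally show ?thesis by (simp add: mult_ac)
qed

lemma powr_add_le:
  fixes m F q :: real
  assumes "q > 0" "m \<ge> 0" "F \<ge> 0"
  shows "(m + F) powr q \<le> 2 powr q * (m powr q + F powr q)"
proof -
  have "(m + F) powr q \<le> (2 * max m F) powr q" using assms by (intro powr_mono2) auto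
  also have "\<dots> = 2 powr q * max m F powr q" using assms by (simp add: powr_mult)
  also have "\<dots> \<le> 2 powr q * (m powr q + F powr q)"
    by (intro mult_left_mono) (auto simp: max_def)
  finally show ?thesis .
qed

lemma path_avg_square_le:
  fixes a b :: "'a::euclidean_space" and g :: "'a \<Rightarrow> real"
  assumes g: "continuous_on UNIV g" and v: "measure lborel (cbox a b) > 0"
  shows "(path_avg a b g k x s)\<^sup>2 \<le> path_avg a b (\<lambda>x. (g x)\<^sup>2) k x s"
proof -
  let ?v = "measure lborel (cbox a b)" let ?f = "\<lambda>y. g (x + s ^ k *\<^sub>R (y - x))"
  have "continuous_on UNIV ?f"
    by (intro continuous_on_compose2[OF g] continuous_intros) auto
  then have "(integral (cbox a b) ?f)\<^sup>2 / ?v\<^sup>2 \<le> integral (cbox a b) (\<lambda>y. (?f y)\<^sup>2) * ?v / ?v\<^sup>2"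
    by (intro divide_right_mono integral_square_le) auto
  then show ?thesis
    using v by (simp add: path_avg_def power_divide power2_eq_square)
qed


text \<open>With e = (q-2)/2, the q-th power of the averaged gradient is at most H^e H, where H
  averages the squared gradient. H^e is bounded pointwise at the cost s^(-k d e), while H is
  integrated in x without loss. Against the weight s^((k-1) q) the exponent of s is k \<theta> - q
  with \<theta> = q - d e, and \<theta> > 0 is exactly subcriticality.\<close>

lemma Sobolev_box:
  fixes a b :: "'a::euclidean_space" and q :: real
  assumes v_pos: "measure lborel (cbox a b) > 0" and q: "q > 2" "DIM('a) * (q - 2) < 2 * q"
  obtains C where "C > 0"
    "\<And>u Du. (\<And>x. (u has_derivative (\<lambda>h. Du x \<bullet> h)) (at x)) \<Longrightarrow> continuous_on UNIV Du \<Longrightarrow>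
       integral (cbox a b) (\<lambda>x. \<bar>u x\<bar> powr q)
         \<le> C * integral (cbox a b) (\<lambda>x. (u x)\<^sup>2 + (norm (Du x))\<^sup>2) powr (q / 2)"
proof -
  let ?Q = "cbox a b" let ?d = "DIM('a)"
  define v where "v = measure lborel ?Q"
  have v: "v > 0" using v_pos by (simp add: v_def)
  define e where "e = (q - 2) / 2"
  define \<theta> where "\<theta> = q - ?d * e"
  have \<theta>: "\<theta> > 0" using q by (simp add: \<theta>_def e_def field_simps)
  have e: "e > 0" using q by (simp add: e_def)
  \<comment> \<open>Large enough for k \<theta> >= q, so that the remaining power of s is bounded; k
    >= 2 makes the weight s^(k-1) vanish at s = 0.\<close>
  define k where "k = max 2 (nat \<lceil>q / \<theta>\<rceil>)"
  have k: "k \<ge> 2" "q \<le> real k * \<theta>"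
  proof -
    have "q / \<theta> \<le> real k" unfolding k_def by linarith
    then show "q \<le> real k * \<theta>" using \<theta> by (simp add: field_simps)
  qed (simp add: k_def)
  obtain D where D: "D > 0" "\<And>x y. x \<in> ?Q \<Longrightarrow> y \<in> ?Q \<Longrightarrow> norm (y - x) \<le> D"
  proof -
    obtain B where B: "B > 0" "\<And>x. x \<in> ?Q \<Longrightarrow> norm x \<le> B"
      using bounded_cbox[of a b] by (auto simp: bounded_pos)
    have "norm (y - x) \<le> 2 * B" if "x \<in> ?Q" "y \<in> ?Q" for x y
      using norm_triangle_ineq4[of y x] B(2)[OF that(1)] B(2)[OF that(2)] by linarith
    then show ?thesis using that[of "2 * B"] B(1) by auto
  qed
  define A where "A = D * real k"
  have A: "A > 0" using D k by (simp add: A_def)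
  define C1 where "C1 = A powr q * v powr (- e)"
  have C1: "C1 > 0" using A v by (simp add: C1_def)
  \<comment> \<open>2^q splits (m + F)^q; the first summand bounds the mean m by Cauchy-Schwarz, the
    second the oscillation F, with 2^d from the integrated path averages.\<close>
  define C where "C = 2 powr q * (v * (1 / v) powr (q / 2) + C1 * 2 ^ ?d)"
  have C: "C > 0" unfolding C_def using C1 v by (intro mult_pos_pos add_nonneg_pos) auto
  have main: "integral ?Q (\<lambda>x. \<bar>u x\<bar> powr q) \<le> C * integral ?Q (\<lambda>x. (u x)\<^sup>2 + (norm (Du x))\<^sup>2) powr (q / 2)"
    if u: "\<And>x. (u has_derivative (\<lambda>h. Du x \<bullet> h)) (at x)" and Du: "continuous_on UNIV Du" for u Du
  proof -
    define g where "g x = norm (Du x)" for x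
    define g2 where "g2 x = (g x)\<^sup>2" for x
    have g: "continuous_on UNIV g" "\<And>x. 0 \<le> g x"
      unfolding g_def[abs_def] using Du by (auto intro!: continuous_intros)
    have g2: "continuous_on UNIV g2" "\<And>x. 0 \<le> g2 x"
      unfolding g2_def[abs_def] using g by (auto intro!: continuous_intros)
    have cu: "continuous_on UNIV u"
      using u by (intro continuous_at_imp_continuous_on ballI has_derivative_continuous) auto
    define G2 where "G2 = integral ?Q g2"
    define E2 where "E2 = integral ?Q (\<lambda>x. (u x)\<^sup>2 + g2 x)"
    have u2: "continuous_on UNIV (\<lambda>x. (u x)\<^sup>2)" using cu by (intro continuous_intros)
    have E2: "E2 = integral ?Q (\<lambda>x. (u x)\<^sup>2) + G2"
      unfolding E2_def G2_def by (intro integral_add integrable_on_cbox_if_continuous u2 g2)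
    have nonneg: "0 \<le> G2" "0 \<le> integral ?Q (\<lambda>x. (u x)\<^sup>2)"
      unfolding G2_def by (auto intro!: integral_nonneg integrable_on_cbox_if_continuous u2 g2)
    define m where "m = integral ?Q (\<lambda>x. \<bar>u x\<bar>) / v"
    have m0: "0 \<le> m" unfolding m_def using v cu
      by (intro divide_nonneg_nonneg integral_nonneg integrable_on_cbox_if_continuous continuous_intros) auto
    define h where "h = path_avg a b g k"
    define H where "H = path_avg a b g2 k"
    have h0: "0 \<le> h x s" and H0: "0 \<le> H x s" for x s
      unfolding h_def H_def using path_avg_nonneg[OF g v_pos] path_avg_nonneg[OF g2 v_pos] by auto
    have hH: "(h x s)\<^sup>2 \<le> H x s" for x s
      unfolding h_def H_def g2_def[abs_def] by (rule path_avg_square_le[OF g(1) v_pos])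
    define \<phi> where "\<phi> x s = A * s ^ (k - 1) * h x s" for x s
    define F where "F x = integral (cbox 0 1) (\<phi> x)" for x
    have \<phi>0: "0 \<le> \<phi> x s" if "0 \<le> s" for x s
      unfolding \<phi>_def using A h0 that by simp
    have c\<phi>: "continuous_on UNIV (\<phi> x)" for x
      unfolding \<phi>_def[abs_def] h_def by (intro continuous_intros path_avg_continuous_snd g v_pos)
    have F0: "0 \<le> F x" for x
      unfolding F_def by (intro integral_nonneg integrable_on_cbox_if_continuous c\<phi>) (auto intro: \<phi>0)
    have u_le: "\<bar>u x\<bar> \<le> m + F x" if x: "x \<in> ?Q" for x
    proof -
      let ?w = "\<lambda>y s. A * s ^ (k - 1) * g (x + s ^ k *\<^sub>R (y - x))"
      have cw: "continuous_on S (\<lambda>(y, s). ?w y s)" for S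
        by (auto simp: split_beta intro!: continuous_intros continuous_on_compose2[OF g(1)])
      have cw1: "continuous_on UNIV (\<lambda>y. integral (cbox 0 1) (?w y))"
        by (rule integral_continuous_on_param[OF cw])
      have "integral ?Q (\<lambda>y. \<bar>u x\<bar>) \<le> integral ?Q (\<lambda>y. \<bar>u y\<bar> + integral (cbox 0 1) (?w y))"
      proof (rule integral_le)
        show "(\<lambda>y. \<bar>u y\<bar> + integral (cbox 0 1) (?w y)) integrable_on ?Q"
          using cu cw1 by (intro integrable_on_cbox_if_continuous continuous_intros)
        fix y assume y: "y \<in> ?Q"
        show "\<bar>u x\<bar> \<le> \<bar>u y\<bar> + integral (cbox 0 1) (?w y)"
          using oscillation_along_path[OF u Du D(2)[OF x y], of k] k by (simp add: A_def g_def)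
      qed (rule integrable_on_cbox_if_continuous, rule continuous_on_const)
      also have "\<dots> = integral ?Q (\<lambda>y. \<bar>u y\<bar>) + integral ?Q (\<lambda>y. integral (cbox 0 1) (?w y))"
        using cu cw1 by (intro integral_add integrable_on_cbox_if_continuous continuous_intros)
      \<comment> \<open>Averaging over y first is what turns the line integrals into path
        averages.\<close>
      also have "integral ?Q (\<lambda>y. integral (cbox 0 1) (?w y)) = integral (cbox 0 1) (\<lambda>s. integral ?Q (\<lambda>y. ?w y s))"
        by (rule integral_swap_continuous[OF cw])
      also have "\<dots> = integral (cbox 0 1) (\<lambda>s. v * \<phi> x s)"
        using v by (simp add: \<phi>_def h_def path_avg_def v_def)
      also have "\<dots> = v * F x" by (simp add: F_def)
      finally have "v * \<bar>u x\<bar> \<le> integral ?Q (\<lambda>y. \<bar>u y\<bar>) + v * F x" by (simp add: v_def)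
      then show ?thesis using v by (simp add: m_def field_simps)
    qed
    have \<phi>_le: "\<phi> x s powr q \<le> C1 * G2 powr e * H x s" if x: "x \<in> ?Q" and s: "0 \<le> s" "s \<le> 1" for x s
    proof (cases "s = 0")
      case True
      then have "\<phi> x s = 0" using k by (simp add: \<phi>_def)
      then show ?thesis using C1 H0 by simp
    next
      case False
      then have s0: "s > 0" using s by simp
      have qe: "q / 2 = e + 1" by (simp add: e_def field_simps)
      \<comment> \<open>Cauchy-Schwarz passes from h to H, leaving H^(e+1): e powers are spent on
        the pointwise bound, one is kept for the integration in x.\<close>
      have "h x s powr q = (h x s powr 2) powr (q / 2)" by (simp add: powr_powr)
      also have "\<dots> = ((h x s)\<^sup>2) powr (q / 2)" using h0 by (simp add: powr_numeral)
      also have "\<dots> \<le> H x s powr (q / 2)" using q hH by (intro powr_mono2) auto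
      also have "\<dots> = H x s powr e * H x s" using H0 by (simp add: qe powr_add)
      also have "\<dots> \<le> (G2 / (s ^ k) ^ ?d / v) powr e * H x s"
      proof (intro mult_right_mono powr_mono2)
        show "H x s \<le> G2 / (s ^ k) ^ ?d / v"
          unfolding H_def G2_def v_def by (rule path_avg_le[OF g2 v_pos x s0 s(2)])
      qed (use e H0 in auto)
      also have "(G2 / (s ^ k) ^ ?d / v) powr e = G2 powr e * v powr (- e) * s powr (- (real k * ?d * e))"
      proof -
        have "((s ^ k) ^ ?d) = s powr (real k * ?d)"
          using s0 by (simp add: powr_realpow[symmetric] powr_powr power_mult[symmetric])
        then have "((s ^ k) ^ ?d) powr e = s powr (real k * ?d * e)" by (simp only: powr_powr)
        then show ?thesis
          unfolding powr_divide by (simp only: powr_minus divide_inverse mult_ac)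
      qed
      finally have hq: "h x s powr q \<le> G2 powr e * v powr (- e) * s powr (- (real k * ?d * e)) * H x s" .
      have "\<phi> x s powr q = A powr q * s powr ((real k - 1) * q) * h x s powr q"
        using A s0 h0 k by (simp add: \<phi>_def powr_mult powr_realpow[symmetric] powr_powr of_nat_diff)
      also have "\<dots> \<le> A powr q * s powr ((real k - 1) * q) * (G2 powr e * v powr (- e) * s powr (- (real k * ?d * e)) * H x s)"
        by (intro mult_left_mono hq) auto
      also have "\<dots> = (C1 * G2 powr e * H x s) * (s powr ((real k - 1) * q) * s powr (- (real k * ?d * e)))"
        by (simp add: C1_def mult_ac)
      also have "\<dots> \<le> (C1 * G2 powr e * H x s) * 1"
      proof (rule mult_left_mono)
        have "s powr ((real k - 1) * q) * s powr (- (real k * ?d * e)) = s powr (real k * \<theta> - q)"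
          unfolding powr_add[symmetric] by (simp add: \<theta>_def algebra_simps)
        also have "\<dots> \<le> 1 powr (real k * \<theta> - q)" using k s0 s by (intro powr_mono2) auto
        finally show "s powr ((real k - 1) * q) * s powr (- (real k * ?d * e)) \<le> 1" by simp
      qed (use C1 H0 in auto)
      finally show ?thesis by simp
    qed
    have cH: "continuous_on S (\<lambda>(x, s). H x s)" for S
      unfolding H_def split_beta using path_avg_continuous[OF g2 v_pos] continuous_on_subset by blast
    have cH1: "continuous_on UNIV (H x)" for x
      unfolding H_def by (rule path_avg_continuous_snd[OF g2 v_pos])
    define J where "J x = integral (cbox 0 1) (H x)" for x
    have cJ: "continuous_on UNIV J"
      unfolding J_def[abs_def] by (rule integral_continuous_on_param[OF cH])
    have F_le: "F x powr q \<le> C1 * G2 powr e * J x" if x: "x \<in> ?Q" for x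
    proof -
      \<comment> \<open>Jensen's inequality: the tangent at the constant \<open>F x\<close> is
        integrated in s, and (q - 1) F^q cancels.\<close>
      have I1: "integral (cbox 0 1) (\<lambda>s. q * F x powr (q - 1) * \<phi> x s)
          \<le> integral (cbox 0 1) (\<lambda>s. C1 * G2 powr e * H x s + (q - 1) * F x powr q)"
      proof (rule integral_le)
        fix s :: real assume s: "s \<in> cbox 0 1"
        have "q * F x powr (q - 1) * \<phi> x s \<le> \<phi> x s powr q + (q - 1) * F x powr q"
          using q s by (intro Young_tangent \<phi>0 F0) auto
        then show "q * F x powr (q - 1) * \<phi> x s \<le> C1 * G2 powr e * H x s + (q - 1) * F x powr q"
          using \<phi>_le[OF x, of s] s by simp
      qed (intro integrable_on_cbox_if_continuous continuous_intros c\<phi> cH1)+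
      have I2: "integral (cbox 0 1) (\<lambda>s. q * F x powr (q - 1) * \<phi> x s) = q * F x powr (q - 1) * F x"
        by (simp add: F_def)
      have I3: "integral (cbox 0 1) (\<lambda>s. C1 * G2 powr e * H x s + (q - 1) * F x powr q)
          = C1 * G2 powr e * J x + (q - 1) * F x powr q"
      proof -
        have "integral (cbox 0 1) (\<lambda>s. C1 * G2 powr e * H x s + (q - 1) * F x powr q)
          = integral (cbox 0 1) (\<lambda>s. C1 * G2 powr e * H x s) + integral (cbox 0 1) (\<lambda>s::real. (q - 1) * F x powr q)"
          by (intro integral_add integrable_on_cbox_if_continuous continuous_intros cH1)
        then show ?thesis by (simp add: J_def)
      qed
      have I4: "F x powr (q - 1) * F x = F x powr q"
        using powr_add[of "F x" "q - 1" 1] F0[of x] by simp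
      have "q * F x powr q \<le> C1 * G2 powr e * J x + (q - 1) * F x powr q"
        using I1 unfolding I2 I3 by (simp only: mult.assoc I4)
      then show ?thesis by (simp add: left_diff_distrib)
    qed
    have J_int: "integral ?Q J \<le> 2 ^ ?d * G2"
    proof -
      have "integral ?Q J = integral (cbox 0 1) (\<lambda>s. integral ?Q (\<lambda>x. H x s))"
        unfolding J_def[abs_def] by (rule integral_swap_continuous[OF cH])
      also have "\<dots> \<le> integral (cbox 0 1) (\<lambda>s::real. 2 ^ ?d * G2)"
      proof (rule integral_le)
        have "continuous_on UNIV (\<lambda>s. integral ?Q (\<lambda>x. H x s))"
        proof (rule integral_continuous_on_param)
          have "continuous_on (UNIV \<times> ?Q) (\<lambda>p. path_avg a b g2 k (fst (snd p, fst p)) (snd (snd p, fst p)))"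
            by (rule continuous_on_compose2[OF path_avg_continuous[OF g2 v_pos]]) (auto intro!: continuous_intros)
          then show "continuous_on (UNIV \<times> ?Q) (\<lambda>(s, x). H x s)" by (simp add: H_def split_beta)
        qed
        then show "(\<lambda>s. integral ?Q (\<lambda>x. H x s)) integrable_on cbox 0 1"
          by (rule integrable_on_cbox_if_continuous)
        show "(\<lambda>s::real. 2 ^ ?d * G2) integrable_on cbox 0 1"
          by (intro integrable_on_cbox_if_continuous continuous_intros)
        fix s :: real assume "s \<in> cbox 0 1"
        then show "integral ?Q (\<lambda>x. H x s) \<le> 2 ^ ?d * G2"
          unfolding H_def G2_def by (intro integral_path_avg_le[OF g2 v_pos]) auto
      qed
      finally show ?thesis by simp
    qed
    have "integral ?Q (\<lambda>x. \<bar>u x\<bar> powr q) \<le> integral ?Q (\<lambda>x. 2 powr q * m powr q + 2 powr q * C1 * G2 powr e * J x)"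
    proof (rule integral_le)
      show "(\<lambda>x. \<bar>u x\<bar> powr q) integrable_on ?Q"
        using q cu by (intro integrable_on_cbox_if_continuous continuous_on_powr' continuous_intros) auto
      show "(\<lambda>x. 2 powr q * m powr q + 2 powr q * C1 * G2 powr e * J x) integrable_on ?Q"
        by (intro integrable_on_cbox_if_continuous continuous_intros cJ)
      fix x assume x: "x \<in> ?Q"
      have "\<bar>u x\<bar> powr q \<le> (m + F x) powr q" using q u_le[OF x] by (intro powr_mono2) auto
      also have "\<dots> \<le> 2 powr q * (m powr q + F x powr q)" using q m0 F0 by (intro powr_add_le) auto
      also have "\<dots> \<le> 2 powr q * (m powr q + C1 * G2 powr e * J x)"
        by (intro mult_left_mono add_left_mono F_le x) auto
      finally show "\<bar>u x\<bar> powr q \<le> 2 powr q * m powr q + 2 powr q * C1 * G2 powr e * J x"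
        by (simp add: distrib_left mult.assoc)
    qed
    also have "\<dots> = 2 powr q * m powr q * v + 2 powr q * C1 * G2 powr e * integral ?Q J"
    proof -
      have "integral ?Q (\<lambda>x. 2 powr q * m powr q + 2 powr q * C1 * G2 powr e * J x)
          = integral ?Q (\<lambda>x. 2 powr q * m powr q) + integral ?Q (\<lambda>x. 2 powr q * C1 * G2 powr e * J x)"
        by (intro integral_add integrable_on_cbox_if_continuous continuous_intros cJ)
      then show ?thesis by (simp add: v_def mult.commute)
    qed
    also have "\<dots> \<le> 2 powr q * ((1 / v) powr (q / 2) * E2 powr (q / 2)) * v + 2 powr q * C1 * (2 ^ ?d * E2 powr (q / 2))"
    proof (rule add_mono)
      have "m\<^sup>2 \<le> E2 / v"
      proof -
        have "(integral ?Q (\<lambda>x. \<bar>u x\<bar>))\<^sup>2 \<le> integral ?Q (\<lambda>x. \<bar>u x\<bar>\<^sup>2) * v"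
          unfolding v_def using cu by (intro integral_square_le continuous_intros)
        also have "\<dots> \<le> E2 * v" using v nonneg E2 by (intro mult_right_mono) auto
        finally show ?thesis using v by (simp add: m_def power_divide power2_eq_square field_simps)
      qed
      then have "(m\<^sup>2) powr (q / 2) \<le> (E2 / v) powr (q / 2)" using q by (intro powr_mono2) auto
      moreover have "(m\<^sup>2) powr (q / 2) = m powr q"
      proof -
        have "m\<^sup>2 = m powr 2" using m0 by (simp add: powr_numeral)
        then show ?thesis by (simp only: powr_powr) simp
      qed
      moreover have "(E2 / v) powr (q / 2) = (1 / v) powr (q / 2) * E2 powr (q / 2)"
        using E2 nonneg v by (simp add: powr_mult[symmetric])
      ultimately show "2 powr q * m powr q * v \<le> 2 powr q * ((1 / v) powr (q / 2) * E2 powr (q / 2)) * v"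
        using v by (intro mult_right_mono mult_left_mono) auto
      have "G2 powr e * integral ?Q J \<le> G2 powr e * (2 ^ ?d * G2)"
        by (intro mult_left_mono J_int) auto
      also have "\<dots> = 2 ^ ?d * (G2 powr e * G2)" by simp
      also have "G2 powr e * G2 = G2 powr (q / 2)"
        using powr_add[of G2 e 1] nonneg by (simp add: e_def field_simps)
      also have "\<dots> \<le> E2 powr (q / 2)" using E2 nonneg q by (intro powr_mono2) auto
      finally have "G2 powr e * integral ?Q J \<le> 2 ^ ?d * E2 powr (q / 2)" by simp
      then have "2 powr q * C1 * (G2 powr e * integral ?Q J) \<le> 2 powr q * C1 * (2 ^ ?d * E2 powr (q / 2))"
        using C1 by (intro mult_left_mono) auto
      then show "2 powr q * C1 * G2 powr e * integral ?Q J \<le> 2 powr q * C1 * (2 ^ ?d * E2 powr (q / 2))"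
        by (simp only: mult.assoc)
    qed
    also have "\<dots> = C * E2 powr (q / 2)" by (simp add: C_def algebra_simps)
    finally show ?thesis by (simp add: E2_def g2_def g_def)
  qed
  show ?thesis by (rule that[OF C main])
qed

section \<open>From continuous functions on the closed box to the space X\<close>

lemma Lint_continuous_eq_integral:
  assumes "continuous_on UNIV f"
  shows "Lint a b f = integral (cbox a b) f"
proof -
  have "bounded (f ` cbox a b)"
    using assms continuous_on_subset by (intro compact_imp_bounded compact_continuous_image compact_cbox) blast
  then obtain B where "\<forall>x\<in>cbox a b. \<bar>f x\<bar> \<le> B" by (auto simp: bounded_iff)
  then have "integrable (lebesgue_on (Omega a b)) f"
    using box_subset_cbox[of a b]
    by (intro bounded_integrable_Omega[of _ _ _ B] continuous_measurable_Omega assms) (auto simp: Omega_def)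
  then have "Lint a b f = integral (Omega a b) f"
    unfolding Lint_def by (intro lebesgue_integral_eq_integral) auto
  then show ?thesis by (simp add: Omega_def integral_open_interval)
qed

lemma Lnorm_le_if_nn_integral_le:
  assumes f: "f \<in> borel_measurable M" and q: "q > 0" and B: "0 \<le> B"
    and le: "(\<integral>\<^sup>+x. ennreal (\<bar>f x\<bar> powr q) \<partial>M) \<le> ennreal (B powr q)"
  shows "integrable M (\<lambda>x. \<bar>f x\<bar> powr q)" "Lnorm M q f \<le> B"
proof -
  have m: "(\<lambda>x. \<bar>f x\<bar> powr q) \<in> borel_measurable M" using f by measurable
  show I: "integrable M (\<lambda>x. \<bar>f x\<bar> powr q)"
    using le by (intro integrableI_bounded m) (auto intro: le_less_trans)
  have "ennreal (\<integral>x. \<bar>f x\<bar> powr q \<partial>M) \<le> ennreal (B powr q)"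
    using le nn_integral_eq_integral[OF I] by simp
  then have "(\<integral>x. \<bar>f x\<bar> powr q \<partial>M) \<le> B powr q" by (simp add: ennreal_le_iff)
  then have "Lnorm M q f \<le> (B powr q) powr (1 / q)"
    unfolding Lnorm_def using q by (intro powr_mono2) (auto intro: integral_nonneg_AE)
  then show "Lnorm M q f \<le> B" using q B by (simp add: powr_powr)
qed

lemma Sobolev_smooth:
  fixes a b :: "real^'d" and q :: real
  assumes box: "\<forall>i. a $ i < b $ i" and q: "q > 2" "CARD('d) * (q - 2) < 2 * q"
  obtains S where "S > 0" "\<And>\<phi>. smooth \<phi> \<Longrightarrow> Lint a b (\<lambda>x. \<bar>\<phi> x\<bar> powr q) \<le> (S * H1_norm a b \<phi>) powr q"
proof -
  have "measure lborel (cbox a b) > 0"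
    using box by (subst content_pos_lt_eq) (auto simp: Basis_vec_def inner_axis)
  then obtain C where C: "C > 0" and Sob:
    "\<And>u Du. (\<And>x. (u has_derivative (\<lambda>h. Du x \<bullet> h)) (at x)) \<Longrightarrow> continuous_on UNIV Du \<Longrightarrow>
       integral (cbox a b) (\<lambda>x. \<bar>u x\<bar> powr q)
         \<le> C * integral (cbox a b) (\<lambda>x. (u x)\<^sup>2 + (norm (Du x))\<^sup>2) powr (q / 2)"
    by (rule Sobolev_box[where q = q]) (use q in simp_all)
  define S where "S = C powr (1 / q)"
  have "Lint a b (\<lambda>x. \<bar>\<phi> x\<bar> powr q) \<le> (S * H1_norm a b \<phi>) powr q" if \<phi>: "smooth \<phi>" for \<phi>
  proof -
    let ?D = "\<lambda>x. \<chi> i. pd [i] \<phi> x"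
    have c: "continuous_on UNIV \<phi>" "continuous_on UNIV ?D"
      using smooth_continuous[OF \<phi>] smooth_continuous[OF smooth_pd[OF \<phi>]]
      by (auto intro!: continuous_on_vec_lambda simp del: pd.simps)
    have cp: "continuous_on UNIV (\<lambda>x. \<bar>\<phi> x\<bar> powr q)"
      using q c by (intro continuous_on_powr' continuous_intros) auto
    have ce: "continuous_on UNIV (\<lambda>x. (\<phi> x)\<^sup>2 + (norm (?D x))\<^sup>2)"
      by (intro continuous_on_add continuous_on_power continuous_on_norm c)
    have "H1_form a b \<phi> \<phi> = Lint a b (\<lambda>x. (\<phi> x)\<^sup>2 + (norm (?D x))\<^sup>2)"
    proof -
      note H = H1_smooth[OF \<phi>, of a b]
      have "H1_form a b \<phi> \<phi> = Lint a b (\<lambda>x. \<phi> x * \<phi> x + inner (wgrad a b \<phi> x) (wgrad a b \<phi> x))"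
        unfolding H1_form_def grad_form_def Lint_def
        using H by (intro Bochner_Integration.integral_add[symmetric] L2_mult_integrable grad_integrable) (auto simp: H1_def)
      also have "\<dots> = Lint a b (\<lambda>x. (\<phi> x)\<^sup>2 + (norm (?D x))\<^sup>2)"
        unfolding Lint_def
      proof (rule integral_cong_AE)
        show "AE x in lebesgue_on (Omega a b). \<phi> x * \<phi> x + inner (wgrad a b \<phi> x) (wgrad a b \<phi> x) = (\<phi> x)\<^sup>2 + (norm (?D x))\<^sup>2"
          using wgrad_smooth[OF \<phi>, of a b]
          by eventually_elim (simp add: power2_norm_eq_inner power2_eq_square[of "\<phi> _"] del: pd.simps)
        show "(\<lambda>x. \<phi> x * \<phi> x + inner (wgrad a b \<phi> x) (wgrad a b \<phi> x)) \<in> borel_measurable (lebesgue_on (Omega a b))"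
          using H by (intro borel_measurable_add borel_measurable_times borel_measurable_inner wgrad_measurable
              continuous_measurable_Omega c)
      qed (intro continuous_measurable_Omega ce)
      finally show ?thesis .
    qed
    then have E: "integral (cbox a b) (\<lambda>x. (\<phi> x)\<^sup>2 + (norm (?D x))\<^sup>2) = H1_form a b \<phi> \<phi>"
      by (simp add: Lint_continuous_eq_integral[OF ce] del: pd.simps)
    have "Lint a b (\<lambda>x. \<bar>\<phi> x\<bar> powr q) = integral (cbox a b) (\<lambda>x. \<bar>\<phi> x\<bar> powr q)"
      by (rule Lint_continuous_eq_integral[OF cp])
    also have "\<dots> \<le> C * H1_form a b \<phi> \<phi> powr (q / 2)"
      using Sob[OF smooth_has_derivative[OF \<phi>] c(2)] unfolding E .
    also have "\<dots> = (S * H1_norm a b \<phi>) powr q"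
    proof -
      have "H1_norm a b \<phi> powr q = H1_form a b \<phi> \<phi> powr (q / 2)"
        unfolding H1_norm_eq powr_half_sqrt[OF H1_form_nonneg, symmetric] by (simp add: powr_powr)
      then show ?thesis using C q by (simp add: powr_mult S_def powr_powr)
    qed
    finally show ?thesis .
  qed
  moreover have "S > 0" using C by (simp add: S_def)
  ultimately show ?thesis using that by blast
qed

text \<open>Smooth approximants converge in L2, hence almost everywhere along a subsequence, and
  Fatou transfers their uniform bound to u. Only smoothness of the approximants matters, so one
  constant serves both boundary conditions.\<close>

lemma Sobolev_Xsp:
  fixes a b :: "real^'d" and q :: real
  assumes box: "\<forall>i. a $ i < b $ i" and q: "q > 2" "CARD('d) * (q - 2) < 2 * q"
  obtains S where "S > 0"
    "\<And>c u. Xsp c a b u \<Longrightarrow> integrable (lebesgue_on (Omega a b)) (\<lambda>x. \<bar>u x\<bar> powr q) \<and>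
       Lnorm (lebesgue_on (Omega a b)) q u \<le> S * H1_norm a b u"
proof -
  obtain S where S: "S > 0" and
    Sob: "\<And>\<phi>. smooth \<phi> \<Longrightarrow> Lint a b (\<lambda>x. \<bar>\<phi> x\<bar> powr q) \<le> (S * H1_norm a b \<phi>) powr q"
    by (rule Sobolev_smooth[OF box q]) (rule that)
  let ?M = "lebesgue_on (Omega a b)"
  have key: "integrable ?M (\<lambda>x. \<bar>u x\<bar> powr q) \<and> Lnorm ?M q u \<le> S * (H1_norm a b u + \<epsilon>)"
    if u: "Xsp c a b u" and \<epsilon>: "\<epsilon> > 0" for c u \<epsilon>
  proof -
    note uH = Xsp_H1[OF u]
    \<comment> \<open>1 / (n+1) drives the convergence, while \<epsilon> bounds the norms of all
      approximants by that of u plus \<epsilon>; \<epsilon> tends to 0 at the end.\<close>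
    have "\<exists>\<phi>. smooth \<phi> \<and> H1_norm a b (\<lambda>x. u x - \<phi> x) < min \<epsilon> (1 / real (Suc n))" for n
    proof -
      have "min \<epsilon> (1 / real (Suc n)) > 0" using \<epsilon> by simp
      from Xsp_smooth_approx[OF u this] show ?thesis by blast
    qed
    then obtain \<phi> where \<phi>: "\<And>n. smooth (\<phi> n)" "\<And>n. H1_norm a b (\<lambda>x. u x - \<phi> n x) < min \<epsilon> (1 / real (Suc n))"
      by metis
    have dH: "H1 a b (\<lambda>x. u x - \<phi> n x)" for n
      using H1_lincomb[OF uH H1_smooth[OF \<phi>(1)], of "-1" n] by simp
    have lim: "(\<lambda>n. \<integral>x. norm ((u x - \<phi> n x)\<^sup>2) \<partial>?M) \<longlonglongrightarrow> 0"
    proof (rule tendsto_sandwich[OF _ _ tendsto_const])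
      show "\<forall>\<^sub>F n in sequentially. (\<integral>x. norm ((u x - \<phi> n x)\<^sup>2) \<partial>?M) \<le> (1 / real (Suc n))\<^sup>2"
      proof (intro always_eventually allI)
        fix n
        let ?w = "\<lambda>x. u x - \<phi> n x"
        have "(\<integral>x. norm ((?w x)\<^sup>2) \<partial>?M) \<le> H1_form a b ?w ?w"
          using grad_form_nonneg[of a b ?w] by (simp add: H1_form_def Lint_def power2_eq_square)
        also have "\<dots> = (H1_norm a b ?w)\<^sup>2" by (simp add: H1_norm_eq H1_form_nonneg)
        also have "\<dots> \<le> (1 / real (Suc n))\<^sup>2"
          using \<phi>(2)[of n] H1_norm_nonneg by (intro power_mono) auto
        finally show "(\<integral>x. norm ((?w x)\<^sup>2) \<partial>?M) \<le> (1 / real (Suc n))\<^sup>2" .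
      qed
      have "(\<lambda>n. (1 / real (Suc n))\<^sup>2) \<longlonglongrightarrow> 0\<^sup>2"
        by (intro tendsto_power LIMSEQ_Suc[OF lim_1_over_n])
      then show "(\<lambda>n. (1 / real (Suc n))\<^sup>2) \<longlonglongrightarrow> 0" by simp
    qed (auto intro!: always_eventually integral_nonneg_AE)
    have "integrable ?M (\<lambda>x. (u x - \<phi> n x)\<^sup>2)" for n
      using dH[of n] by (simp add: H1_def L2_def)
    from tendsto_L1_AE_subseq[OF this lim]
    obtain r :: "nat \<Rightarrow> nat" where r: "AE x in ?M. (\<lambda>n. (u x - \<phi> (r n) x)\<^sup>2) \<longlonglongrightarrow> 0" by blast
    have um: "u \<in> borel_measurable ?M" using uH by (simp add: H1_def L2_def)
    have \<phi>m: "\<phi> n \<in> borel_measurable ?M" for n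
      by (intro continuous_measurable_Omega smooth_continuous \<phi>)
    let ?B = "S * (H1_norm a b u + \<epsilon>)"
    have B0: "0 \<le> ?B" using S \<epsilon> H1_norm_nonneg[of a b u] by simp
    have "(\<integral>\<^sup>+x. ennreal (\<bar>u x\<bar> powr q) \<partial>?M) = (\<integral>\<^sup>+x. liminf (\<lambda>n. ennreal (\<bar>\<phi> (r n) x\<bar> powr q)) \<partial>?M)"
    proof (rule nn_integral_cong_AE)
      show "AE x in ?M. ennreal (\<bar>u x\<bar> powr q) = liminf (\<lambda>n. ennreal (\<bar>\<phi> (r n) x\<bar> powr q))"
        using r
      proof eventually_elim
        case (elim x)
        have "(\<lambda>n. sqrt ((u x - \<phi> (r n) x)\<^sup>2)) \<longlonglongrightarrow> sqrt 0" by (intro tendsto_real_sqrt elim)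
        then have "(\<lambda>n. u x - \<phi> (r n) x) \<longlonglongrightarrow> 0" by (simp add: tendsto_rabs_zero_iff)
        from tendsto_diff[OF tendsto_const[of "u x"] this]
        have "(\<lambda>n. \<phi> (r n) x) \<longlonglongrightarrow> u x" by simp
        then have "(\<lambda>n. ennreal (\<bar>\<phi> (r n) x\<bar> powr q)) \<longlonglongrightarrow> ennreal (\<bar>u x\<bar> powr q)"
          using q by (intro tendsto_ennrealI tendsto_powr' tendsto_rabs tendsto_const) auto
        then show ?case by (intro lim_imp_Liminf[symmetric]) auto
      qed
    qed
    also have "\<dots> \<le> liminf (\<lambda>n. \<integral>\<^sup>+x. ennreal (\<bar>\<phi> (r n) x\<bar> powr q) \<partial>?M)"
      using \<phi>m by (intro nn_integral_liminf) measurable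
    also have "\<dots> \<le> liminf (\<lambda>n. ennreal (?B powr q))"
    proof (intro Liminf_mono always_eventually allI)
      fix n
      let ?\<psi> = "\<phi> (r n)"
      obtain B where B: "\<And>x. x \<in> Omega a b \<Longrightarrow> \<bar>?\<psi> x\<bar> \<le> B"
        by (rule smooth_bounded_Omega[OF \<phi>(1), where a = a and b = b]) (rule that)
      have "integrable ?M (\<lambda>x. \<bar>?\<psi> x\<bar> powr q)"
        using \<phi>m[of "r n"] B q by (intro bounded_integrable_Omega[of _ _ _ "B powr q"]) (auto intro!: powr_mono2)
      then have "(\<integral>\<^sup>+x. ennreal (\<bar>?\<psi> x\<bar> powr q) \<partial>?M) = ennreal (Lint a b (\<lambda>x. \<bar>?\<psi> x\<bar> powr q))"
        unfolding Lint_def by (intro nn_integral_eq_integral) auto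
      also have "\<dots> \<le> ennreal ((S * H1_norm a b ?\<psi>) powr q)" by (intro ennreal_leI Sob \<phi>)
      also have "\<dots> \<le> ennreal (?B powr q)"
      proof (intro ennreal_leI powr_mono2 mult_left_mono)
        have "H1_norm a b (\<lambda>x. u x + (-1) * (u x - ?\<psi> x)) \<le> H1_norm a b u + \<bar>-1\<bar> * H1_norm a b (\<lambda>x. u x - ?\<psi> x)"
          by (rule H1_norm_lincomb[OF uH dH])
        also have "(\<lambda>x. u x + (-1) * (u x - ?\<psi> x)) = ?\<psi>" by auto
        finally show "H1_norm a b ?\<psi> \<le> H1_norm a b u + \<epsilon>" using \<phi>(2)[of "r n"] by simp
      qed (use S q in \<open>auto intro!: mult_nonneg_nonneg H1_norm_nonneg\<close>)
      finally show "(\<integral>\<^sup>+x. ennreal (\<bar>?\<psi> x\<bar> powr q) \<partial>?M) \<le> ennreal (?B powr q)" .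
    qed
    also have "\<dots> = ennreal (?B powr q)" by (intro Liminf_const) auto
    finally show ?thesis using Lnorm_le_if_nn_integral_le[OF um _ B0] q by auto
  qed
  have "integrable ?M (\<lambda>x. \<bar>u x\<bar> powr q) \<and> Lnorm ?M q u \<le> S * H1_norm a b u"
    if u: "Xsp c a b u" for c u
  proof
    show "integrable ?M (\<lambda>x. \<bar>u x\<bar> powr q)" using key[OF u zero_less_one] by blast
    show "Lnorm ?M q u \<le> S * H1_norm a b u"
    proof (rule field_le_epsilon)
      fix e :: real assume "e > 0"
      then have "Lnorm ?M q u \<le> S * (H1_norm a b u + e / S)" using key[OF u, of "e / S"] S by simp
      then show "Lnorm ?M q u \<le> S * H1_norm a b u + e" using S by (simp add: distrib_left)
    qed
  qed
  then show ?thesis using that[OF S] by blast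
qed

section \<open>Convergence of the scheme\<close>

text \<open>Subtracting the implicit operator applied to \<open>u\<close> from both sides moves its
  action onto the increment. The stabilising \<alpha> terms at \<open>u\<close> cancel and the full
  gradient \<open>G u\<close> is left on the right.\<close>

lemma (in nondegenerate_ground_state) precond_eq_if_weak_step:
  assumes u: "u \<in> X" and ut: "ut \<in> X" and v: "v \<in> X"
    and eq: "ip (\<lambda>x. ut x - u x) v / \<tau> = - (gr ut v / 2 + \<alpha> * ip ut v
      + (\<integral>x. (V x + \<omega> - q u u * \<bar>u x\<bar> powr (p - 1) - \<alpha>) * u x * v x \<partial>M))"
  shows "precond \<tau> \<alpha> (\<lambda>x. ut x - u x) v = - G u v"
proof -
  have "(\<integral>x. (V x + \<omega> - q u u * \<bar>u x\<bar> powr (p - 1) - \<alpha>) * u x * v x \<partial>M)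
      = (\<integral>x. V x * u x * v x + \<omega> * (u x * v x) - q u u * (\<bar>u x\<bar> powr (p - 1) * u x * v x) - \<alpha> * (u x * v x) \<partial>M)"
    by (simp add: algebra_simps)
  also have "\<dots> = Vf u v + \<omega> * ip u v - q u u * W u u v - \<alpha> * ip u v"
    using V_integrable[OF u v] ip_integrable[OF u v] W_integrable[OF u u v]
    by (simp add: Vf_def ip_def W_def)
  finally have I: "(\<integral>x. (V x + \<omega> - q u u * \<bar>u x\<bar> powr (p - 1) - \<alpha>) * u x * v x \<partial>M)
      = Vf u v + \<omega> * ip u v - q u u * W u u v - \<alpha> * ip u v" .
  have "precond \<tau> \<alpha> (\<lambda>x. ut x - u x) v
      = ip (\<lambda>x. ut x - u x) v / \<tau> + (gr ut v - gr u v) / 2 + \<alpha> * (ip ut v - ip u v)"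
    unfolding precond_def form_diff[OF gr_form ut u v]
    using form_diff[OF ip_form ut u v] by simp
  then show ?thesis
    unfolding eq I G_def q_def[of u v] by (simp add: field_simps)
qed

text \<open>(A1) in the shape required by the Sobolev inequality with q = p + 1; in dimensions 1 and
  2 it holds for every p because 2 (p-1) < 2 (p+1).\<close>

lemma subcritical_exponent:
  fixes d :: nat and p :: real
  assumes "1 < p" "3 \<le> d \<Longrightarrow> p < (real d + 2) / (real d - 2)"
  shows "real d * (p - 1) < 2 * (p + 1)"
proof (cases "3 \<le> d")
  case True
  then have "p * (real d - 2) < real d + 2" using assms by (simp add: field_simps)
  then show ?thesis by (simp add: algebra_simps)
next
  case False
  then have "real d \<le> 2" by simp
  then have "real d * (p - 1) \<le> 2 * (p - 1)" using assms by (intro mult_right_mono) auto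
  then show ?thesis by simp
qed

lemma Lp_norm_eq: "Lp_norm a b r u = Lnorm (lebesgue_on (Omega a b)) r u"
  by (simp add: Lp_norm_def Lnorm_def Lint_def)

lemma L2_norm_sq: "(L2_norm a b u)\<^sup>2 = Lint a b (\<lambda>x. u x * u x)"
  unfolding L2_norm_def power2_eq_square[of "u _"]
  by (rule real_sqrt_pow2) (auto simp: Lint_def intro!: integral_nonneg_AE)

theorem mainTheorem8:
  fixes a b :: "real^'d" and c :: bc and V :: "real^'d \<Rightarrow> real"
    and \<omega> p \<alpha> :: real and ug :: "real^'d \<Rightarrow> real"
  assumes box_nonempty: "\<forall>i. a $ i < b $ i"
    and A1_p: "1 < p \<and> (CARD('d) \<ge> 3 \<longrightarrow> p < (real CARD('d) + 2) / (real CARD('d) - 2))"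
    and A1_V_meas: "V \<in> borel_measurable (lebesgue_on (Omega a b))"
    and A1_V_bdd: "\<exists>M. AE x in lebesgue_on (Omega a b). \<bar>V x\<bar> \<le> M"
    and A1_V_nonneg: "AE x in lebesgue_on (Omega a b). V x \<ge> 0"
    and A2: "\<omega> > - lambda0 c a b V"
    and alpha: "ereal \<alpha> \<ge> max 0 (esssup (lebesgue_on (Omega a b)) (\<lambda>x. ereal (V x + \<omega>))) / 2 + 1 / 2"
    and gs: "ground_state c a b V \<omega> p ug"
    and ND: "nondegenerate c a b V \<omega> p ug"
  shows "\<exists>\<delta>0>0. \<forall>u0. Xsp c a b u0 \<and> Lp_norm a b (p + 1) u0 = 1
           \<and> H1_norm a b (\<lambda>x. u0 x - ug x) \<le> \<delta>0 \<longrightarrow>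
         (\<exists>C>0. \<exists>k>0. \<forall>\<tau>>0. \<forall>u ut. u 0 = u0 \<and>
             (\<forall>n. gfalm_step c a b V \<omega> p \<tau> \<alpha> (u n) (ut (Suc n)) (u (Suc n))) \<longrightarrow>
           (\<forall>n. H1_norm a b (\<lambda>x. u n x - ug x) \<le> C * exp (- k * real n * \<tau> / (1 + \<tau>))))"
proof -
  let ?M = "lebesgue_on (Omega a b)" and ?X = "{u. Xsp c a b u}"
  have p: "p > 1" using A1_p by simp
  have crit: "CARD('d) * (p - 1) < 2 * (p + 1)" using A1_p by (intro subcritical_exponent) auto
  obtain S where S: "S > 0" and Sob: "\<And>c u. Xsp c a b u \<Longrightarrow> integrable ?M (\<lambda>x. \<bar>u x\<bar> powr (p + 1)) \<and>
       Lnorm ?M (p + 1) u \<le> S * H1_norm a b u"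
    by (rule Sobolev_Xsp[OF box_nonempty, of "p + 1"]) (use p crit in auto)
  obtain KV where KV: "KV \<ge> 0" and V: "AE x in ?M. 0 \<le> V x \<and> V x \<le> KV"
  proof -
    obtain B where "AE x in ?M. \<bar>V x\<bar> \<le> B" using A1_V_bdd by blast
    with A1_V_nonneg have "AE x in ?M. 0 \<le> V x \<and> V x \<le> max B 0" by eventually_elim auto
    then show ?thesis using that[of "max B 0"] by simp
  qed
  have form: "sym_form ?X (grad_form a b)"
    by (rule sym_form_subset[OF grad_form_sym_form]) (auto intro: Xsp_H1)
  have XL2: "u \<in> borel_measurable ?M" "integrable ?M (\<lambda>x. (u x)\<^sup>2)" if "Xsp c a b u" for u
    using Xsp_H1[OF that] by (auto simp: H1_def L2_def)
  interpret ES: energy_space ?X ?M "grad_form a b" V \<omega> p S KV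
  proof unfold_locales
    show "Lnorm ?M (p + 1) u \<le> S * sqrt ((\<integral>x. u x * u x \<partial>?M) + grad_form a b u u)" if "u \<in> ?X" for u
      using Sob that by (simp add: H1_norm_eq H1_form_def Lint_def)
  qed (use Sob XL2 form A1_V_meas V p S KV in \<open>auto simp: grad_form_nonneg intro: Xsp_lincomb\<close>)
  have qQ: "ES.q u u = Qf a b V \<omega> u" for u
    unfolding ES.q_def ES.Vf_def ES.ip_def Qf_def grad_sq_eq L2_norm_sq Lint_def
    by (simp add: power2_eq_square mult.assoc)
  have hnH: "ES.hn u = H1_norm a b u" for u
    by (simp add: ES.hn_def ES.H_def ES.ip_def H1_norm_eq H1_form_def Lint_def)
  \<comment> \<open>(A2) enters here: by scaling to the L2 unit sphere, \<open>lambda0\<close> times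
    the squared L2-norm bounds the energy without the \<omega> term.\<close>
  have nonneg: "0 \<le> ES.q u u" if u: "u \<in> ?X" for u
  proof -
    let ?E = "\<lambda>u v. grad_form a b u v / 2 + ES.Vf u v"
    have E_form: "sym_form ?X ?E" by (intro sym_form_intros form ES.Vf_form)
    have E0: "0 \<le> ?E w w" for w using grad_form_nonneg[of a b w] ES.Vf_nonneg[of w] by simp
    have ipL: "ES.ip w w = (L2_norm a b w)\<^sup>2" for w by (simp add: ES.ip_def L2_norm_sq Lint_def)
    show ?thesis
    proof (cases "L2_norm a b u = 0")
      case True
      then show ?thesis using E0[of u] by (simp add: ES.q_def ipL)
    next
      case False
      let ?n = "L2_norm a b u"
      let ?v = "\<lambda>x. (1 / ?n) * u x"
      have v: "?v \<in> ?X" by (rule ES.scale_mem[OF u])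
      have "(L2_norm a b ?v)\<^sup>2 = 1"
        using False ES.form_scale_both[OF ES.ip_form u, of "1 / ?n"] unfolding ipL by (simp add: power_divide)
      moreover have "0 \<le> L2_norm a b ?v" by (simp add: L2_norm_def Lint_def integral_nonneg_AE)
      ultimately have n1: "L2_norm a b ?v = 1" by (simp add: power2_eq_1_iff)
      have "lambda0 c a b V \<le> ?E ?v ?v"
        unfolding lambda0_def
      proof (rule cInf_lower)
        show "?E ?v ?v \<in> {grad_sq a b u / 2 + Lint a b (\<lambda>x. V x * (u x)\<^sup>2) |u. Xsp c a b u \<and> L2_norm a b u = 1}"
          using v n1 by (auto simp: grad_sq_eq ES.Vf_def Lint_def power2_eq_square mult.assoc intro!: exI[of _ ?v])
        \<comment> \<open>A real \<open>Inf\<close> is a lower bound only for a set bounded below; 0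
          serves because V is nonnegative almost everywhere.\<close>
        show "bdd_below {grad_sq a b u / 2 + Lint a b (\<lambda>x. V x * (u x)\<^sup>2) |u. Xsp c a b u \<and> L2_norm a b u = 1}"
        proof (rule bdd_belowI[of _ 0])
          fix z assume "z \<in> {grad_sq a b u / 2 + Lint a b (\<lambda>x. V x * (u x)\<^sup>2) |u. Xsp c a b u \<and> L2_norm a b u = 1}"
          then obtain w where "z = ?E w w"
            by (auto simp: grad_sq_eq ES.Vf_def Lint_def power2_eq_square mult.assoc)
          then show "0 \<le> z" using E0 by simp
        qed
      qed
      also have "?E ?v ?v = (1 / ?n)\<^sup>2 * ?E u u" by (rule ES.form_scale_both[OF E_form u])
      finally have "lambda0 c a b V * ?n\<^sup>2 \<le> ?E u u" using False by (simp add: field_simps)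
      moreover have "- \<omega> * ?n\<^sup>2 \<le> lambda0 c a b V * ?n\<^sup>2" using A2 by (intro mult_right_mono) auto
      ultimately show ?thesis by (simp add: ES.q_def ipL)
    qed
  qed
  obtain k where k: "k > 0" and nd: "\<And>\<xi>. Xsp c a b \<xi> \<Longrightarrow>
      L2_inner a b (\<lambda>x. \<bar>ug x\<bar> powr (p - 1) * ug x) \<xi> = 0 \<Longrightarrow>
      k * (H1_norm a b \<xi>)\<^sup>2 \<le> Qf a b V \<omega> \<xi> - p * Qf a b V \<omega> ug * Lint a b (\<lambda>x. \<bar>ug x\<bar> powr (p - 1) * (\<xi> x)\<^sup>2)"
    using ND unfolding nondegenerate_def by blast
  interpret GS: nondegenerate_ground_state ?X ?M "grad_form a b" V \<omega> p S KV ug k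
  proof unfold_locales
    show "ug \<in> ?X" "Lnorm ?M (p + 1) ug = 1"
      using gs by (auto simp: ground_state_def Lp_norm_eq)
    show "ES.q ug ug \<le> ES.q u u" if "u \<in> ?X" "Lnorm ?M (p + 1) u = 1" for u
      using gs that by (auto simp: ground_state_def Lp_norm_eq qQ)
    show "k * ES.H \<xi> \<xi> \<le> ES.q \<xi> \<xi> - p * ES.q ug ug * ES.W ug \<xi> \<xi>" if "\<xi> \<in> ?X" "ES.W ug ug \<xi> = 0" for \<xi>
      using nd[of \<xi>] that ES.hn_sq[OF that(1)]
      by (simp add: qQ hnH ES.W_def L2_inner_def Lint_def power2_eq_square mult.assoc)
  qed (use nonneg k in auto)
  have \<alpha>V: "\<alpha> \<ge> 1 / 2" "AE x in ?M. V x + \<omega> \<le> 2 * \<alpha> - 1"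
  proof -
    let ?s = "esssup ?M (\<lambda>x. ereal (V x + \<omega>))"
    have fin: "max 0 ?s / 2 + 1 / 2 \<le> ereal \<alpha>" by (rule alpha)
    \<comment> \<open>The essential supremum is an extended real; its positive part is finite, lying
      between 0 and a bound in terms of \<alpha>.\<close>
    obtain r where r: "max 0 ?s = ereal r"
      using fin by (cases "max 0 ?s") (auto simp: max_def split: if_splits)
    have r0: "0 \<le> r" using r by (metis ereal_less_eq(5) max.cobounded1)
    have "ereal (r / 2 + 1 / 2) \<le> ereal \<alpha>" using fin unfolding r by (simp add: one_ereal_def)
    then have ra: "r / 2 + 1 / 2 \<le> \<alpha>" by simp
    then show "\<alpha> \<ge> 1 / 2" using r0 by simp
    have "AE x in ?M. ereal (V x + \<omega>) \<le> ?s" by (rule esssup_AE)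
    then show "AE x in ?M. V x + \<omega> \<le> 2 * \<alpha> - 1"
    proof eventually_elim
      case (elim x)
      then have "ereal (V x + \<omega>) \<le> ereal r" unfolding r[symmetric] by (simp add: le_max_iff_disj)
      then show ?case using ra by simp
    qed
  qed
  \<comment> \<open>These constants are fixed before the initial datum, the step size and the
    iterates, hence uniform in all of them.\<close>
  obtain \<delta> C e where \<delta>: "\<delta> > 0" and C: "C > 0" and e: "e > 0" and conv:
    "\<And>\<tau> u ut n. \<tau> > 0 \<Longrightarrow> u 0 \<in> ?X \<Longrightarrow> Lnorm ?M (p + 1) (u 0) = 1 \<Longrightarrow> ES.hn (GS.err (u 0)) \<le> \<delta> \<Longrightarrow>
      (\<And>n. ut (Suc n) \<in> ?X) \<Longrightarrow>
      (\<And>n. u (Suc n) = (\<lambda>x. ut (Suc n) x / Lnorm ?M (p + 1) (ut (Suc n)))) \<Longrightarrow>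
      (\<And>n v. u n \<in> ?X \<Longrightarrow> Lnorm ?M (p + 1) (u n) = 1 \<Longrightarrow> v \<in> ?X \<Longrightarrow>
         GS.precond \<tau> \<alpha> (\<lambda>x. ut (Suc n) x - u n x) v = - GS.G (u n) v) \<Longrightarrow>
      ES.hn (GS.err (u n)) \<le> C * exp (- e * real n * \<tau> / (1 + \<tau>))"
  proof (rule GS.exponential_convergence[OF \<alpha>V], goal_cases)
    case (1 \<delta> C e)
    show ?case by (rule 1(1)[OF 1(2-4)]) (rule 1(5))
  qed
  show ?thesis
  proof (rule exI[of _ \<delta>], rule conjI[OF \<delta>], intro allI impI, elim conjE)
    fix u0 assume u0: "Xsp c a b u0" "Lp_norm a b (p + 1) u0 = 1" "H1_norm a b (\<lambda>x. u0 x - ug x) \<le> \<delta>"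
    show "\<exists>C>0. \<exists>k>0. \<forall>\<tau>>0. \<forall>u ut. u 0 = u0 \<and>
             (\<forall>n. gfalm_step c a b V \<omega> p \<tau> \<alpha> (u n) (ut (Suc n)) (u (Suc n))) \<longrightarrow>
           (\<forall>n. H1_norm a b (\<lambda>x. u n x - ug x) \<le> C * exp (- k * real n * \<tau> / (1 + \<tau>)))"
    proof (rule exI[of _ C], rule conjI[OF C], rule exI[of _ e], rule conjI[OF e], intro allI impI, elim conjE)
      fix \<tau> :: real and u ut n
      assume \<tau>: "\<tau> > 0" and u: "u 0 = u0"
        and step: "\<forall>n. gfalm_step c a b V \<omega> p \<tau> \<alpha> (u n) (ut (Suc n)) (u (Suc n))"
      have X: "ut (Suc n) \<in> ?X" for n
        using step[rule_format, of n] by (simp add: gfalm_step_def)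
      have "ES.hn (GS.err (u n)) \<le> C * exp (- e * real n * \<tau> / (1 + \<tau>))"
      proof (rule conv[OF \<tau>, of u ut n])
        show "u (Suc n) = (\<lambda>x. ut (Suc n) x / Lnorm ?M (p + 1) (ut (Suc n)))" for n
          using step[rule_format, of n] by (simp add: gfalm_step_def Lp_norm_eq)
        show "GS.precond \<tau> \<alpha> (\<lambda>x. ut (Suc n) x - u n x) v = - GS.G (u n) v"
          if un: "u n \<in> ?X" "Lnorm ?M (p + 1) (u n) = 1" "v \<in> ?X" for n v
        proof (rule GS.precond_eq_if_weak_step[OF un(1) X un(3)])
          \<comment> \<open>On the unit sphere the denominator of \<open>lambda_tilde\<close> is
            1.\<close>
          have "lambda_tilde a b V \<omega> p (u n) = ES.q (u n) (u n)"
            using un(2) by (simp add: lambda_tilde_def Lp_norm_eq qQ)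
          then show "ES.ip (\<lambda>x. ut (Suc n) x - u n x) v / \<tau> = - (grad_form a b (ut (Suc n)) v / 2
              + \<alpha> * ES.ip (ut (Suc n)) v
              + (\<integral>x. (V x + \<omega> - ES.q (u n) (u n) * \<bar>u n x\<bar> powr (p - 1) - \<alpha>) * u n x * v x \<partial>?M))"
            using step[rule_format, of n] un(3)
            by (simp add: gfalm_step_def ES.ip_def grad_form_def L2_inner_def Lint_def)
        qed
      qed (use u0 u X in \<open>auto simp: hnH GS.err_def Lp_norm_eq\<close>)
      then show "H1_norm a b (\<lambda>x. u n x - ug x) \<le> C * exp (- e * real n * \<tau> / (1 + \<tau>))"
        by (simp add: hnH GS.err_def)
    qed
  qed
qed

end
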